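(* Let $H$ satisfy the standing assumptions (i)--(iv) of the context. Assume that there exist $R_0>0$ and $\tilde{H}:\mathbb{R}^d\times\mathbb{R}^d\times\Omega\to\mathbb{R}$, also satisfying (i)--(iv) (with $\tilde H$ in place of $H$), such that $$\tilde{H}(p,y,\omega)=H(p,y,\omega)\quad\text{for all }(p,y,\omega)\in(\mathbb{R}^d\setminus B_{R_0})\times\mathbb{R}^d\times\Omega,$$ and such that, for each $y\in\mathbb{R}^d$ and $\omega\in\Omega$, the map $p\mapsto\tilde{H}(p,y,\omega)$ is convex. Then there exist a subset $\Omega_7\subset\Omega$ of full probability and a bounded, open subset $U\subset\mathbb{R}^d$ such that, for every $\omega\in\Omega_7$, every $p\in\mathbb{R}^d\setminus U$ and every $R>0$, with $v^\delta$ the solution of $\delta v^\delta+H(p+Dv^\delta,x,\omega)=0$ on $\mathbb{R}^d$ corresponding to $p$, $$\lim_{\delta\rightarrow 0}\ \sup_{x\in B_{R/\delta}}\left|\overline{H}(p)+\delta v^\delta(x,\omega)\right|=0.$$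
   Context: Setting. $(\Omega,\mathcal{F},\mathbb{P})$ is a probability space equipped with a group $\{\tau_y\}_{y\in\mathbb{R}^d}$ of transformations $\tau_y:\Omega\to\Omega$ (so $\tau_{y+z}=\tau_y\tau_z$) which are measure-preserving and ergodic, the latter meaning that if $E\in\mathcal{F}$ satisfies $\tau_y(E)=E$ for every $y\in\mathbb{R}^d$ then $\mathbb{P}(E)\in\{0,1\}$. "Full probability" means probability one. $B_R$ is the open ball of radius $R$ centered at $0$ in $\mathbb{R}^d$. All partial differential equations and inequalities are understood in the viscosity sense. Standing assumptions on $H:\mathbb{R}^d\times\mathbb{R}^d\times\Omega\to\mathbb{R}$, $(p,y,\omega)\mapsto H(p,y,\omega)$ (measurable in $\omega$ for fixed $(p,y)$): (i) for each $p$, $(y,\omega)\mapsto H(p,y,\omega)$ is stationary: $H(p,y+z,\omega)=H(p,y,\tau_z\omega)$ for all $y,z\in\mathbb{R}^d$, $\omega\in\Omega$; (ii) $\lim_{|p|\to\infty}\inf_{(y,\omega)\in\mathbb{R}^d\times\Omega}H(p,y,\omega)=+\infty$; (iii) for each $R>0$ there is $C=C(R)>0$ with $|H(p,y,\omega)|\le C$ for all $p\in B_R$, $y\in\mathbb{R}^d$, $\omega\in\Omega$; (iv) for each $R>0$ there is $C=C(R)>0$ with $|H(p_1,y_1,\omega)-H(p_2,y_2,\omega)|\le C(|p_1-p_2|+|y_1-y_2|)$ for all $p_1,p_2\in B_R$, $y_1,y_2\in\mathbb{R}^d$, $\omega\in\Omega$. Approximate macroscopic problem. For $p\in\mathbb{R}^d$,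 $\delta>0$, $\omega\in\Omega$, $v^\delta=v^\delta(\cdot,\omega)$ (corresponding to $p$) is the unique bounded Lipschitz viscosity solution of $\delta v^\delta+H(p+Dv^\delta,x,\omega)=0$ on $\mathbb{R}^d$. Effective Hamiltonian. There is a set $\Omega_1\subset\Omega$ of full probability such that for each $p\in\mathbb{R}^d$ the quantity $\limsup_{\delta\to0}-\delta v^\delta(0,\omega)$ takes the same value for every $\omega\in\Omega_1$; this value is denoted $\overline{H}(p)$, defining $\overline{H}:\mathbb{R}^d\to\mathbb{R}$. *)

theory Defs
  imports "HOL-Probability.Probability"
begin

text \<open>
  Throughout, \<open>\<real>\<^sup>d\<close> is an arbitrary type \<open>'a :: euclidean_space\<close>, \<open>\<Omega>\<close> is \<^term>\<open>space M\<close>, and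
  \<open>\<delta> \<rightarrow> 0\<close> always means \<open>\<delta> \<rightarrow> 0+\<close>.
\<close>

subsection \<open>The random environment\<close>

locale ergodic_environment = prob_space M
  for M :: "'w measure" +
  fixes \<tau> :: "'a::euclidean_space \<Rightarrow> 'w \<Rightarrow> 'w"
  assumes measurable_action: "\<And>y. \<tau> y \<in> measurable M M"
    and measure_preserving: "\<And>y. distr M M (\<tau> y) = M"
    and action_zero: "\<And>\<omega>. \<omega> \<in> space M \<Longrightarrow> \<tau> 0 \<omega> = \<omega>"
    and action_add: "\<And>y z \<omega>. \<omega> \<in> space M \<Longrightarrow> \<tau> (y + z) \<omega> = \<tau> y (\<tau> z \<omega>)"
    and ergodic: "\<And>E. E \<in> sets M \<Longrightarrow> (\<And>y. \<tau> y ` E = E) \<Longrightarrow> measure M E \<in> {0, 1}"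

definition full_probability :: "'w measure \<Rightarrow> 'w set \<Rightarrow> bool" where
  "full_probability M S \<longleftrightarrow> S \<in> sets M \<and> measure M S = 1"

subsection \<open>The Hamiltonian\<close>

locale random_hamiltonian =
  fixes M :: "'w measure"
    and \<tau> :: "'a::euclidean_space \<Rightarrow> 'w \<Rightarrow> 'w"
    and H :: "'a \<Rightarrow> 'a \<Rightarrow> 'w \<Rightarrow> real"
  assumes measurable_H: "\<And>p y. (\<lambda>\<omega>. H p y \<omega>) \<in> borel_measurable M"
    and stationary:
      "\<And>p y z \<omega>. \<omega> \<in> space M \<Longrightarrow> H p (y + z) \<omega> = H p y (\<tau> z \<omega>)"
    and coercive:
      "((\<lambda>p. INF (y, \<omega>) \<in> UNIV \<times> space M. ereal (H p y \<omega>)) \<longlongrightarrow> \<infinity>) at_infinity"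
    and locally_bounded:
      "\<And>R. R > 0 \<Longrightarrow> \<exists>C>0. \<forall>p\<in>ball 0 R. \<forall>y. \<forall>\<omega>\<in>space M. \<bar>H p y \<omega>\<bar> \<le> C"
    and locally_lipschitz:
      "\<And>R. R > 0 \<Longrightarrow> \<exists>C>0. \<forall>p1\<in>ball 0 R. \<forall>p2\<in>ball 0 R. \<forall>y1 y2. \<forall>\<omega>\<in>space M.
         \<bar>H p1 y1 \<omega> - H p2 y2 \<omega>\<bar> \<le> C * (norm (p1 - p2) + norm (y1 - y2))"

subsection \<open>Viscosity solutions\<close>

text \<open>
  First-order equations \<open>F(Du, u, x) = 0\<close> on the whole space. Only continuous solutions are
  needed; test functions are \<open>C\<^sup>1\<close> and touch at a local extremum of \<open>u - \<phi>\<close>.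
\<close>

definition C1_with_gradient :: "('a::euclidean_space \<Rightarrow> real) \<Rightarrow> ('a \<Rightarrow> 'a) \<Rightarrow> bool" where
  "C1_with_gradient \<phi> D \<longleftrightarrow> (\<forall>x. GDERIV \<phi> x :> D x) \<and> continuous_on UNIV D"

definition viscosity_subsolution ::
  "('a::euclidean_space \<Rightarrow> real \<Rightarrow> 'a \<Rightarrow> real) \<Rightarrow> ('a \<Rightarrow> real) \<Rightarrow> bool" where
  "viscosity_subsolution F u \<longleftrightarrow> continuous_on UNIV u \<and>
     (\<forall>\<phi> D x. C1_with_gradient \<phi> D \<longrightarrow>
        (\<forall>\<^sub>F y in nhds x. u y - \<phi> y \<le> u x - \<phi> x) \<longrightarrow> F (D x) (u x) x \<le> 0)"

definition viscosity_supersolution ::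
  "('a::euclidean_space \<Rightarrow> real \<Rightarrow> 'a \<Rightarrow> real) \<Rightarrow> ('a \<Rightarrow> real) \<Rightarrow> bool" where
  "viscosity_supersolution F u \<longleftrightarrow> continuous_on UNIV u \<and>
     (\<forall>\<phi> D x. C1_with_gradient \<phi> D \<longrightarrow>
        (\<forall>\<^sub>F y in nhds x. u y - \<phi> y \<ge> u x - \<phi> x) \<longrightarrow> F (D x) (u x) x \<ge> 0)"

definition viscosity_solution ::
  "('a::euclidean_space \<Rightarrow> real \<Rightarrow> 'a \<Rightarrow> real) \<Rightarrow> ('a \<Rightarrow> real) \<Rightarrow> bool" where
  "viscosity_solution F u \<longleftrightarrow> viscosity_subsolution F u \<and> viscosity_supersolution F u"

subsection \<open>The approximate macroscopic problem and the effective Hamiltonian\<close>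

text \<open>
  The definite descriptions below denote the intended objects for \<open>\<delta> > 0\<close>, \<open>\<omega> \<in> \<Omega>\<close> and a
  Hamiltonian satisfying \<^locale>\<open>random_hamiltonian\<close> in an ergodic environment; their
  well-definedness is not assumed anywhere.
\<close>

definition v_approx ::
  "('a::euclidean_space \<Rightarrow> 'a \<Rightarrow> 'w \<Rightarrow> real) \<Rightarrow> 'a \<Rightarrow> real \<Rightarrow> 'w \<Rightarrow> 'a \<Rightarrow> real" where
  "v_approx H p \<delta> \<omega> = (THE v. bounded (range v) \<and> (\<exists>L. L-lipschitz_on UNIV v) \<and>
     viscosity_solution (\<lambda>q r x. \<delta> * r + H (p + q) x \<omega>) v)"

definition effective_hamiltonian ::
  "'w measure \<Rightarrow> ('a::euclidean_space \<Rightarrow> 'a \<Rightarrow> 'w \<Rightarrow> real) \<Rightarrow> 'a \<Rightarrow> real" where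
  "effective_hamiltonian M H = (THE h. \<exists>\<Omega>1. full_probability M \<Omega>1 \<and>
     (\<forall>p. \<forall>\<omega>\<in>\<Omega>1. Limsup (at_right 0) (\<lambda>\<delta>. ereal (- \<delta> * v_approx H p \<delta> \<omega> 0)) = ereal (h p)))"

end

theory Submission
  imports Defs
begin

unbundle inner_syntax

text \<open>
  Outside a large ball of slopes \<open>p\<close> the values of \<open>H\<close> exceed its values on \<open>B\<^sub>R\<^sub>0\<close>. Since
  \<open>- \<delta> v\<^sup>\<delta> \<ge> inf H(p, \<cdot>)\<close> by comparison with constants, the slopes \<open>p + Dv\<^sup>\<delta>\<close> at which the equation is
  tested then avoid \<open>B\<^sub>R\<^sub>0\<close> as far as it matters, so the solution for the convex Hamiltonian \<open>Ht\<close> is also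
  the solution for \<open>H\<close> (\<open>approx_solution_modify\<close>). It remains to homogenize \<open>Ht\<close>, and to see that the
  effective Hamiltonian of \<open>H\<close>, a limit superior at the origin, is well defined for every \<open>p\<close>, so that it
  must agree with the limit wherever there is one.

  For a level \<open>\<mu>\<close> above the values of \<open>Ht\<close> on the unit ball, convexity turns the inequality
  \<open>Ht(Du, x) \<le> \<mu>\<close> into a family of inequalities \<open>u(y) - u(x) \<le> c(x, y)\<close>, where \<open>c\<close> is built from the support
  function of the sublevel set at \<open>x\<close>. Subsolutions are therefore the functions that are
  1-Lipschitz for the asymmetric distance \<open>m(x, y)\<close>, the infimum of the sums of \<open>c\<close> along finite
  chains of points. This distance is stationary, measurable, subadditive and comparable to the
  Euclidean distance. The subadditive ergodic theorem gives \<open>m(x, x + n q) / n \<rightarrow> \<gamma>(q)\<close>, and iterating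
  the one-dimensional maximal inequality along the coordinate axes makes the convergence uniform in
  \<open>|x| \<le> R n\<close> (\<open>subadditive_AE_limit\<close>, \<open>AE_uniform_in_vertex\<close>). Both ergodic theorems follow from a single maximal inequality for
  superadditive processes.

  The limit of \<open>- \<delta> v\<^sup>\<delta>\<close> is the infimum of the levels \<open>\<mu>\<close> with \<open>p \<bullet> q \<le> \<gamma>(q)\<close> for all \<open>q\<close>. At such a level
  \<open>y \<mapsto> - m(y, x)\<close> is a subsolution that is at most about \<open>p \<bullet> (y - x)\<close>, and comparing it with \<open>v\<^sup>\<delta>\<close> on a ball
  of radius of order \<open>1 / \<delta>\<close> bounds \<open>- \<delta> v\<^sup>\<delta>(x)\<close> from above (\<open>discounted_upper_bound\<close>). At a level with
  \<open>p \<bullet> q > \<gamma>(q)\<close> for some \<open>q\<close>, a value of \<open>- \<delta> v\<^sup>\<delta>\<close> below \<open>\<mu>\<close> would make \<open>v\<^sup>\<delta> + p \<bullet> x\<close> a local subsolution whose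
  increment over a step \<open>q\<close> is on average at most \<open>\<gamma>(q)\<close>, so that \<open>v\<^sup>\<delta>\<close> would grow linearly in direction \<open>- q\<close> beyond
  its bound (\<open>discounted_lower_bound\<close>). Because the distance converges uniformly in the vertex, both
  bounds are uniform on balls of radius \<open>R / \<delta>\<close>.

  The effective Hamiltonian requires measurability of \<open>v\<^sup>\<delta>(0)\<close>, which the chains of the convex case do not
  give. The local comparison principle shows that \<open>v\<^sup>\<delta>(0)\<close> is determined, up to any
  given error, by finitely many values of \<open>H\<close> (\<open>v_measurable\<close>). Ergodicity then makes the limit
  superior constant, for all \<open>p\<close> simultaneously by Lipschitz continuity in \<open>p\<close>.
\<close>


section \<open>Test functions and jets\<close>

text \<open>Recording only the gradients of the test functions that touch at a point separates the
  geometry of touching from the equation: the Hamiltonian is then evaluated on a set of slopes.\<close>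

definition superjet :: "('a::euclidean_space \<Rightarrow> real) \<Rightarrow> 'a \<Rightarrow> 'a set" where
  "superjet u x = {q. \<exists>\<phi> D. C1_with_gradient \<phi> D \<and> D x = q \<and> (\<forall>\<^sub>F y in nhds x. u y - \<phi> y \<le> u x - \<phi> x)}"

definition subjet :: "('a::euclidean_space \<Rightarrow> real) \<Rightarrow> 'a \<Rightarrow> 'a set" where
  "subjet u x = {q. \<exists>\<phi> D. C1_with_gradient \<phi> D \<and> D x = q \<and> (\<forall>\<^sub>F y in nhds x. u y - \<phi> y \<ge> u x - \<phi> x)}"

lemma viscosity_subsolution_iff_superjet:
  "viscosity_subsolution F u \<longleftrightarrow> continuous_on UNIV u \<and> (\<forall>x. \<forall>q\<in>superjet u x. F q (u x) x \<le> 0)"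
  unfolding viscosity_subsolution_def superjet_def by blast

lemma viscosity_supersolution_iff_subjet:
  "viscosity_supersolution F u \<longleftrightarrow> continuous_on UNIV u \<and> (\<forall>x. \<forall>q\<in>subjet u x. F q (u x) x \<ge> 0)"
  unfolding viscosity_supersolution_def subjet_def by blast

lemma superjetI:
  assumes "C1_with_gradient \<phi> D" "D x = q" "open S" "x \<in> S" "\<And>y. y \<in> S \<Longrightarrow> u y - \<phi> y \<le> u x - \<phi> x"
  shows "q \<in> superjet u x"
  using assms unfolding superjet_def eventually_nhds by blast

lemma subjetI:
  assumes "C1_with_gradient \<phi> D" "D x = q" "open S" "x \<in> S" "\<And>y. y \<in> S \<Longrightarrow> u y - \<phi> y \<ge> u x - \<phi> x"
  shows "q \<in> subjet u x"
  using assms unfolding subjet_def eventually_nhds by blast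

lemma C1_const: "C1_with_gradient (\<lambda>_. c) (\<lambda>_. 0)"
  by (auto simp: C1_with_gradient_def GDERIV_const)

lemma C1_add:
  "C1_with_gradient f D \<Longrightarrow> C1_with_gradient g E \<Longrightarrow> C1_with_gradient (\<lambda>x. f x + g x) (\<lambda>x. D x + E x)"
  by (auto simp: C1_with_gradient_def intro!: GDERIV_add continuous_intros)

lemma C1_compose:
  assumes "C1_with_gradient f D" "\<And>t. (g has_real_derivative g' t) (at t)" "continuous_on UNIV g'"
  shows "C1_with_gradient (\<lambda>x. g (f x)) (\<lambda>x. g' (f x) *\<^sub>R D x)"
proof -
  have "continuous_on UNIV f"
    using assms(1) unfolding C1_with_gradient_def gderiv_def
    by (metis continuous_at_imp_continuous_on has_derivative_continuous)
  moreover have "continuous_on UNIV (\<lambda>x. g' (f x))"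
    using continuous_on_compose2[OF assms(3) \<open>continuous_on UNIV f\<close>] by auto
  ultimately show ?thesis
    using assms unfolding C1_with_gradient_def
    by (auto intro!: continuous_intros intro: GDERIV_DERIV_compose)
qed

lemma C1_cmult:
  "C1_with_gradient f D \<Longrightarrow> C1_with_gradient (\<lambda>x. c * f x) (\<lambda>x. c *\<^sub>R D x)"
  by (rule C1_compose[where g = "\<lambda>t. c * t" and g' = "\<lambda>_. c"]) (auto intro!: derivative_eq_intros)

lemma C1_inner: "C1_with_gradient (\<lambda>y. e \<bullet> (y - x)) (\<lambda>_. e)"
  unfolding C1_with_gradient_def gderiv_def
  by (auto intro!: derivative_eq_intros simp: inner_commute)

lemma C1_norm_sq: "C1_with_gradient (\<lambda>y. (norm (y - x))\<^sup>2) (\<lambda>y. 2 *\<^sub>R (y - x))"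
  unfolding C1_with_gradient_def gderiv_def power2_norm_eq_inner
  by (auto intro!: derivative_eq_intros continuous_intros simp: inner_commute algebra_simps)

lemma C1_power2:
  assumes "C1_with_gradient f D"
  shows "C1_with_gradient (\<lambda>x. (f x)\<^sup>2) (\<lambda>x. (2 * f x) *\<^sub>R D x)"
  by (rule C1_compose[OF assms, where g = "\<lambda>t. t\<^sup>2" and g' = "\<lambda>t. 2 * t"])
     (auto intro!: derivative_eq_intros continuous_intros)

lemma C1_exp:
  assumes "C1_with_gradient f D"
  shows "C1_with_gradient (\<lambda>x. exp (f x)) (\<lambda>x. exp (f x) *\<^sub>R D x)"
  by (rule C1_compose[OF assms, where g = exp and g' = exp])
     (auto intro!: derivative_eq_intros continuous_intros)

lemma superjet_add_C1:
  assumes "C1_with_gradient \<psi> E" "q \<in> superjet u x"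
  shows "q + E x \<in> superjet (\<lambda>y. u y + \<psi> y) x"
proof -
  obtain \<phi> D where *: "C1_with_gradient \<phi> D" "D x = q" "\<forall>\<^sub>F y in nhds x. u y - \<phi> y \<le> u x - \<phi> x"
    using assms(2) unfolding superjet_def by blast
  have "\<forall>\<^sub>F y in nhds x. (u y + \<psi> y) - (\<phi> y + \<psi> y) \<le> (u x + \<psi> x) - (\<phi> x + \<psi> x)"
    using *(3) by eventually_elim simp
  then show ?thesis
    using C1_add[OF *(1) assms(1)] *(2) unfolding superjet_def by blast
qed

lemma subjet_eq_superjet_uminus: "q \<in> subjet u x \<longleftrightarrow> - q \<in> superjet (\<lambda>y. - u y) x"
proof
  assume "q \<in> subjet u x"
  then obtain \<phi> D where *: "C1_with_gradient \<phi> D" "D x = q" "\<forall>\<^sub>F y in nhds x. u y - \<phi> y \<ge> u x - \<phi> x"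
    unfolding subjet_def by blast
  have "\<forall>\<^sub>F y in nhds x. - u y - (- 1) * \<phi> y \<le> - u x - (- 1) * \<phi> x"
    using *(3) by eventually_elim simp
  then show "- q \<in> superjet (\<lambda>y. - u y) x"
    using C1_cmult[OF *(1), of "-1"] *(2) unfolding superjet_def by force
next
  assume "- q \<in> superjet (\<lambda>y. - u y) x"
  then obtain \<phi> D where *: "C1_with_gradient \<phi> D" "D x = - q" "\<forall>\<^sub>F y in nhds x. - u y - \<phi> y \<le> - u x - \<phi> x"
    unfolding superjet_def by blast
  have "\<forall>\<^sub>F y in nhds x. u y - (- 1) * \<phi> y \<ge> u x - (- 1) * \<phi> x"
    using *(3) by eventually_elim simp
  then show "q \<in> subjet u x"
    using C1_cmult[OF *(1), of "-1"] *(2) unfolding subjet_def by force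
qed

lemma superjet_translate:
  assumes "q \<in> superjet (\<lambda>y. u (y + z)) x"
  shows "q \<in> superjet u (x + z)"
proof -
  obtain \<phi> D where *: "C1_with_gradient \<phi> D" "D x = q" "\<forall>\<^sub>F y in nhds x. u (y + z) - \<phi> y \<le> u (x + z) - \<phi> x"
    using assms unfolding superjet_def by blast
  then obtain S where S: "open S" "x \<in> S" "\<And>y. y \<in> S \<Longrightarrow> u (y + z) - \<phi> y \<le> u (x + z) - \<phi> x"
    unfolding eventually_nhds by blast
  have "C1_with_gradient (\<lambda>y. \<phi> (y - z)) (\<lambda>y. D (y - z))"
    unfolding C1_with_gradient_def
  proof (intro conjI allI)
    fix y
    have "(\<phi> has_derivative (\<lambda>h. h \<bullet> D (y - z))) (at (y - z))"
      using *(1) unfolding C1_with_gradient_def gderiv_def by blast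
    then show "GDERIV (\<lambda>y. \<phi> (y - z)) y :> D (y - z)"
      unfolding gderiv_def
      by (rule has_derivative_compose[rotated]) (auto intro!: derivative_eq_intros)
    show "continuous_on UNIV (\<lambda>y. D (y - z))"
      using *(1) continuous_on_compose2[of UNIV D UNIV "\<lambda>y. y - z"] unfolding C1_with_gradient_def
      by (simp add: continuous_on_diff)
  qed
  then show ?thesis
  proof (rule superjetI)
    show "open ((+) z ` S)" using S(1) by (rule open_translation)
    show "x + z \<in> (+) z ` S" using S(2) by (simp add: add.commute)
    show "u y - \<phi> (y - z) \<le> u (x + z) - \<phi> (x + z - z)" if "y \<in> (+) z ` S" for y
      using that S(3) by (auto simp: add.commute)
  qed (use *(2) in simp)
qed

lemma superjet_of_bound_above:
  assumes "q \<in> superjet u x" "\<forall>\<^sub>F y in nhds x. w y \<le> u y" "w x = u x"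
  shows "q \<in> superjet w x"
proof -
  obtain \<phi> D where *: "C1_with_gradient \<phi> D" "D x = q" "\<forall>\<^sub>F y in nhds x. u y - \<phi> y \<le> u x - \<phi> x"
    using assms(1) unfolding superjet_def by blast
  have "\<forall>\<^sub>F y in nhds x. w y - \<phi> y \<le> w x - \<phi> x"
    using *(3) assms(2)
  proof eventually_elim
    case (elim y) then show ?case using assms(3) by linarith
  qed
  then show ?thesis using * unfolding superjet_def by blast
qed

text \<open>Going backwards, \<open>u x - u (x - s e)\<close> bounds the increment of a function touching \<open>u\<close> from above at \<open>x\<close>
  from above; letting \<open>s\<close> tend to 0 bounds its slope.\<close>

lemma superjet_slope_le_backward_rate:
  assumes q: "q \<in> superjet u x"
    and le: "\<And>s. 0 < s \<Longrightarrow> s < r \<Longrightarrow> u x - u (x - s *\<^sub>R e) \<le> s * (a + K * s)" and "r > 0"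
  shows "q \<bullet> e \<le> a"
proof -
  obtain \<phi> D where *: "C1_with_gradient \<phi> D" "D x = q" "\<forall>\<^sub>F y in nhds x. u y - \<phi> y \<le> u x - \<phi> x"
    using q unfolding superjet_def by blast
  have "(\<phi> has_derivative (\<lambda>h. h \<bullet> q)) (at x)"
    using * unfolding C1_with_gradient_def gderiv_def by blast
  then have "((\<lambda>s. \<phi> (x - s *\<^sub>R e)) has_derivative (\<lambda>s. (- (s *\<^sub>R e)) \<bullet> q)) (at 0)"
    by (intro has_derivative_compose[where f="\<lambda>s. x - s *\<^sub>R e" and g = \<phi>]) (auto intro!: derivative_eq_intros)
  then have "((\<lambda>s. \<phi> (x - s *\<^sub>R e)) has_real_derivative (- (q \<bullet> e))) (at 0)"
    unfolding has_field_derivative_def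
    by (rule has_derivative_eq_rhs) (simp add: fun_eq_iff inner_commute)
  then have lim: "((\<lambda>s. (\<phi> (x - s *\<^sub>R e) - \<phi> x) / s) \<longlongrightarrow> - (q \<bullet> e)) (at_right 0)"
    unfolding has_field_derivative_iff using filterlim_at_split by fastforce
  have lim2: "((\<lambda>s. - (a + K * s)) \<longlongrightarrow> - (a + K * 0)) (at_right 0)"
    by (intro tendsto_intros)
  have "filterlim (\<lambda>s. x - s *\<^sub>R e) (nhds (x - 0 *\<^sub>R e)) (at_right 0)"
    by (intro tendsto_intros)
  then have "\<forall>\<^sub>F s in at_right 0. u (x - s *\<^sub>R e) - \<phi> (x - s *\<^sub>R e) \<le> u x - \<phi> x"
    unfolding filterlim_iff using *(3) by (smt (verit) eventually_mono scaleR_zero_left diff_zero)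
  moreover have "\<forall>\<^sub>F s in at_right 0. s \<in> {0<..<r}"
    using \<open>r > 0\<close> by (rule eventually_at_right_real)
  ultimately have "\<forall>\<^sub>F s in at_right 0. - (a + K * s) \<le> (\<phi> (x - s *\<^sub>R e) - \<phi> x) / s"
  proof eventually_elim
    case (elim s)
    then have "- (s * (a + K * s)) \<le> \<phi> (x - s *\<^sub>R e) - \<phi> x" using le[of s] by auto
    then show ?case using elim by (simp add: field_simps)
  qed
  from tendsto_le[OF _ lim lim2 this] show ?thesis by simp
qed

lemma norm_superjet_le_lipschitz:
  assumes "L-lipschitz_on UNIV u" "q \<in> superjet u x"
  shows "norm q \<le> L"
proof -
  have "q \<bullet> q \<le> L * norm q"
  proof (rule superjet_slope_le_backward_rate[OF assms(2), of 1 _ _ 0])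
    fix s :: real assume "0 < s"
    then show "u x - u (x - s *\<^sub>R q) \<le> s * (L * norm q + 0 * s)"
      using lipschitz_onD[OF assms(1), of x "x - s *\<^sub>R q"]
      by (simp add: dist_real_def dist_norm mult_ac)
  qed simp
  then have "norm q * norm q \<le> L * norm q" by (simp add: power2_norm_eq_inner flip: power2_eq_square)
  then show ?thesis
    using lipschitz_on_nonneg[OF assms(1)] by (cases "norm q = 0") auto
qed

lemma superjet_const: "superjet (\<lambda>_. c) x \<subseteq> {0}"
  using norm_superjet_le_lipschitz[of 0 "\<lambda>_. c"] by (fastforce intro: lipschitz_onI)

lemma subjet_const: "subjet (\<lambda>_. c) x \<subseteq> {0}"
  using superjet_const by (fastforce simp: subjet_eq_superjet_uminus)

lemma superjet_C1:
  assumes "C1_with_gradient \<psi> E" "q \<in> superjet \<psi> x"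
  shows "q = E x"
proof -
  have "q + (- 1) *\<^sub>R E x \<in> superjet (\<lambda>y. \<psi> y + (- 1) * \<psi> y) x"
    by (intro superjet_add_C1 C1_cmult assms)
  then show ?thesis using superjet_const[of 0 x] by auto
qed

section \<open>Slopes of superjets bound increments\<close>

text \<open>
  The bound \<open>e \<bullet> Du \<le> a\<close> in the viscosity sense integrates along the direction \<open>e\<close>. If the increment
  were too large, then \<open>u\<close> minus the test function
  \<open>a s + \<eta> exp (K (s - t)) + K |y\<^sup>\<bottom>|\<^sup>2\<close>, with \<open>s\<close> the coordinate along \<open>e\<close> and \<open>y\<^sup>\<bottom>\<close> the orthogonal
  component, would have a maximum inside a thin cylinder around the segment: the exponential keeps it
  away from the far end and the quadratic term from the sides. The slope of the test function in
  direction \<open>e\<close> exceeds \<open>a\<close> everywhere.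
\<close>

lemma superjet_slope_bounds_increment:
  fixes u :: "'a::euclidean_space \<Rightarrow> real"
  assumes cont: "continuous_on UNIV u" and e: "norm e = 1" and t: "t \<ge> 0" and r: "r > 0"
    and jets: "\<And>y q s. 0 \<le> s \<Longrightarrow> s \<le> t \<Longrightarrow> dist y (x + s *\<^sub>R e) < r \<Longrightarrow> q \<in> superjet u y \<Longrightarrow> q \<bullet> e \<le> a"
  shows "u (x + t *\<^sub>R e) \<le> u x + t * a"
proof (rule ccontr)
  assume neg: "\<not> ?thesis"
  define \<eta> where "\<eta> = (u (x + t *\<^sub>R e) - u x - t * a) / 4"
  have \<eta>: "\<eta> > 0" using neg by (simp add: \<eta>_def)
  \<comment> \<open>A cylinder of radius \<open>\<rho>\<close> that overshoots the end of the segment by \<open>\<rho>\<close> stays within distance \<open>r\<close>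
    of the segment.\<close>
  define \<rho> where "\<rho> = r / 3"
  have \<rho>: "\<rho> > 0" using r by (simp add: \<rho>_def)
  define s where "s = (\<lambda>y. e \<bullet> (y - x))"
  define P where "P = (\<lambda>y. (norm (y - x))\<^sup>2 - (s y)\<^sup>2)"
  have ee: "e \<bullet> e = 1" using e by (simp add: dot_square_norm)
  have P_eq: "P y = (norm (y - x - s y *\<^sub>R e))\<^sup>2" for y
    unfolding P_def power2_norm_eq_inner s_def
    by (simp add: inner_diff_left inner_diff_right ee inner_commute algebra_simps power2_eq_square)
  have P0: "P y \<ge> 0" for y by (simp add: P_eq)
  define N where "N = {y. 0 \<le> s y \<and> s y \<le> t + \<rho> \<and> P y \<le> \<rho>\<^sup>2}"
  have scont: "continuous_on UNIV s" unfolding s_def by (intro continuous_intros)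
  have Pcont: "continuous_on UNIV P" unfolding P_def s_def by (intro continuous_intros)
  have "closed N"
    unfolding N_def using scont Pcont
    by (intro closed_Collect_conj closed_Collect_le continuous_intros)
  moreover have "bounded N"
  proof (rule boundedI)
    fix y assume "y \<in> N"
    then have "0 \<le> s y" "s y \<le> t + \<rho>" "(norm (y - x))\<^sup>2 - (s y)\<^sup>2 \<le> \<rho>\<^sup>2"
      unfolding N_def P_def by auto
    moreover from this have "(s y)\<^sup>2 \<le> (t + \<rho>)\<^sup>2" by (intro power_mono)
    ultimately have "(norm (y - x))\<^sup>2 \<le> (t + \<rho>)\<^sup>2 + \<rho>\<^sup>2" by linarith
    moreover have "0 \<le> 2 * (t + \<rho>) * \<rho>" using t \<rho> by (intro mult_nonneg_nonneg) auto
    ultimately have "(norm (y - x))\<^sup>2 \<le> ((t + \<rho>) + \<rho>)\<^sup>2"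
      unfolding power2_sum[of "t + \<rho>" \<rho>] by linarith
    then have "norm (y - x) \<le> t + \<rho> + \<rho>" by (rule power2_le_imp_le) (use t \<rho> in linarith)
    then show "norm y \<le> norm x + (t + \<rho> + \<rho>)" using norm_triangle_sub[of y x] by linarith
  qed
  ultimately have N: "compact N" by (simp add: compact_eq_bounded_closed)
  have s_end: "s (x + t *\<^sub>R e) = t" by (simp add: s_def ee)
  have endN: "x + t *\<^sub>R e \<in> N" unfolding N_def
    using t \<rho> by (simp add: s_end P_eq)
  have "continuous_on N (\<lambda>y. u y - a * s y)"
    by (intro continuous_intros continuous_on_subset[OF cont] continuous_on_subset[OF scont]) auto
  then have "bounded ((\<lambda>y. u y - a * s y) ` N)"
    using N by (intro compact_imp_bounded compact_continuous_image) auto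
  then obtain M where M: "\<And>y. y \<in> N \<Longrightarrow> \<bar>u y - a * s y\<bar> \<le> M" and M0: "M > 0"
    by (auto simp: bounded_pos)
  obtain \<rho>1 where \<rho>1: "\<rho>1 > 0" "\<rho>1 \<le> \<rho>" "\<And>y. dist y x \<le> \<rho>1 \<Longrightarrow> u y \<le> u x + \<eta>"
  proof -
    have "continuous (at x) u" using cont by (simp add: continuous_on_eq_continuous_at)
    then obtain d where d: "d > 0" "\<And>y. dist y x < d \<Longrightarrow> dist (u y) (u x) < \<eta>"
      using \<eta> unfolding continuous_at_eps_delta by blast
    show ?thesis
    proof (rule that[of "min \<rho> (d/2)"])
      fix y assume "dist y x \<le> min \<rho> (d/2)"
      then have "dist (u y) (u x) < \<eta>" using d by (intro d(2)) auto
      then show "u y \<le> u x + \<eta>" by (simp add: dist_real_def)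
    qed (use d \<rho> in auto)
  qed
  \<comment> \<open>Large enough for the penalties to beat the oscillation of \<open>u\<close>, on the bottom outside the disc of
    radius \<open>\<rho>1\<close>, on the sides and at the far end.\<close>
  define K where "K = (2 * M + \<eta> + 1) / \<rho>1\<^sup>2 + (2 * M + \<eta> + 1) / (\<eta> * \<rho>)"
  have K0: "K > 0" unfolding K_def using M0 \<eta> \<rho> \<rho>1 by (intro add_pos_pos divide_pos_pos) auto
  have K1: "K * \<rho>1\<^sup>2 > 2 * M + \<eta>"
  proof -
    have "K * \<rho>1\<^sup>2 = (2 * M + \<eta> + 1) + (2 * M + \<eta> + 1) / (\<eta> * \<rho>) * \<rho>1\<^sup>2"
      unfolding K_def using \<rho>1 by (simp add: field_simps)
    moreover have "(2 * M + \<eta> + 1) / (\<eta> * \<rho>) * \<rho>1\<^sup>2 \<ge> 0" using M0 \<eta> \<rho> by simp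
    ultimately show ?thesis by linarith
  qed
  have K2: "\<eta> * exp (K * \<rho>) > 2 * M + \<eta>"
  proof -
    have "K * (\<eta> * \<rho>) = (2 * M + \<eta> + 1) / \<rho>1\<^sup>2 * (\<eta> * \<rho>) + (2 * M + \<eta> + 1)"
      unfolding K_def using \<eta> \<rho> by (simp add: field_simps)
    moreover have "(2 * M + \<eta> + 1) / \<rho>1\<^sup>2 * (\<eta> * \<rho>) \<ge> 0" using M0 \<eta> \<rho> by simp
    ultimately have "2 * M + \<eta> < K * (\<eta> * \<rho>)" by linarith
    also have "\<dots> = \<eta> * (K * \<rho>)" by simp
    also have "\<dots> \<le> \<eta> * exp (K * \<rho>)"
      using \<eta> exp_ge_add_one_self[of "K * \<rho>"] by (intro mult_left_mono) linarith+
    finally show ?thesis .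
  qed
  have K3: "K * \<rho>\<^sup>2 > 2 * M + \<eta>"
    using K1 K0 power_mono[OF \<rho>1(2), of 2] \<rho>1(1) mult_left_mono[of "\<rho>1\<^sup>2" "\<rho>\<^sup>2" K] by linarith
  define \<phi> where "\<phi> = (\<lambda>y. a * s y + \<eta> * exp (K * s y + (- K * t)) + K * P y)"
  define D where "D = (\<lambda>y. a *\<^sub>R e + \<eta> *\<^sub>R (exp (K * s y + (- K * t)) *\<^sub>R (K *\<^sub>R e + 0))
                        + K *\<^sub>R (2 *\<^sub>R (y - x) + (-1) *\<^sub>R ((2 * s y) *\<^sub>R e)))"
  have P_alt: "P = (\<lambda>y. (norm (y - x))\<^sup>2 + (-1) * (s y)\<^sup>2)" by (simp add: P_def fun_eq_iff)
  have sC1: "C1_with_gradient s (\<lambda>_. e)" unfolding s_def by (rule C1_inner)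
  have C1: "C1_with_gradient \<phi> D"
    unfolding \<phi>_def D_def P_alt
    by (intro C1_add C1_cmult C1_exp C1_const C1_norm_sq C1_power2 sC1)
  have De: "D y \<bullet> e > a" for y
  proof -
    have "D y \<bullet> e = a + \<eta> * (exp (K * s y + (- K * t)) * K)"
      unfolding D_def by (simp add: inner_add_left inner_diff_left ee s_def inner_commute algebra_simps)
    then show ?thesis using \<eta> K0 by simp
  qed
  have "continuous_on N (\<lambda>y. u y - \<phi> y)"
    unfolding \<phi>_def using continuous_on_subset[OF cont subset_UNIV] continuous_on_subset[OF scont subset_UNIV]
      continuous_on_subset[OF Pcont subset_UNIV]
    by (intro continuous_intros) auto
  then obtain z where z: "z \<in> N" "\<And>y. y \<in> N \<Longrightarrow> u y - \<phi> y \<le> u z - \<phi> z"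
    using continuous_attains_sup[OF N, of "\<lambda>y. u y - \<phi> y"] endN by blast
  have P_end: "P (x + t *\<^sub>R e) = 0" by (simp add: P_eq s_end)
  have val: "u z - \<phi> z \<ge> u x + 3 * \<eta>"
    using z(2)[OF endN] by (simp add: \<phi>_def s_end P_end \<eta>_def field_simps)
  have val2: "u z - \<phi> z \<ge> - M - \<eta>"
    using z(2)[OF endN] M[OF endN] by (simp add: \<phi>_def s_end P_end)
  have exp0: "\<eta> * exp (K * s z + (- K * t)) \<ge> 0" using \<eta> by simp
  have KP: "K * P z \<ge> 0" using K0 P0 by simp
  have s_pos: "s z > 0"
  proof (rule ccontr)
    assume "\<not> s z > 0"
    then have s0: "s z = 0" using z(1) unfolding N_def by auto
    have P_z: "P z = (dist z x)\<^sup>2" by (simp add: P_def s0 dist_norm)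
    show False
    proof (cases "dist z x \<le> \<rho>1")
      case True
      have "u z - \<phi> z = u z - \<eta> * exp (K * s z + (- K * t)) - K * P z" by (simp add: \<phi>_def s0)
      then have "u z - \<phi> z \<le> u z" using exp0 KP by linarith
      also have "\<dots> \<le> u x + \<eta>" using \<rho>1(3) True by simp
      finally show False using val \<eta> by linarith
    next
      case False
      then have "\<rho>1\<^sup>2 \<le> P z" unfolding P_z using \<rho>1(1) by (intro power_mono) auto
      then have "K * \<rho>1\<^sup>2 \<le> K * P z" using K0 by simp
      then show False using val2 M[OF z(1)] exp0 K1 by (simp add: \<phi>_def)
    qed
  qed
  have s_lt: "s z < t + \<rho>"
  proof (rule ccontr)
    assume "\<not> s z < t + \<rho>"
    then have "s z = t + \<rho>" using z(1) unfolding N_def by auto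
    then have "K * s z + (- K * t) = K * \<rho>" by (simp add: algebra_simps)
    then have "u z - \<phi> z = u z - a * s z - \<eta> * exp (K * \<rho>) - K * P z" by (simp add: \<phi>_def)
    then show False using val2 M[OF z(1)] KP K2 by linarith
  qed
  have P_lt: "P z < \<rho>\<^sup>2"
  proof (rule ccontr)
    assume "\<not> P z < \<rho>\<^sup>2"
    then have "K * \<rho>\<^sup>2 \<le> K * P z" using K0 by simp
    then show False using val2 M[OF z(1)] exp0 K3 by (simp add: \<phi>_def)
  qed
  define I where "I = {y. 0 < s y \<and> s y < t + \<rho> \<and> P y < \<rho>\<^sup>2}"
  have openI: "open I" unfolding I_def
    by (intro open_Collect_conj open_Collect_less scont Pcont continuous_on_const)
  have zI: "z \<in> I" unfolding I_def mem_Collect_eq using s_pos s_lt P_lt by (intro conjI)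
  have zmax: "u y - \<phi> y \<le> u z - \<phi> z" if "y \<in> I" for y
  proof (rule z(2))
    have "0 < s y \<and> s y < t + \<rho> \<and> P y < \<rho>\<^sup>2" using that unfolding I_def mem_Collect_eq .
    then show "y \<in> N" unfolding N_def mem_Collect_eq by (elim conjE, intro conjI less_imp_le)
  qed
  have jet: "D z \<in> superjet u z"
    by (rule superjetI[OF C1 refl openI zI zmax])
  define s1 where "s1 = min (s z) t"
  have s1: "0 \<le> s1" "s1 \<le> t" "\<bar>s z - s1\<bar> \<le> \<rho>"
    using s_pos s_lt t \<rho> unfolding s1_def by linarith+
  have d1: "norm (z - x - s z *\<^sub>R e) \<le> \<rho>"
    by (rule power2_le_imp_le) (use P_lt P_eq[of z] \<rho> in linarith)+
  have d2: "norm ((s z - s1) *\<^sub>R e) \<le> \<rho>"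
    using s1 e by simp
  have "norm ((z - x - s z *\<^sub>R e) + (s z - s1) *\<^sub>R e) \<le> \<rho> + \<rho>"
    by (rule norm_triangle_mono[OF d1 d2])
  moreover have "(z - x - s z *\<^sub>R e) + (s z - s1) *\<^sub>R e = z - (x + s1 *\<^sub>R e)"
    by (simp add: scaleR_left_diff_distrib)
  ultimately have "dist z (x + s1 *\<^sub>R e) < r"
    using r unfolding dist_norm \<rho>_def by simp
  then have "D z \<bullet> e \<le> a"
    using jet s1 by (intro jets[of s1 z]) auto
  then show False using De[of z] by simp
qed

corollary lipschitz_of_superjet_bound:
  fixes u :: "'a::euclidean_space \<Rightarrow> real"
  assumes "continuous_on UNIV u" "L \<ge> 0" "\<And>y q. q \<in> superjet u y \<Longrightarrow> norm q \<le> L"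
  shows "L-lipschitz_on UNIV u"
proof -
  have le: "u y - u x \<le> L * dist x y" for x y
  proof (cases "x = y")
    case False
    define e where "e = (y - x) /\<^sub>R norm (y - x)"
    have e: "norm e = 1" using False by (simp add: e_def)
    have "u (x + norm (y - x) *\<^sub>R e) \<le> u x + norm (y - x) * L"
    proof (rule superjet_slope_bounds_increment[OF assms(1) e, of _ 1])
      fix z q s assume "q \<in> superjet u z"
      then show "q \<bullet> e \<le> L" using assms(3)[of q z] norm_cauchy_schwarz[of q e] e by simp
    qed auto
    then show ?thesis using False by (simp add: e_def dist_norm norm_minus_commute mult.commute)
  qed simp
  show ?thesis
  proof (rule lipschitz_onI)
    fix x y show "dist (u x) (u y) \<le> L * dist x y"
      using le[of x y] le[of y x] by (simp add: dist_real_def dist_commute)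
  qed (use assms in auto)
qed

section \<open>Local comparison\<close>

text \<open>
  The doubling of variables is done on a ball, with the penalty \<open>\<kappa> |x - x0|\<^sup>2\<close>, where \<open>\<kappa> R\<^sup>2\<close> exceeds
  the bound \<open>B\<close> for \<open>u - v\<close>, in place of boundary conditions. The penalty perturbs slopes by at
  most \<open>2 (B + 1) / R\<close>, and this is the only trace of what happens outside the ball. Since
  \<open>\<delta> v\<^sup>\<delta>\<close> is bounded, \<open>B\<close> is of order \<open>1 / \<delta>\<close> in the applications, so that balls of radius
  \<open>R' / \<delta>\<close> with a large \<open>R'\<close> determine \<open>\<delta> v\<^sup>\<delta> (x0)\<close>.
\<close>

lemma local_comparison:
  fixes u v :: "'a::euclidean_space \<Rightarrow> real"
  assumes \<delta>: "\<delta> > 0" and R: "R > 0" and C: "C \<ge> 0" and \<epsilon>: "\<epsilon> \<ge> 0" and B: "B \<ge> 0"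
    and Lu: "L-lipschitz_on UNIV u" and Lv: "L-lipschitz_on UNIV v"
    and diff: "\<And>x. x \<in> cball x0 R \<Longrightarrow> u x - v x \<le> B"
    and sub: "\<And>x q. x \<in> ball x0 R \<Longrightarrow> q \<in> superjet u x \<Longrightarrow> \<delta> * u x + G1 q x \<le> 0"
    and super: "\<And>x q. x \<in> ball x0 (R + 1) \<Longrightarrow> q \<in> subjet v x \<Longrightarrow> \<delta> * v x + G2 q x \<ge> 0"
    and comp: "\<And>q1 q2 x y. norm q1 \<le> P \<Longrightarrow> norm q2 \<le> P \<Longrightarrow> x \<in> ball x0 R \<Longrightarrow> y \<in> ball x0 (R + 1) \<Longrightarrow>
        G2 q2 y - G1 q1 x \<le> \<epsilon> + C * (norm (q1 - q2) + norm (x - y))"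
    and P: "P \<ge> 2 * L + 2 * (B + 1) / R"
  shows "\<delta> * (u x0 - v x0) \<le> \<epsilon> + C * (2 * (B + 1) / R)"
proof (cases "u x0 \<le> v x0")
  case True
  then have "\<delta> * (u x0 - v x0) \<le> 0" using \<delta> by (simp add: mult_le_0_iff)
  moreover have "C * (2 * (B + 1) / R) \<ge> 0" using C B R by simp
  ultimately show ?thesis using \<epsilon> by linarith
next
  case False
  have L: "L \<ge> 0" using Lu lipschitz_on_nonneg by blast
  define \<kappa> where "\<kappa> = (B + 1) / R\<^sup>2"
  have \<kappa>: "\<kappa> > 0" "\<kappa> * R\<^sup>2 = B + 1" "2 * \<kappa> * R = 2 * (B + 1) / R"
    using B R by (auto simp: \<kappa>_def power2_eq_square)
  have key: "\<delta> * (u x0 - v x0) \<le> \<epsilon> + C * (2 * (B + 1) / R + 2 * \<alpha> * L)"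
    if \<alpha>: "\<alpha> > 0" "2 * \<alpha> * L < 1" "2 * \<alpha> * L\<^sup>2 < 1" for \<alpha>
  proof -
    define \<Phi> where "\<Phi> = (\<lambda>z. u (fst z) - v (snd z) - (norm (fst z - snd z))\<^sup>2 / (2 * \<alpha>) - \<kappa> * (norm (fst z - x0))\<^sup>2)"
    define S where "S = cball x0 R \<times> cball x0 (R + 1)"
    have "compact S" unfolding S_def by (intro compact_Times compact_cball)
    have cu: "continuous_on UNIV u" and cv: "continuous_on UNIV v"
      using Lu Lv by (auto intro: lipschitz_on_continuous_on)
    have "continuous_on S \<Phi>" unfolding \<Phi>_def
      using \<alpha>(1) by (intro continuous_intros continuous_on_compose2[OF cu] continuous_on_compose2[OF cv]) auto
    moreover have x0S: "(x0, x0) \<in> S" using R by (simp add: S_def)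
    ultimately obtain z where z: "z \<in> S" "\<And>y. y \<in> S \<Longrightarrow> \<Phi> y \<le> \<Phi> z"
      using continuous_attains_sup[OF \<open>compact S\<close>, of \<Phi>] by blast
    obtain x y where xy: "z = (x, y)" by (cases z)
    have xyS: "dist x0 x \<le> R" "dist x0 y \<le> R + 1" using z(1) by (auto simp: S_def xy)
    have vxy: "v x - v y \<le> L * norm (x - y)" for x y
      using lipschitz_onD[OF Lv, of x y] by (simp add: dist_real_def dist_norm)
    have "\<Phi> (x, x) \<le> \<Phi> (x, y)" using z(2)[of "(x, x)"] xyS by (simp add: S_def xy)
    then have "(norm (x - y))\<^sup>2 / (2 * \<alpha>) \<le> v x - v y" by (simp add: \<Phi>_def)
    also have "\<dots> \<le> L * norm (x - y)" by (rule vxy)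
    finally have "(norm (x - y))\<^sup>2 / (2 * \<alpha>) \<le> L * norm (x - y)" .
    then have "(norm (x - y))\<^sup>2 \<le> (2 * \<alpha> * L) * norm (x - y)"
      using \<alpha>(1) by (simp add: divide_le_eq mult.commute mult.left_commute)
    then have nxy: "norm (x - y) \<le> 2 * \<alpha> * L"
      using \<alpha>(1) L by (cases "norm (x - y) = 0") (auto simp: power2_eq_square)
    have base: "\<Phi> (x0, x0) \<le> \<Phi> (x, y)" using z(2)[OF x0S] xy by simp
    then have pos: "\<Phi> (x, y) > 0" using False by (simp add: \<Phi>_def)
    have nn: "(norm (x - y))\<^sup>2 / (2 * \<alpha>) \<ge> 0" "\<kappa> * (norm (x - x0))\<^sup>2 \<ge> 0" using \<alpha> \<kappa> by auto
    have xin: "dist x0 x < R"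
    proof (rule ccontr)
      assume "\<not> dist x0 x < R"
      then have "norm (x - x0) = R" using xyS(1) by (simp add: dist_norm norm_minus_commute)
      then have "\<Phi> (x, y) \<le> (u x - v x) + (v x - v y) - (B + 1)"
        using nn(1) \<kappa>(2) by (simp add: \<Phi>_def)
      moreover have "u x - v x \<le> B" using diff[of x] xyS by simp
      moreover have "v x - v y \<le> L * (2 * \<alpha> * L)"
        using vxy[of x y] mult_left_mono[OF nxy L] by linarith
      moreover have "L * (2 * \<alpha> * L) = 2 * \<alpha> * L\<^sup>2" by (simp add: power2_eq_square)
      ultimately show False using pos \<alpha>(3) by linarith
    qed
    have yin: "dist x0 y < R + 1"
    proof -
      have "dist x0 y \<le> dist x0 x + norm (x - y)" using dist_triangle[of x0 y x] by (simp add: dist_norm)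
      then show ?thesis using xin nxy \<alpha>(2) by linarith
    qed
    define q2 where "q2 = (1 / \<alpha>) *\<^sub>R (x - y)"
    define q1 where "q1 = q2 + (2 * \<kappa>) *\<^sub>R (x - x0)"
    have "q1 \<in> superjet u x"
    proof (rule superjetI[of "\<lambda>x'. (1 / (2 * \<alpha>)) * (norm (x' - y))\<^sup>2 + \<kappa> * (norm (x' - x0))\<^sup>2"
          "\<lambda>x'. (1 / (2 * \<alpha>)) *\<^sub>R (2 *\<^sub>R (x' - y)) + \<kappa> *\<^sub>R (2 *\<^sub>R (x' - x0))" _ _ "ball x0 R"])
      show "(1 / (2 * \<alpha>)) *\<^sub>R (2 *\<^sub>R (x - y)) + \<kappa> *\<^sub>R (2 *\<^sub>R (x - x0)) = q1"
        unfolding q1_def q2_def by (simp add: mult.commute)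
      fix x' assume "x' \<in> ball x0 R"
      then have "\<Phi> (x', y) \<le> \<Phi> (x, y)" using z(2)[of "(x', y)"] xyS by (simp add: S_def xy)
      then show "u x' - (1 / (2 * \<alpha>) * (norm (x' - y))\<^sup>2 + \<kappa> * (norm (x' - x0))\<^sup>2)
          \<le> u x - (1 / (2 * \<alpha>) * (norm (x - y))\<^sup>2 + \<kappa> * (norm (x - x0))\<^sup>2)"
        by (simp add: \<Phi>_def)
    qed (intro C1_add C1_cmult C1_norm_sq, use xin in simp_all)
    then have s1: "\<delta> * u x + G1 q1 x \<le> 0" using sub[of x q1] xin by simp
    have "q2 \<in> subjet v y"
    proof (rule subjetI[of "\<lambda>y'. (- 1 / (2 * \<alpha>)) * (norm (y' - x))\<^sup>2"
          "\<lambda>y'. (- 1 / (2 * \<alpha>)) *\<^sub>R (2 *\<^sub>R (y' - x))" _ _ "ball x0 (R + 1)"])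
      show "(- 1 / (2 * \<alpha>)) *\<^sub>R (2 *\<^sub>R (y - x)) = q2"
        unfolding q2_def by (simp add: algebra_simps)
      fix y' assume "y' \<in> ball x0 (R + 1)"
      then have "\<Phi> (x, y') \<le> \<Phi> (x, y)" using z(2)[of "(x, y')"] xyS by (simp add: S_def xy)
      then show "v y' - - 1 / (2 * \<alpha>) * (norm (y' - x))\<^sup>2 \<ge> v y - - 1 / (2 * \<alpha>) * (norm (y - x))\<^sup>2"
        by (simp add: \<Phi>_def norm_minus_commute)
    qed (intro C1_cmult C1_norm_sq, use yin in simp_all)
    then have s2: "\<delta> * v y + G2 q2 y \<ge> 0" using super[of y q2] yin by simp
    have "norm q2 = norm (x - y) / \<alpha>" using \<alpha>(1) by (simp add: q2_def)
    also have "\<dots> \<le> 2 * L" using nxy \<alpha>(1) by (simp add: divide_le_eq mult.commute mult.left_commute)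
    finally have nq2: "norm q2 \<le> 2 * L" .
    have ndiff: "norm (q1 - q2) \<le> 2 * (B + 1) / R"
    proof -
      have "norm (q1 - q2) = 2 * \<kappa> * norm (x - x0)" using \<kappa>(1) by (simp add: q1_def)
      also have "\<dots> \<le> 2 * \<kappa> * R" using xyS(1) \<kappa>(1) by (simp add: dist_norm norm_minus_commute)
      finally show ?thesis using \<kappa>(3) by simp
    qed
    have "norm q1 \<le> norm q2 + norm (q1 - q2)" by (metis norm_triangle_sub add.commute)
    then have nP: "norm q1 \<le> P" using nq2 ndiff P by linarith
    have BR: "2 * (B + 1) / R \<ge> 0" using B R by simp
    have "u x0 - v x0 = \<Phi> (x0, x0)" by (simp add: \<Phi>_def)
    also have "\<dots> \<le> \<Phi> (x, y)" by (rule base)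
    also have "\<dots> \<le> u x - v y" using nn by (simp add: \<Phi>_def)
    finally have "\<delta> * (u x0 - v x0) \<le> \<delta> * (u x - v y)" using \<delta> by simp
    also have "\<dots> \<le> G2 q2 y - G1 q1 x" using s1 s2 by (simp add: right_diff_distrib)
    also have "\<dots> \<le> \<epsilon> + C * (norm (q1 - q2) + norm (x - y))"
      using nP nq2 P BR xin yin by (intro comp) auto
    also have "\<dots> \<le> \<epsilon> + C * (2 * (B + 1) / R + 2 * \<alpha> * L)"
      using ndiff nxy C by (intro add_left_mono mult_left_mono) auto
    finally show ?thesis .
  qed
  show ?thesis
  proof (rule field_le_epsilon)
    fix e :: real assume e: "e > 0"
    define m where "m = 1 + 2 * L + 2 * L\<^sup>2 + C * (2 * L)"
    have m: "m > 0" "2 * L < m" "2 * L\<^sup>2 < m" "C * (2 * L) \<le> m"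
      unfolding m_def using L C by (auto simp: add_pos_nonneg add_nonneg_pos)
    define \<alpha> where "\<alpha> = min 1 e / m"
    have \<alpha>0: "\<alpha> > 0" using e m by (simp add: \<alpha>_def)
    have "\<alpha> * m = min 1 e" using m by (simp add: \<alpha>_def)
    then have am: "\<alpha> * m \<le> 1" "\<alpha> * m \<le> e" by auto
    have a1: "\<alpha> * (2 * L) < \<alpha> * m" "\<alpha> * (2 * L\<^sup>2) < \<alpha> * m" "\<alpha> * (C * (2 * L)) \<le> \<alpha> * m"
      using \<alpha>0 m by (auto intro: mult_strict_left_mono mult_left_mono)
    have "\<delta> * (u x0 - v x0) \<le> \<epsilon> + C * (2 * (B + 1) / R + 2 * \<alpha> * L)"
      using a1 am by (intro key \<alpha>0) (auto simp: mult.assoc mult.left_commute)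
    also have "\<dots> = \<epsilon> + C * (2 * (B + 1) / R) + \<alpha> * (C * (2 * L))" by (simp add: algebra_simps)
    also have "\<dots> \<le> \<epsilon> + C * (2 * (B + 1) / R) + e" using a1(3) am(2) by linarith
    finally show "\<delta> * (u x0 - v x0) \<le> \<epsilon> + C * (2 * (B + 1) / R) + e" .
  qed
qed

section \<open>The approximate problem\<close>

text \<open>For bounded functions the radius in the local comparison can be sent to infinity.\<close>

lemma global_comparison:
  fixes u v :: "'a::euclidean_space \<Rightarrow> real"
  assumes \<delta>: "\<delta> > 0" and C: "C \<ge> 0" and \<epsilon>: "\<epsilon> \<ge> 0"
    and Lu: "L-lipschitz_on UNIV u" and Lv: "L-lipschitz_on UNIV v"
    and bu: "bounded (range u)" and bv: "bounded (range v)"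
    and sub: "\<And>x q. q \<in> superjet u x \<Longrightarrow> \<delta> * u x + G1 q x \<le> 0"
    and super: "\<And>x q. q \<in> subjet v x \<Longrightarrow> \<delta> * v x + G2 q x \<ge> 0"
    and comp: "\<And>q1 q2 x y. norm q1 \<le> 2 * L + 1 \<Longrightarrow> norm q2 \<le> 2 * L + 1 \<Longrightarrow>
        G2 q2 y - G1 q1 x \<le> \<epsilon> + C * (norm (q1 - q2) + norm (x - y))"
  shows "\<delta> * (u x - v x) \<le> \<epsilon>"
proof (rule field_le_epsilon)
  fix e :: real assume e: "e > 0"
  obtain B1 B2 where B: "\<And>x. \<bar>u x\<bar> \<le> B1" "\<And>x. \<bar>v x\<bar> \<le> B2"
    using bu bv unfolding bounded_iff by auto
  have B0: "0 \<le> B1 + B2" using B(1)[of 0] B(2)[of 0] by linarith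
  define D where "D = 2 * (B1 + B2 + 1)"
  have D: "D > 0" using B0 by (simp add: D_def)
  define R where "R = D + C * D / e"
  have R: "R > 0" "D \<le> R" "C * D / e \<le> R"
    using C D e by (auto simp: R_def add_pos_nonneg)
  have "\<delta> * (u x - v x) \<le> \<epsilon> + C * (2 * (B1 + B2 + 1) / R)"
  proof (rule local_comparison[OF \<delta> R(1) C \<epsilon> B0 Lu Lv])
    show "u y - v y \<le> B1 + B2" for y using B(1)[of y] B(2)[of y] by linarith
    show "2 * L + 2 * (B1 + B2 + 1) / R \<le> 2 * L + 1" using R by (simp add: D_def)
  qed (use sub super comp in auto)
  also have "C * (2 * (B1 + B2 + 1) / R) \<le> e"
    using R e C by (simp add: D_def field_simps)
  finally show "\<delta> * (u x - v x) \<le> \<epsilon> + e" by simp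
qed

definition approx_solution :: "('a::euclidean_space \<Rightarrow> 'a \<Rightarrow> real) \<Rightarrow> 'a \<Rightarrow> real \<Rightarrow> ('a \<Rightarrow> real) \<Rightarrow> bool" where
  "approx_solution H p \<delta> v \<longleftrightarrow> bounded (range v) \<and> (\<exists>L. L-lipschitz_on UNIV v) \<and>
     viscosity_solution (\<lambda>q r x. \<delta> * r + H (p + q) x) v"

text \<open>A slope at which the equation can hold, for \<open>p\<close> in the ball of radius \<open>R\<close>, has norm at most
  \<open>max_slope Bd Cr R\<close>, by coercivity and the bound on \<open>\<delta> v\<^sup>\<delta>\<close>.\<close>

definition max_slope :: "(real \<Rightarrow> real) \<Rightarrow> (real \<Rightarrow> real) \<Rightarrow> real \<Rightarrow> real" where
  "max_slope Bd Cr R = Cr (Bd R + 1) + R"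

text \<open>
  A realization of the random Hamiltonian, with explicit moduli. The moduli do not depend on the
  realization, and all estimates below are in terms of them; this uniformity is what the
  measurability and the ergodic arguments live on.
\<close>

locale hamiltonian =
  fixes H :: "'a::euclidean_space \<Rightarrow> 'a \<Rightarrow> real" and Bd Lp Cr :: "real \<Rightarrow> real"
  assumes bound: "\<And>R q x. norm q \<le> R \<Longrightarrow> \<bar>H q x\<bar> \<le> Bd R"
    and lip: "\<And>R q1 q2 x1 x2. norm q1 \<le> R \<Longrightarrow> norm q2 \<le> R \<Longrightarrow>
               \<bar>H q1 x1 - H q2 x2\<bar> \<le> Lp R * (norm (q1 - q2) + norm (x1 - x2))"
    and coer: "\<And>a q x. Cr a \<le> norm q \<Longrightarrow> a \<le> H q x"
    and Lp_nonneg: "\<And>R. 0 \<le> Lp R" and Cr_pos: "\<And>a. 0 < Cr a"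
begin

lemma Bd_nonneg: "0 \<le> R \<Longrightarrow> 0 \<le> Bd R"
  using bound[of 0 R 0] by simp

lemma H_tendsto:
  assumes "(f \<longlongrightarrow> q) F" "(g \<longlongrightarrow> x) F"
  shows "((\<lambda>n. H (f n) (g n)) \<longlongrightarrow> H q x) F"
proof -
  have f: "((\<lambda>n. norm (f n - q)) \<longlongrightarrow> 0) F" and g: "((\<lambda>n. norm (g n - x)) \<longlongrightarrow> 0) F"
    using assms by (auto intro: tendsto_norm_zero LIM_zero)
  have ev: "\<forall>\<^sub>F n in F. norm (f n - q) < 1" using order_tendstoD(2)[OF f, of 1] by simp
  have "((\<lambda>n. Lp (norm q + 1) * (norm (f n - q) + norm (g n - x))) \<longlongrightarrow> Lp (norm q + 1) * (0 + 0)) F"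
    by (intro tendsto_intros f g)
  then have lim: "((\<lambda>n. Lp (norm q + 1) * (norm (f n - q) + norm (g n - x))) \<longlongrightarrow> 0) F" by simp
  have "((\<lambda>n. H (f n) (g n) - H q x) \<longlongrightarrow> 0) F"
  proof (rule Lim_null_comparison[OF _ lim])
    show "\<forall>\<^sub>F n in F. norm (H (f n) (g n) - H q x) \<le> Lp (norm q + 1) * (norm (f n - q) + norm (g n - x))"
      using ev
    proof eventually_elim
      case (elim n)
      then have "norm (f n) \<le> norm q + 1" using norm_triangle_sub[of "f n" q] by linarith
      then show ?case unfolding real_norm_def by (intro lip) auto
    qed
  qed
  then show ?thesis by (rule LIM_zero_cancel)
qed

abbreviation Lip :: "real \<Rightarrow> real" where
  "Lip \<equiv> max_slope Bd Cr"

lemma Lip_pos: "R \<ge> 0 \<Longrightarrow> Lip R > 0"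
  using Cr_pos[of "Bd R + 1"] by (simp add: max_slope_def)

lemma slope_bound:
  assumes "norm p \<le> R" "H (p + q) x \<le> Bd R"
  shows "norm q \<le> Lip R"
proof -
  have "norm (p + q) \<le> Cr (Bd R + 1)"
    using coer[of "Bd R + 1" "p + q" x] assms(2) by linarith
  then show ?thesis unfolding max_slope_def using norm_triangle_ineq4[of "p + q" p] assms(1) by simp
qed

lemma approx_solutionD:
  assumes "approx_solution H p \<delta> v"
  shows "bounded (range v)" "continuous_on UNIV v"
    "\<And>x q. q \<in> superjet v x \<Longrightarrow> \<delta> * v x + H (p + q) x \<le> 0"
    "\<And>x q. q \<in> subjet v x \<Longrightarrow> \<delta> * v x + H (p + q) x \<ge> 0"
  using assms unfolding approx_solution_def viscosity_solution_def
    viscosity_subsolution_iff_superjet viscosity_supersolution_iff_subjet by auto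

lemma comp_same:
  assumes "norm p \<le> R" "norm q1 \<le> P" "norm q2 \<le> P"
  shows "H (p + q2) y - H (p + q1) x \<le> Lp (R + P) * (norm (q1 - q2) + norm (x - y))"
proof -
  have "\<bar>H (p + q2) y - H (p + q1) x\<bar> \<le> Lp (R + P) * (norm ((p + q2) - (p + q1)) + norm (y - x))"
    using assms norm_triangle_ineq[of p q1] norm_triangle_ineq[of p q2] by (intro lip) linarith+
  then show ?thesis by (simp add: norm_minus_commute)
qed

lemma comparison_same:
  assumes "\<delta> > 0" "L1-lipschitz_on UNIV u" "L2-lipschitz_on UNIV v" "bounded (range u)" "bounded (range v)"
    and sub: "\<And>x q. q \<in> superjet u x \<Longrightarrow> \<delta> * u x + H (p + q) x \<le> 0"
    and super: "\<And>x q. q \<in> subjet v x \<Longrightarrow> \<delta> * v x + H (p + q) x \<ge> 0"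
  shows "u x \<le> v x"
proof -
  define L where "L = max L1 L2"
  have "\<delta> * (u x - v x) \<le> 0"
    using assms lipschitz_on_mono[OF assms(2), of UNIV L] lipschitz_on_mono[OF assms(3), of UNIV L]
      comp_same[of p "norm p" _ "2 * L + 1"] Lp_nonneg
    by (intro global_comparison[where ?G1.0 = "\<lambda>q. H (p + q)" and ?G2.0 = "\<lambda>q. H (p + q)" and L = L
          and C = "Lp (norm p + (2 * L + 1))"]) (auto simp: L_def)
  then show ?thesis using \<open>\<delta> > 0\<close> by (simp add: mult_le_0_iff)
qed

lemma const_subjet:
  assumes "norm p \<le> R" "\<delta> > 0" "q \<in> subjet (\<lambda>_. Bd R / \<delta>) x"
  shows "\<delta> * (Bd R / \<delta>) + H (p + q) x \<ge> 0"
proof -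
  have "q = 0" using assms(3) subjet_const by blast
  then show ?thesis using bound[OF assms(1), of x] assms(2) by simp
qed

lemma const_superjet:
  assumes "norm p \<le> R" "\<delta> > 0" "q \<in> superjet (\<lambda>_. - Bd R / \<delta>) x"
  shows "\<delta> * (- Bd R / \<delta>) + H (p + q) x \<le> 0"
proof -
  have "q = 0" using assms(3) superjet_const by blast
  then show ?thesis using bound[OF assms(1), of x] assms(2) by simp
qed

lemma const_lipschitz: "0-lipschitz_on UNIV (\<lambda>_::'a. c::real)"
  by (rule lipschitz_onI) auto

lemma approx_solution_bound:
  assumes "norm p \<le> R" "\<delta> > 0" "approx_solution H p \<delta> v"
  shows "\<bar>\<delta> * v x\<bar> \<le> Bd R"
proof -
  obtain L where L: "L-lipschitz_on UNIV v" using assms(3) unfolding approx_solution_def by blast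
  note D = approx_solutionD[OF assms(3)]
  have "v x \<le> Bd R / \<delta>"
    by (rule comparison_same[OF assms(2) L const_lipschitz D(1) _ D(3) const_subjet[OF assms(1,2)]]) auto
  moreover have "- Bd R / \<delta> \<le> v x"
    by (rule comparison_same[OF assms(2) const_lipschitz L _ D(1) const_superjet[OF assms(1,2)] D(4)]) auto
  ultimately show ?thesis using assms(2) by (simp add: field_simps abs_le_iff)
qed

lemma approx_solution_le:
  assumes "\<delta> > 0" "approx_solution H p \<delta> v" "\<And>x. a \<le> H p x"
  shows "\<delta> * v x \<le> - a"
proof -
  obtain L where L: "L-lipschitz_on UNIV v" using assms(2) unfolding approx_solution_def by blast
  have "v x \<le> - a / \<delta>"
  proof (rule comparison_same[OF assms(1) L const_lipschitz approx_solutionD(1)[OF assms(2)] _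
        approx_solutionD(3)[OF assms(2)]])
    fix x q :: 'a assume "q \<in> subjet (\<lambda>_. - a / \<delta>) x"
    then have "q = 0" using subjet_const by blast
    then show "0 \<le> \<delta> * (- a / \<delta>) + H (p + q) x" using assms(1,3) by simp
  qed simp
  then show ?thesis using assms(1) by (simp add: field_simps)
qed

lemma approx_subsolution_lipschitz:
  assumes "norm p \<le> R" "continuous_on UNIV u" "\<And>x. - Bd R \<le> \<delta> * u x"
    and "\<And>x q. q \<in> superjet u x \<Longrightarrow> \<delta> * u x + H (p + q) x \<le> 0"
  shows "(Lip R)-lipschitz_on UNIV u"
proof (rule lipschitz_of_superjet_bound)
  have "R \<ge> 0" using assms(1) norm_ge_zero order_trans by blast
  then show "Lip R \<ge> 0" using Lip_pos by (simp add: less_imp_le)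
  fix y q assume "q \<in> superjet u y"
  then have "H (p + q) y \<le> Bd R" using assms(3)[of y] assms(4)[of q y] by linarith
  then show "norm q \<le> Lip R" using slope_bound assms(1) by blast
qed (use assms in auto)

lemma approx_solution_lipschitz:
  assumes "norm p \<le> R" "\<delta> > 0" "approx_solution H p \<delta> v"
  shows "(Lip R)-lipschitz_on UNIV v"
proof (rule approx_subsolution_lipschitz[OF assms(1)])
  show "- Bd R \<le> \<delta> * v x" for x using approx_solution_bound[OF assms, of x] by linarith
qed (use approx_solutionD[OF assms(3)] in auto)

lemma approx_solution_unique:
  assumes "\<delta> > 0" "approx_solution H p \<delta> v" "approx_solution H p \<delta> w"
  shows "v = w"
proof -
  note L = approx_solution_lipschitz[OF order_refl assms(1)]
  note Dv = approx_solutionD[OF assms(2)] and Dw = approx_solutionD[OF assms(3)]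
  have "v x \<le> w x" for x
    by (rule comparison_same[OF assms(1) L[OF assms(2)] L[OF assms(3)] Dv(1) Dw(1) Dv(3) Dw(4)])
  moreover have "w x \<le> v x" for x
    by (rule comparison_same[OF assms(1) L[OF assms(3)] L[OF assms(2)] Dw(1) Dv(1) Dw(3) Dv(4)])
  ultimately show ?thesis by (auto intro: antisym)
qed

text \<open>
  Perron's method. Coercivity makes all competitors equi-Lipschitz, so their supremum is Lipschitz and
  no semicontinuous envelopes are needed.
\<close>

lemma approx_solution_exists:
  fixes p :: 'a
  assumes \<delta>: "\<delta> > 0"
  shows "\<exists>v. approx_solution H p \<delta> v"
proof -
  define R where "R = norm p"
  have pR: "norm p \<le> R" and R0: "R \<ge> 0" by (auto simp: R_def)
  define b where "b = Bd R / \<delta>"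
  have \<delta>b: "\<delta> * b = Bd R" using \<delta> by (simp add: b_def)
  define S where "S = {u. continuous_on UNIV u \<and> bounded (range u) \<and> (\<forall>x. - b \<le> u x) \<and>
      (\<forall>x. \<forall>q\<in>superjet u x. \<delta> * u x + H (p + q) x \<le> 0)}"
  define L where "L = Lip R"
  have L0: "L > 0" using Lip_pos R0 by (simp add: L_def)
  have S_lip: "L-lipschitz_on UNIV u" if "u \<in> S" for u
    unfolding L_def
  proof (rule approx_subsolution_lipschitz[OF pR])
    show "- Bd R \<le> \<delta> * u x" for x
      using that \<delta> mult_left_mono[of "- b" "u x" \<delta>] by (simp add: S_def \<delta>b)
  qed (use that in \<open>auto simp: S_def\<close>)
  have S_le: "u x \<le> b" if "u \<in> S" for u x
    unfolding b_def
    by (rule comparison_same[OF \<delta> S_lip[OF that] const_lipschitz _ _ _ const_subjet[OF pR \<delta>]])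
       (use that in \<open>auto simp: S_def\<close>)
  have const_S: "(\<lambda>_. - b) \<in> S"
    using const_superjet[OF pR \<delta>] by (auto simp: S_def b_def)
  define V where "V = (\<lambda>x. SUP u\<in>S. u x)"
  have bdd: "bdd_above ((\<lambda>u. u x) ` S)" for x
    using S_le by (auto intro!: bdd_aboveI)
  have V_ge: "u x \<le> V x" if "u \<in> S" for u x
    unfolding V_def by (rule cSUP_upper[OF that bdd])
  have V_le: "V x \<le> c" if "\<And>u. u \<in> S \<Longrightarrow> u x \<le> c" for c x
    unfolding V_def using const_S that by (intro cSUP_least) auto
  have V_bounds: "- b \<le> V x" "V x \<le> b" for x
    using V_ge[OF const_S, of x] V_le[of x b] S_le by auto
  have V_lip: "L-lipschitz_on UNIV V"
  proof (rule lipschitz_onI)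
    have le: "V x \<le> V y + L * dist x y" for x y
    proof (rule V_le)
      fix u assume u: "u \<in> S"
      have "dist (u x) (u y) \<le> L * dist x y" using lipschitz_onD[OF S_lip[OF u]] by simp
      then show "u x \<le> V y + L * dist x y"
        using V_ge[OF u, of y] unfolding dist_real_def by linarith
    qed
    show "dist (V x) (V y) \<le> L * dist x y" for x y
      using le[of x y] le[of y x] by (simp add: dist_real_def dist_commute)
  qed (use L0 in simp)
  have V_cont: "continuous_on UNIV V" using V_lip by (rule lipschitz_on_continuous_on)
  have V_bdd: "bounded (range V)"
    using V_bounds by (intro boundedI[of _ b]) (auto simp: abs_le_iff minus_le_iff)
  \<comment> \<open>Nearly optimal competitors, with the test function made strict by a quadratic term, have touching
    points that converge to \<open>x0\<close>.\<close>
  have V_sub: "\<delta> * V x0 + H (p + q) x0 \<le> 0" if q: "q \<in> superjet V x0" for x0 q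
  proof -
    obtain \<phi> D where \<phi>: "C1_with_gradient \<phi> D" "D x0 = q" "\<forall>\<^sub>F y in nhds x0. V y - \<phi> y \<le> V x0 - \<phi> x0"
      using q unfolding superjet_def by blast
    obtain r0 where r0: "r0 > 0" "\<And>y. dist y x0 < r0 \<Longrightarrow> V y - \<phi> y \<le> V x0 - \<phi> x0"
      using \<phi>(3) unfolding eventually_nhds_metric by blast
    define r where "r = r0 / 2"
    have r: "r > 0" "\<And>y. y \<in> cball x0 r \<Longrightarrow> V y - \<phi> y \<le> V x0 - \<phi> x0"
      using r0 by (auto simp: r_def dist_commute)
    have \<phi>c: "continuous_on A \<phi>" for A
      using \<phi>(1) unfolding C1_with_gradient_def gderiv_def
      by (meson continuous_at_imp_continuous_on has_derivative_continuous)
    have ex: "\<exists>u y. u \<in> S \<and> V x0 < u x0 + 1 / real (Suc n) \<and> y \<in> cball x0 r \<and>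
        (\<forall>z\<in>cball x0 r. u z - (\<phi> z + (norm (z - x0))\<^sup>2) \<le> u y - (\<phi> y + (norm (y - x0))\<^sup>2))" for n
    proof -
      have "V x0 - 1 / real (Suc n) < V x0" by simp
      then obtain u where u: "u \<in> S" "V x0 - 1 / real (Suc n) < u x0"
        unfolding V_def using less_cSUP_iff[OF _ bdd] const_S by blast
      have "continuous_on (cball x0 r) (\<lambda>z. u z - (\<phi> z + (norm (z - x0))\<^sup>2))"
        using u(1) \<phi>c by (intro continuous_intros) (auto simp: S_def intro: continuous_on_subset)
      then obtain y where "y \<in> cball x0 r"
        "\<forall>z\<in>cball x0 r. u z - (\<phi> z + (norm (z - x0))\<^sup>2) \<le> u y - (\<phi> y + (norm (y - x0))\<^sup>2)"
        using continuous_attains_sup[OF compact_cball, of x0 r] r(1) by force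
      then show ?thesis using u by (intro exI[of _ u] exI[of _ y]) auto
    qed
    then obtain u y where uy: "\<And>n. u n \<in> S" "\<And>n. V x0 < u n x0 + 1 / real (Suc n)" "\<And>n. y n \<in> cball x0 r"
      "\<And>n z. z \<in> cball x0 r \<Longrightarrow> u n z - (\<phi> z + (norm (z - x0))\<^sup>2) \<le> u n (y n) - (\<phi> (y n) + (norm (y n - x0))\<^sup>2)"
      by metis
    have dist_y: "(norm (y n - x0))\<^sup>2 \<le> 1 / real (Suc n)" for n
    proof -
      have "u n x0 - \<phi> x0 \<le> u n (y n) - \<phi> (y n) - (norm (y n - x0))\<^sup>2"
        using uy(4)[of x0 n] r(1) by simp
      moreover have "u n (y n) \<le> V (y n)" using V_ge uy(1) by blast
      moreover have "V (y n) - \<phi> (y n) \<le> V x0 - \<phi> x0" using r(2) uy(3) by blast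
      ultimately show ?thesis using uy(2)[of n] by linarith
    qed
    have lim0: "(\<lambda>n. 1 / real (Suc n)) \<longlonglongrightarrow> 0" by (rule LIMSEQ_Suc[OF lim_1_over_n])
    have "(\<lambda>n. (norm (y n - x0))\<^sup>2) \<longlonglongrightarrow> 0"
      by (rule tendsto_sandwich[OF _ _ tendsto_const lim0]) (auto intro!: always_eventually dist_y simp del: of_nat_Suc)
    from tendsto_real_sqrt[OF this] have "(\<lambda>n. norm (y n - x0)) \<longlonglongrightarrow> 0"
      by simp
    then have y_lim: "y \<longlonglongrightarrow> x0"
      using LIM_zero_cancel tendsto_norm_zero_iff by blast
    have u_lim: "(\<lambda>n. u n (y n)) \<longlonglongrightarrow> V x0"
    proof (rule LIM_zero_cancel, rule Lim_null_comparison)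
      show "\<forall>\<^sub>F n in sequentially. norm (u n (y n) - V x0) \<le> L * dist (y n) x0 + 1 / real (Suc n)"
      proof (rule always_eventually, rule allI)
        fix n
        have "dist (u n (y n)) (u n x0) \<le> L * dist (y n) x0" using lipschitz_onD[OF S_lip[OF uy(1)]] by simp
        then show "norm (u n (y n) - V x0) \<le> L * dist (y n) x0 + 1 / real (Suc n)"
          using uy(2)[of n] V_ge[OF uy(1)[of n], of x0] unfolding dist_real_def real_norm_def by linarith
      qed
      have "(\<lambda>n. L * dist (y n) x0 + 1 / real (Suc n)) \<longlonglongrightarrow> L * dist x0 x0 + 0"
        by (intro tendsto_intros y_lim lim0)
      then show "(\<lambda>n. L * dist (y n) x0 + 1 / real (Suc n)) \<longlonglongrightarrow> 0" by simp
    qed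
    define Q where "Q = (\<lambda>n. D (y n) + 1 *\<^sub>R (2 *\<^sub>R (y n - x0)))"
    have "(\<lambda>n. D (y n)) \<longlonglongrightarrow> D x0"
      using \<phi>(1) y_lim unfolding C1_with_gradient_def
      by (metis continuous_on_eq_continuous_at continuous_within_tendsto_compose' UNIV_I open_UNIV)
    then have "Q \<longlonglongrightarrow> D x0 + 1 *\<^sub>R (2 *\<^sub>R (x0 - x0))"
      unfolding Q_def by (intro tendsto_intros y_lim)
    then have Q_lim: "Q \<longlonglongrightarrow> q" by (simp add: \<phi>(2))
    have "(\<lambda>n. p + Q n) \<longlonglongrightarrow> p + q" by (intro tendsto_intros Q_lim)
    then have "(\<lambda>n. \<delta> * u n (y n) + H (p + Q n) (y n)) \<longlonglongrightarrow> \<delta> * V x0 + H (p + q) x0"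
      by (rule tendsto_add[OF tendsto_mult_left[OF u_lim] H_tendsto[OF _ y_lim]])
    moreover have "\<forall>\<^sub>F n in sequentially. \<delta> * u n (y n) + H (p + Q n) (y n) \<le> 0"
      using tendstoD[OF y_lim r(1)]
    proof eventually_elim
      case (elim n)
      have "Q n \<in> superjet (u n) (y n)"
        unfolding Q_def
      proof (rule superjetI[of "\<lambda>z. \<phi> z + 1 * (norm (z - x0))\<^sup>2" "\<lambda>z. D z + 1 *\<^sub>R (2 *\<^sub>R (z - x0))" _ _ "ball x0 r"])
        show "C1_with_gradient (\<lambda>z. \<phi> z + 1 * (norm (z - x0))\<^sup>2) (\<lambda>z. D z + 1 *\<^sub>R (2 *\<^sub>R (z - x0)))"
          by (intro C1_add C1_cmult C1_norm_sq \<phi>)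
        fix z assume "z \<in> ball x0 r"
        then show "u n z - (\<phi> z + 1 * (norm (z - x0))\<^sup>2) \<le> u n (y n) - (\<phi> (y n) + 1 * (norm (y n - x0))\<^sup>2)"
          using uy(4)[of z n] by simp
      qed (use elim in \<open>auto simp: dist_commute\<close>)
      then show ?case using uy(1)[of n] by (simp add: S_def)
    qed
    ultimately show ?thesis by (rule tendsto_upperbound) simp
  qed
  \<comment> \<open>Otherwise the test function, raised above \<open>V\<close> near \<open>x0\<close>, gives a larger competitor.\<close>
  have V_super: "\<delta> * V x0 + H (p + q) x0 \<ge> 0" if q: "q \<in> subjet V x0" for x0 q
  proof (rule ccontr)
    assume neg: "\<not> ?thesis"
    define \<kappa> where "\<kappa> = - (\<delta> * V x0 + H (p + q) x0) / 2"
    have \<kappa>: "\<kappa> > 0" using neg by (simp add: \<kappa>_def)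
    have \<kappa>2: "\<delta> * V x0 + H (p + q) x0 = - 2 * \<kappa>" by (simp add: \<kappa>_def)
    obtain \<phi> D where \<phi>: "C1_with_gradient \<phi> D" "D x0 = q" "\<forall>\<^sub>F y in nhds x0. V y - \<phi> y \<ge> V x0 - \<phi> x0"
      using q unfolding subjet_def by blast
    obtain r0 where r0: "r0 > 0" "\<And>y. dist y x0 < r0 \<Longrightarrow> V y - \<phi> y \<ge> V x0 - \<phi> x0"
      using \<phi>(3) unfolding eventually_nhds_metric by blast
    have "isCont \<phi> x0" and Dc: "isCont D x0"
      using \<phi>(1) unfolding C1_with_gradient_def gderiv_def
      by (auto intro: has_derivative_continuous simp: continuous_on_eq_continuous_at)
    then have "((\<lambda>y. \<delta> * (\<phi> y - \<phi> x0 + V x0) + H (p + (D y + (-1) *\<^sub>R (2 *\<^sub>R (y - x0)))) y) \<longlongrightarrow>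
        \<delta> * (\<phi> x0 - \<phi> x0 + V x0) + H (p + (D x0 + (-1) *\<^sub>R (2 *\<^sub>R (x0 - x0)))) x0) (at x0)"
      by (intro tendsto_intros H_tendsto) (auto simp: isCont_def)
    then have "\<forall>\<^sub>F y in at x0. \<delta> * (\<phi> y - \<phi> x0 + V x0) + H (p + (D y + (-1) *\<^sub>R (2 *\<^sub>R (y - x0)))) y < - \<kappa>"
      by (rule order_tendstoD) (use \<kappa> \<phi>(2) \<kappa>2 in simp)
    then obtain r1 where r1: "r1 > 0" "\<And>y. y \<noteq> x0 \<Longrightarrow> dist y x0 < r1 \<Longrightarrow>
        \<delta> * (\<phi> y - \<phi> x0 + V x0) + H (p + (D y + (-1) *\<^sub>R (2 *\<^sub>R (y - x0)))) y < - \<kappa>"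
      unfolding eventually_at by blast
    define r where "r = min r0 r1"
    have r: "r > 0" using r0 r1 by (simp add: r_def)
    have near: "\<delta> * (\<phi> y - \<phi> x0 + V x0) + H (p + (D y + (-1) *\<^sub>R (2 *\<^sub>R (y - x0)))) y < - \<kappa>"
      if "dist y x0 < r" for y
      using that r1(2)[of y] \<kappa> \<phi>(2) \<kappa>2 by (cases "y = x0") (auto simp: r_def)
    define \<epsilon> where "\<epsilon> = min (r\<^sup>2 / 4) (\<kappa> / \<delta>)"
    have \<epsilon>: "\<epsilon> > 0" "\<epsilon> \<le> r\<^sup>2 / 4" "\<delta> * \<epsilon> \<le> \<kappa>"
      using r \<kappa> \<delta> by (auto simp: \<epsilon>_def min_def field_simps)
    define \<psi> where "\<psi> = (\<lambda>y. \<phi> y + (-1) * (norm (y - x0))\<^sup>2 + (V x0 - \<phi> x0 + \<epsilon>))"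
    define E where "E = (\<lambda>y. D y + (-1) *\<^sub>R (2 *\<^sub>R (y - x0)) + 0)"
    have \<psi>C1: "C1_with_gradient \<psi> E" unfolding \<psi>_def E_def
      by (intro C1_add C1_cmult C1_norm_sq C1_const \<phi>)
    then have \<psi>c: "continuous_on A \<psi>" for A
      unfolding C1_with_gradient_def gderiv_def
      by (meson continuous_at_imp_continuous_on has_derivative_continuous)
    have \<psi>_le: "\<psi> y \<le> V y + \<epsilon> - (norm (y - x0))\<^sup>2" if "dist y x0 < r" for y
      using r0(2)[of y] that by (simp add: \<psi>_def r_def)
    define W where "W = (\<lambda>y. if y \<in> ball x0 r then max (V y) (\<psi> y) else V y)"
    have W_ge: "V y \<le> W y" for y by (simp add: W_def)
    have W_le: "W y \<le> V y + \<epsilon>" for y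
    proof (cases "y \<in> ball x0 r")
      case True
      then have "\<psi> y \<le> V y + \<epsilon>"
        using \<psi>_le[of y] zero_le_power2[of "norm (y - x0)"] unfolding mem_ball dist_commute[of x0] by linarith
      then show ?thesis using True \<epsilon>(1) by (simp add: W_def)
    qed (use \<epsilon>(1) in \<open>simp add: W_def\<close>)
    have W_out: "W y = V y" if "y \<in> - cball x0 (r / 2)" for y
    proof (cases "y \<in> ball x0 r")
      case True
      have "r / 2 < norm (y - x0)" using that by (simp add: dist_norm norm_minus_commute)
      then have "(r / 2)\<^sup>2 \<le> (norm (y - x0))\<^sup>2" using r by (intro power_mono) auto
      then have "\<epsilon> \<le> (norm (y - x0))\<^sup>2" using \<epsilon>(2) by (simp add: power_divide)
      then have "\<psi> y \<le> V y" using \<psi>_le[of y] True by (simp add: dist_commute)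
      then show ?thesis by (simp add: W_def)
    qed (simp add: W_def)
    have W_cont: "continuous_on UNIV W"
    proof -
      have "continuous_on (ball x0 r) W"
        by (rule continuous_on_eq[of _ "\<lambda>y. max (V y) (\<psi> y)"])
           (auto simp: W_def intro!: continuous_on_max \<psi>c continuous_on_subset[OF V_cont])
      moreover have "continuous_on (- cball x0 (r / 2)) W"
        by (rule continuous_on_eq[of _ V]) (use W_out in \<open>auto intro: continuous_on_subset[OF V_cont]\<close>)
      moreover have "ball x0 r \<union> - cball x0 (r / 2) = UNIV" using r by auto
      ultimately show ?thesis
        using continuous_on_open_Un[of "ball x0 r" "- cball x0 (r / 2)" W] by auto
    qed
    have "W \<in> S" unfolding S_def
    proof (intro CollectI conjI allI ballI)
      show "bounded (range W)"
      proof (rule boundedI)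
        fix z assume "z \<in> range W"
        then obtain y where "z = W y" by blast
        then show "norm z \<le> b + \<epsilon>"
          using W_ge[of y] W_le[of y] V_bounds[of y] \<epsilon>(1) by (auto simp: abs_le_iff)
      qed
      show "- b \<le> W y" for y using W_ge[of y] V_bounds(1)[of y] by linarith
      fix y q' assume q': "q' \<in> superjet W y"
      show "\<delta> * W y + H (p + q') y \<le> 0"
      proof (cases "W y = V y")
        case True
        have "q' \<in> superjet V y"
          by (rule superjet_of_bound_above[OF q']) (use W_ge True in \<open>auto intro: always_eventually\<close>)
        then show ?thesis using V_sub True by simp
      next
        case False
        then have y: "y \<in> ball x0 r" "W y = \<psi> y" by (auto simp: W_def max_def split: if_splits)
        have "\<forall>\<^sub>F z in nhds y. z \<in> ball x0 r" using y(1) by (intro eventually_nhds_in_open) auto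
        then have "\<forall>\<^sub>F z in nhds y. \<psi> z \<le> W z" by eventually_elim (simp add: W_def)
        then have "q' \<in> superjet \<psi> y" using superjet_of_bound_above[OF q'] y(2) by simp
        then have "q' = E y" using superjet_C1[OF \<psi>C1] by blast
        then have q'_eq: "q' = D y + (-1) *\<^sub>R (2 *\<^sub>R (y - x0))" by (simp add: E_def)
        have "\<psi> y \<le> (\<phi> y - \<phi> x0 + V x0) + \<epsilon>" by (simp add: \<psi>_def)
        then have "\<delta> * W y \<le> \<delta> * ((\<phi> y - \<phi> x0 + V x0) + \<epsilon>)" using \<delta> y(2) by simp
        also have "\<dots> = \<delta> * (\<phi> y - \<phi> x0 + V x0) + \<delta> * \<epsilon>" by (rule distrib_left)
        finally show ?thesis
          using near[of y] y(1) \<epsilon>(3) unfolding q'_eq by (simp add: dist_commute)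
      qed
    qed (rule W_cont)
    then have "W x0 \<le> V x0" by (rule V_ge)
    moreover have "W x0 \<ge> V x0 + \<epsilon>" using r by (simp add: W_def \<psi>_def)
    ultimately show False using \<epsilon>(1) by linarith
  qed
  have "approx_solution H p \<delta> V"
    unfolding approx_solution_def viscosity_solution_def viscosity_subsolution_iff_superjet
      viscosity_supersolution_iff_subjet
    using V_bdd V_lip V_cont V_sub V_super by blast
  then show ?thesis by blast
qed

lemma approx_solution_diff_slope:
  assumes R: "norm p1 \<le> R" "norm p2 \<le> R" and \<delta>: "\<delta> > 0"
    and v1: "approx_solution H p1 \<delta> v1" and v2: "approx_solution H p2 \<delta> v2"
  shows "\<delta> * (v1 x - v2 x) \<le> Lp (R + (2 * Lip R + 1)) * norm (p1 - p2)"
proof (rule global_comparison[OF \<delta> Lp_nonneg _ approx_solution_lipschitz[OF R(1) \<delta> v1]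
      approx_solution_lipschitz[OF R(2) \<delta> v2] approx_solutionD(1)[OF v1] approx_solutionD(1)[OF v2]
      approx_solutionD(3)[OF v1] approx_solutionD(4)[OF v2]])
  fix q1 q2 x y :: 'a
  assume q: "norm q1 \<le> 2 * Lip R + 1" "norm q2 \<le> 2 * Lip R + 1"
  define P where "P = R + (2 * Lip R + 1)"
  have "\<bar>H (p2 + q2) y - H (p1 + q1) x\<bar> \<le> Lp P * (norm ((p2 + q2) - (p1 + q1)) + norm (y - x))"
    using q R norm_triangle_ineq[of p1 q1] norm_triangle_ineq[of p2 q2] unfolding P_def
    by (intro lip) linarith+
  also have "\<dots> \<le> Lp P * ((norm (p1 - p2) + norm (q1 - q2)) + norm (x - y))"
  proof (intro mult_left_mono add_mono Lp_nonneg)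
    have "norm ((p2 + q2) - (p1 + q1)) = norm ((p1 - p2) + (q1 - q2))"
      by (metis add_diff_add norm_minus_commute)
    then show "norm ((p2 + q2) - (p1 + q1)) \<le> norm (p1 - p2) + norm (q1 - q2)"
      using norm_triangle_ineq by metis
  qed (simp add: norm_minus_commute)
  finally show "H (p2 + q2) y - H (p1 + q1) x \<le> Lp (R + (2 * Lip R + 1)) * norm (p1 - p2)
      + Lp (R + (2 * Lip R + 1)) * (norm (q1 - q2) + norm (x - y))"
    by (simp add: P_def algebra_simps)
qed (simp add: Lp_nonneg)

text \<open>The solution for \<open>\<delta>2\<close> solves the equation for \<open>\<delta>1\<close> up to the error \<open>|\<delta>1 - \<delta>2| |v2|\<close>.\<close>

lemma approx_solution_diff_discount:
  assumes R: "norm p \<le> R" and \<delta>: "\<delta>1 > 0" "\<delta>2 > 0"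
    and v1: "approx_solution H p \<delta>1 v1" and v2: "approx_solution H p \<delta>2 v2"
  shows "\<bar>\<delta>1 * v1 x - \<delta>2 * v2 x\<bar> \<le> 2 * (\<bar>\<delta>1 - \<delta>2\<bar> * Bd R / \<delta>2)"
proof -
  define \<epsilon> where "\<epsilon> = \<bar>\<delta>1 - \<delta>2\<bar> * Bd R / \<delta>2"
  have R0: "R \<ge> 0" using R norm_ge_zero order_trans by blast
  have \<epsilon>: "\<epsilon> \<ge> 0" using Bd_nonneg[OF R0] \<delta> by (simp add: \<epsilon>_def)
  have diff: "\<bar>\<delta>1 * v2 y - \<delta>2 * v2 y\<bar> \<le> \<epsilon>" for y
  proof -
    have "\<bar>\<delta>1 * v2 y - \<delta>2 * v2 y\<bar> = \<bar>\<delta>1 - \<delta>2\<bar> / \<delta>2 * \<bar>\<delta>2 * v2 y\<bar>"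
      using \<delta> by (simp add: abs_mult flip: left_diff_distrib)
    also have "\<dots> \<le> \<bar>\<delta>1 - \<delta>2\<bar> / \<delta>2 * Bd R"
      using approx_solution_bound[OF R \<delta>(2) v2] \<delta> by (intro mult_left_mono) auto
    finally show ?thesis by (simp add: \<epsilon>_def)
  qed
  note l1 = approx_solution_lipschitz[OF R \<delta>(1) v1] and l2 = approx_solution_lipschitz[OF R \<delta>(2) v2]
  note b1 = approx_solutionD(1)[OF v1] and b2 = approx_solutionD(1)[OF v2]
  have "\<delta>1 * (v1 x - v2 x) \<le> \<epsilon>"
  proof (rule global_comparison[where ?G1.0 = "\<lambda>q x. H (p + q) x" and ?G2.0 = "\<lambda>q x. H (p + q) x + \<epsilon>",
        OF \<delta>(1) Lp_nonneg \<epsilon> l1 l2 b1 b2 approx_solutionD(3)[OF v1]])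
    fix q y assume "q \<in> subjet v2 y"
    then show "\<delta>1 * v2 y + (H (p + q) y + \<epsilon>) \<ge> 0"
      using approx_solutionD(4)[OF v2, of q y] diff[of y] by linarith
  next
    fix q1 q2 x y :: 'a
    assume "norm q1 \<le> 2 * Lip R + 1" "norm q2 \<le> 2 * Lip R + 1"
    from comp_same[OF R this, of y x]
    show "H (p + q2) y + \<epsilon> - H (p + q1) x \<le> \<epsilon> + Lp (R + (2 * Lip R + 1)) * (norm (q1 - q2) + norm (x - y))"
      by simp
  qed
  moreover have "\<delta>1 * (v2 x - v1 x) \<le> \<epsilon>"
  proof (rule global_comparison[where ?G2.0 = "\<lambda>q x. H (p + q) x" and ?G1.0 = "\<lambda>q x. H (p + q) x - \<epsilon>",
        OF \<delta>(1) Lp_nonneg \<epsilon> l2 l1 b2 b1 _ approx_solutionD(4)[OF v1]])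
    fix q y assume "q \<in> superjet v2 y"
    then show "\<delta>1 * v2 y + (H (p + q) y - \<epsilon>) \<le> 0"
      using approx_solutionD(3)[OF v2, of q y] diff[of y] by linarith
  next
    fix q1 q2 x y :: 'a
    assume "norm q1 \<le> 2 * Lip R + 1" "norm q2 \<le> 2 * Lip R + 1"
    from comp_same[OF R this, of y x]
    show "H (p + q2) y - (H (p + q1) x - \<epsilon>) \<le> \<epsilon> + Lp (R + (2 * Lip R + 1)) * (norm (q1 - q2) + norm (x - y))"
      by simp
  qed
  ultimately show ?thesis
    using diff[of x] unfolding \<epsilon>_def[symmetric] right_diff_distrib by linarith
qed

lemma approx_solution_translate:
  assumes v: "approx_solution H p \<delta> v"
  shows "approx_solution (\<lambda>q x. H q (x + z)) p \<delta> (\<lambda>x. v (x + z))"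
proof -
  note D = approx_solutionD[OF v]
  obtain L where L: "L-lipschitz_on UNIV v" using v unfolding approx_solution_def by blast
  have "L-lipschitz_on UNIV (\<lambda>x. v (x + z))"
  proof (rule lipschitz_onI)
    show "dist (v (x + z)) (v (y + z)) \<le> L * dist x y" for x y
      using lipschitz_onD[OF L, of "x + z" "y + z"] by simp
  qed (rule lipschitz_on_nonneg[OF L])
  moreover from this have "continuous_on UNIV (\<lambda>x. v (x + z))"
    by (rule lipschitz_on_continuous_on)
  moreover have "bounded (range (\<lambda>x. v (x + z)))"
    using D(1) by (rule bounded_subset) auto
  moreover have "\<delta> * v (x + z) + H (p + q) (x + z) \<le> 0" if "q \<in> superjet (\<lambda>x. v (x + z)) x" for q x
    by (rule D(3)[OF superjet_translate[OF that]])
  moreover have "\<delta> * v (x + z) + H (p + q) (x + z) \<ge> 0" if "q \<in> subjet (\<lambda>x. v (x + z)) x" for q x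
  proof (rule D(4))
    show "q \<in> subjet v (x + z)"
      using superjet_translate[of "- q" "\<lambda>y. - v y" z x] that by (simp add: subjet_eq_superjet_uminus)
  qed
  ultimately show ?thesis
    unfolding approx_solution_def viscosity_solution_def
      viscosity_subsolution_iff_superjet viscosity_supersolution_iff_subjet
    by (intro conjI exI allI ballI)
qed

end

text \<open>Only closeness of the Hamiltonians on a ball enters. The price is the last term, which is small when
  the radius \<open>R\<close> is large in comparison with \<open>B\<close>, that is, with \<open>1 / \<delta>\<close>.\<close>

lemma approx_solution_diff_local:
  fixes H1 H2 :: "'a::euclidean_space \<Rightarrow> 'a \<Rightarrow> real"
  assumes h1: "hamiltonian H1 Bd Lp Cr" and h2: "hamiltonian H2 Bd Lp Cr"
    and \<delta>: "\<delta> > 0" and K: "norm p \<le> K" and R: "R > 0" and B: "B = 2 * Bd K / \<delta>" and \<epsilon>: "\<epsilon> \<ge> 0"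
    and P: "2 * max_slope Bd Cr K + 2 * (B + 1) / R \<le> P"
    and v1: "approx_solution H1 p \<delta> v1" and v2: "approx_solution H2 p \<delta> v2"
    and close: "\<And>q x. norm q \<le> K + P \<Longrightarrow> norm x \<le> R + 1 \<Longrightarrow> \<bar>H1 q x - H2 q x\<bar> \<le> \<epsilon>"
  shows "\<delta> * (v1 0 - v2 0) \<le> \<epsilon> + Lp (K + P) * (2 * (B + 1) / R)"
proof -
  interpret h1: hamiltonian H1 Bd Lp Cr by (rule h1)
  interpret h2: hamiltonian H2 Bd Lp Cr by (rule h2)
  have K0: "K \<ge> 0" using K norm_ge_zero order_trans by blast
  have B0: "B \<ge> 0" using h1.Bd_nonneg[OF K0] \<delta> by (simp add: B)
  have diff: "v1 x - v2 x \<le> B" for x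
  proof -
    have "\<delta> * (v1 x - v2 x) \<le> 2 * Bd K"
      using h1.approx_solution_bound[OF K \<delta> v1, of x] h2.approx_solution_bound[OF K \<delta> v2, of x]
      unfolding right_diff_distrib by linarith
    then show ?thesis using \<delta> by (simp add: B field_simps)
  qed
  have comp: "H2 (p + q2) y - H1 (p + q1) x \<le> \<epsilon> + Lp (K + P) * (norm (q1 - q2) + norm (x - y))"
    if q: "norm q1 \<le> P" "norm q2 \<le> P" and x: "x \<in> ball 0 R" for q1 q2 x y
  proof -
    have "norm (p + q1) \<le> K + P" using q K norm_triangle_ineq[of p q1] by linarith
    then have "\<bar>H1 (p + q1) x - H2 (p + q1) x\<bar> \<le> \<epsilon>" using x by (intro close) auto
    then show ?thesis using h2.comp_same[OF K q, of y x] by linarith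
  qed
  show ?thesis
    by (rule local_comparison[OF \<delta> R h1.Lp_nonneg \<epsilon> B0 h1.approx_solution_lipschitz[OF K \<delta> v1]
        h2.approx_solution_lipschitz[OF K \<delta> v2] diff h1.approx_solutionD(3)[OF v1]
        h2.approx_solutionD(4)[OF v2] comp P])
qed

section \<open>Distances generated by chains\<close>

fun chain_cost :: "('a \<Rightarrow> 'a \<Rightarrow> real) \<Rightarrow> 'a \<Rightarrow> 'a list \<Rightarrow> 'a \<Rightarrow> real" where
  "chain_cost c x [] y = c x y"
| "chain_cost c x (z # zs) y = c x z + chain_cost c z zs y"

definition chain_dist :: "('a \<Rightarrow> 'a \<Rightarrow> real) \<Rightarrow> 'a \<Rightarrow> 'a \<Rightarrow> real" where
  "chain_dist c x y = (INF zs. chain_cost c x zs y)"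

lemma chain_cost_snoc: "chain_cost c x (zs @ [z]) y = chain_cost c x zs z + c z y"
  by (induction zs arbitrary: x) auto

lemma chain_cost_translate:
  "chain_cost (\<lambda>x y. c (x + w) (y + w)) x zs y = chain_cost c (x + w) (map (\<lambda>z. z + w) zs) (y + w)"
  by (induction zs arbitrary: x) auto

lemma chain_dist_translate:
  fixes c :: "'a::ab_group_add \<Rightarrow> 'a \<Rightarrow> real"
  shows "chain_dist (\<lambda>x y. c (x + w) (y + w)) x y = chain_dist c (x + w) (y + w)"
proof -
  have "surj (map (\<lambda>z. z + w))"
    by (rule surjI[of _ "map (\<lambda>z. z - w)"]) (simp add: o_def)
  then have "range (\<lambda>zs. chain_cost c (x + w) zs (y + w)) =
      range (\<lambda>zs. chain_cost c (x + w) (map (\<lambda>z. z + w) zs) (y + w))"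
    by (simp flip: image_image[of "\<lambda>zs. chain_cost c (x + w) zs (y + w)" "map (\<lambda>z. z + w)"])
  then show ?thesis unfolding chain_dist_def chain_cost_translate by simp
qed

locale step_cost =
  fixes c :: "'a::euclidean_space \<Rightarrow> 'a \<Rightarrow> real" and \<Lambda> :: real
  assumes c_lower: "\<And>x y. norm (y - x) \<le> c x y"
    and c_upper: "\<And>x y. c x y \<le> \<Lambda> * norm (y - x)"
    and c_cont_left: "\<And>y. continuous_on UNIV (\<lambda>x. c x y)"
    and c_cont_right: "\<And>x. continuous_on UNIV (\<lambda>y. c x y)"
begin

lemma \<Lambda>_ge_1: "1 \<le> \<Lambda>"
proof -
  obtain e :: 'a where "norm e = 1" using vector_choose_size[of 1] by auto
  then show ?thesis using c_lower[of e 0] c_upper[of 0 e] by simp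
qed

lemma chain_cost_lower: "norm (y - x) \<le> chain_cost c x zs y"
proof (induction zs arbitrary: x)
  case (Cons z zs)
  have "norm (y - x) \<le> norm (y - z) + norm (z - x)" using norm_triangle_ineq[of "y - z" "z - x"] by simp
  then show ?case using Cons[of z] c_lower[of z x] by simp
qed (simp add: c_lower)

lemma chain_bdd: "bdd_below (range (\<lambda>zs. chain_cost c x zs y))"
  using chain_cost_lower by (auto intro!: bdd_belowI)

abbreviation "m \<equiv> chain_dist c"

lemma m_le_chain: "m x y \<le> chain_cost c x zs y"
  unfolding chain_dist_def by (rule cINF_lower[OF chain_bdd]) simp

lemma m_greatest: "(\<And>zs. a \<le> chain_cost c x zs y) \<Longrightarrow> a \<le> m x y"
  unfolding chain_dist_def by (rule cINF_greatest) auto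

lemma m_lessD: "m x y < a \<Longrightarrow> \<exists>zs. chain_cost c x zs y < a"
  unfolding chain_dist_def using cINF_less_iff[OF _ chain_bdd] by blast

lemma m_le_c: "m x y \<le> c x y"
  using m_le_chain[of x y "[]"] by simp

lemma m_lower: "norm (y - x) \<le> m x y"
  by (rule m_greatest[OF chain_cost_lower])

lemma m_upper: "m x y \<le> \<Lambda> * norm (y - x)"
  using m_le_c c_upper order_trans by blast

lemma m_step: "m x y \<le> m x z + c z y"
proof -
  have "m x y - c z y \<le> m x z"
    using m_le_chain[of x y "_ @ [z]"] by (intro m_greatest) (simp add: chain_cost_snoc algebra_simps)
  then show ?thesis by simp
qed

text \<open>The functions that increase by at most \<open>c\<close> along each step are those that increase by at most
  the chain distance between any two points.\<close>

definition admissible :: "('a \<Rightarrow> real) \<Rightarrow> bool" where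
  "admissible u \<longleftrightarrow> (\<forall>x y. u y - u x \<le> c x y)"

lemma admissible_le_m:
  assumes "admissible u" shows "u y - u x \<le> m x y"
proof (rule m_greatest)
  show "u y - u x \<le> chain_cost c x zs y" for zs
  proof (induction zs arbitrary: x)
    case Nil
    then show ?case using assms unfolding admissible_def by simp
  next
    case (Cons z zs)
    have "u z - u x \<le> c x z" using assms unfolding admissible_def by blast
    then show ?case using Cons[of z] by simp
  qed
qed

lemma m_triangle: "m x y \<le> m x z + m z y"
proof -
  have "admissible (m x)" unfolding admissible_def using m_step[of x] by (simp add: algebra_simps)
  from admissible_le_m[OF this, of y z] show ?thesis by simp
qed

lemma admissible_neg_m: "admissible (\<lambda>z. - m z y)"
  unfolding admissible_def
proof (intro allI)
  fix x z show "- m z y - - m x y \<le> c x z"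
    using m_triangle[of x y z] m_le_c[of x z] by simp
qed

lemma m_lipschitz: "\<bar>m x y - m x' y'\<bar> \<le> \<Lambda> * (norm (x - x') + norm (y - y'))"
proof -
  have "m x y \<le> m x' y' + \<Lambda> * (norm (x - x') + norm (y - y'))" for x x' y y'
    using m_triangle[of x y x'] m_triangle[of x' y y'] m_upper[of x x'] m_upper[of y' y]
    by (simp add: distrib_left norm_minus_commute)
  from this[of x y x' y'] this[of x' y' x y] show ?thesis by (simp add: norm_minus_commute abs_le_iff)
qed

text \<open>Since \<open>c\<close> dominates the Euclidean distance, cheap chains cannot leave a ball, so functions that
  are admissible only on this ball still feel the global distance.\<close>

lemma locally_admissible_le_m:
  assumes loc: "\<And>y z. y \<in> ball x \<rho> \<Longrightarrow> z \<in> ball x \<rho> \<Longrightarrow> u z - u y \<le> c y z"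
    and \<rho>: "\<Lambda> * norm (y - x) < \<rho>"
  shows "u y - u x \<le> m x y"
proof (rule dense_ge)
  have chain: "u y - u z \<le> chain_cost c z zs y" if "norm (z - x) + chain_cost c z zs y < \<rho>" for z zs
    using that
  proof (induction zs arbitrary: z)
    case Nil
    have "norm (y - x) \<le> norm (z - x) + norm (y - z)" using norm_triangle_ineq[of "z - x" "y - z"] by simp
    then have "norm (y - x) < \<rho>" using Nil c_lower[of y z] by simp
    moreover have "norm (z - x) < \<rho>" using Nil chain_cost_lower[of y z "[]"] norm_ge_zero[of "y - z"] by linarith
    ultimately show ?case using loc[of z y] by (simp add: dist_norm norm_minus_commute)
  next
    case (Cons a zs)
    have "norm (a - x) \<le> norm (z - x) + norm (a - z)" using norm_triangle_ineq[of "z - x" "a - z"] by simp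
    then have a: "norm (a - x) + chain_cost c a zs y < \<rho>" using Cons.prems c_lower[of a z] by simp
    moreover have "norm (z - x) < \<rho>"
      using Cons.prems chain_cost_lower[of y z "a # zs"] norm_ge_zero[of "y - z"] by linarith
    moreover have "norm (a - x) < \<rho>"
      using a chain_cost_lower[of y a zs] norm_ge_zero[of "y - a"] by linarith
    ultimately show ?case
      using Cons.IH[of a] loc[of z a] by (simp add: dist_norm norm_minus_commute)
  qed
  fix a assume "m x y < a"
  moreover have "m x y < \<rho>" using m_upper[of x y] \<rho> by simp
  ultimately have "m x y < min a \<rho>" by simp
  then obtain zs where "chain_cost c x zs y < min a \<rho>" using m_lessD by blast
  then show "u y - u x \<le> a" using chain[of x zs] by simp
qed

lemma chain_cost_cont: "continuous_on UNIV (\<lambda>x. chain_cost c x zs y)"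
  by (cases zs) (auto intro!: continuous_intros c_cont_left)

text \<open>Moving the intermediate points one after the other into a dense set changes the cost arbitrarily
  little, which reduces the infimum over chains to a countable one.\<close>

lemma chain_cost_dense:
  assumes dense: "\<And>X :: 'a set. open X \<Longrightarrow> X \<noteq> {} \<Longrightarrow> \<exists>d\<in>Q. d \<in> X"
    and "chain_cost c x zs y < a"
  shows "\<exists>zs\<in>lists Q. chain_cost c x zs y < a"
  using assms(2)
proof (induction zs arbitrary: x a)
  case Nil
  then show ?case by (intro bexI[of _ "[]"]) auto
next
  case (Cons z zs)
  let ?X = "{w. c x w + chain_cost c w zs y < a}"
  have "open ?X"
    by (intro open_Collect_less continuous_on_add c_cont_right chain_cost_cont continuous_on_const)
  moreover have "z \<in> ?X" using Cons.prems by simp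
  ultimately obtain w where w: "w \<in> Q" "c x w + chain_cost c w zs y < a" using dense by blast
  then have "chain_cost c w zs y < a - c x w" by simp
  then obtain zs' where "zs' \<in> lists Q" "chain_cost c w zs' y < a - c x w" using Cons.IH by blast
  then show ?case using w by (intro bexI[of _ "w # zs'"]) auto
qed

lemma m_less_iff_dense:
  assumes dense: "\<And>X :: 'a set. open X \<Longrightarrow> X \<noteq> {} \<Longrightarrow> \<exists>d\<in>Q. d \<in> X"
  shows "m x y < a \<longleftrightarrow> (\<exists>zs\<in>lists Q. chain_cost c x zs y < a)"
  using m_lessD chain_cost_dense[OF dense] m_le_chain le_less_trans by blast

end

section \<open>Subsolutions of a convex equation as admissible functions\<close>

definition support :: "('a::euclidean_space \<Rightarrow> 'a \<Rightarrow> real) \<Rightarrow> real \<Rightarrow> 'a \<Rightarrow> 'a \<Rightarrow> real" where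
  "support H \<mu> x e = (SUP q\<in>{q. H q x \<le> \<mu>}. q \<bullet> e)"

definition level_cost :: "('a::euclidean_space \<Rightarrow> 'a \<Rightarrow> real) \<Rightarrow> real \<Rightarrow> real \<Rightarrow> 'a \<Rightarrow> 'a \<Rightarrow> real" where
  "level_cost H \<mu> C x y = support H \<mu> x (y - x) + C * (norm (y - x) * min 1 (norm (y - x)))"

text \<open>
  For a Hamiltonian that is convex in the slope, \<open>H(Du, x) \<le> \<mu>\<close> says that the increment of \<open>u\<close> over a
  small step \<open>e\<close> from \<open>x\<close> is at most the support function of the sublevel set at \<open>x\<close>, up to an error
  quadratic in \<open>e\<close> that accounts for the variation of the sublevel set. Including this error in the
  cost makes the correspondence exact, and the property of being a subsolution becomes a family of
  inequalities between values of \<open>u\<close>. The strict bound on the unit ball makes the sublevel sets vary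
  in a Lipschitz way and the cost comparable to the Euclidean distance.
\<close>

locale convex_level = hamiltonian +
  fixes \<mu> :: real
  assumes convex: "\<And>x. convex_on UNIV (\<lambda>q. H q x)"
    and low: "\<And>q x. norm q \<le> 1 \<Longrightarrow> H q x \<le> \<mu> - 1"
begin

definition \<Lambda>0 :: real where "\<Lambda>0 = Cr (\<mu> + 1)"
definition C0 :: real where "C0 = Lp \<Lambda>0"

lemma level_bounded: "H q x \<le> \<mu> \<Longrightarrow> norm q \<le> \<Lambda>0"
  using coer[of "\<mu> + 1" q x] unfolding \<Lambda>0_def by linarith

lemma C0_nonneg: "0 \<le> C0" by (simp add: C0_def Lp_nonneg)
lemma \<Lambda>0_pos: "0 < \<Lambda>0" by (simp add: \<Lambda>0_def Cr_pos)

lemma unit_in_level: "norm q \<le> 1 \<Longrightarrow> H q x \<le> \<mu>"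
  using low[of q x] by simp

lemma inner_le_\<Lambda>0: "H q x \<le> \<mu> \<Longrightarrow> q \<bullet> e \<le> \<Lambda>0 * norm e"
  using norm_cauchy_schwarz[of q e] mult_right_mono[OF level_bounded[of q x], of "norm e"] by simp

lemma support_ge: "H q x \<le> \<mu> \<Longrightarrow> q \<bullet> e \<le> support H \<mu> x e"
  unfolding support_def using inner_le_\<Lambda>0
  by (intro cSUP_upper) (auto intro!: bdd_aboveI)

lemma support_le: "(\<And>q. H q x \<le> \<mu> \<Longrightarrow> q \<bullet> e \<le> a) \<Longrightarrow> support H \<mu> x e \<le> a"
  unfolding support_def using unit_in_level[of 0 x] by (intro cSUP_least) auto

lemma support_lower: "norm e \<le> support H \<mu> x e"
proof -
  have "sgn e \<bullet> e \<le> support H \<mu> x e"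
    by (intro support_ge unit_in_level) (simp add: norm_sgn)
  moreover have "sgn e \<bullet> e = norm e"
    by (cases "e = 0") (simp_all add: sgn_div_norm dot_square_norm power2_eq_square)
  ultimately show ?thesis by simp
qed

lemma support_upper: "support H \<mu> x e \<le> \<Lambda>0 * norm e"
  by (rule support_le[OF inner_le_\<Lambda>0])

lemma support_scale_le: "s \<ge> 0 \<Longrightarrow> support H \<mu> x (s *\<^sub>R e) \<le> s * support H \<mu> x e"
  by (rule support_le) (simp add: support_ge mult_left_mono)

lemma support_lip_direction: "support H \<mu> x e \<le> support H \<mu> x e' + \<Lambda>0 * norm (e - e')"
proof (rule support_le)
  fix q assume q: "H q x \<le> \<mu>"
  have "q \<bullet> e = q \<bullet> e' + q \<bullet> (e - e')" by (simp add: inner_diff_right)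
  then show "q \<bullet> e \<le> support H \<mu> x e' + \<Lambda>0 * norm (e - e')"
    using support_ge[OF q, of e'] inner_le_\<Lambda>0[OF q, of "e - e'"] by simp
qed

text \<open>Moving from \<open>x\<close> to \<open>y\<close> raises \<open>H\<close> by at most \<open>C0 |x - y|\<close> on the sublevel set; shrinking the
  slope by the factor \<open>t\<close> towards the origin, where \<open>H \<le> \<mu> - 1\<close>, compensates this.\<close>

lemma support_lip: "support H \<mu> x e \<le> support H \<mu> y e + C0 * \<Lambda>0 * norm (x - y) * norm e"
proof (rule support_le)
  fix q assume q: "H q x \<le> \<mu>"
  define d where "d = C0 * norm (x - y)"
  have d: "d \<ge> 0" using C0_nonneg by (simp add: d_def)
  define t where "t = 1 / (1 + d)"
  have t: "0 \<le> t" "t \<le> 1" "t * (1 + d) = 1" using d by (auto simp: t_def)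
  have "\<bar>H q y - H q x\<bar> \<le> Lp \<Lambda>0 * (norm (q - q) + norm (y - x))"
    using level_bounded[OF q] by (intro lip) auto
  then have "H q y \<le> \<mu> + d" using q unfolding d_def C0_def by (simp add: norm_minus_commute)
  then have "t * H q y + (1 - t) * H 0 y \<le> t * (\<mu> + d) + (1 - t) * (\<mu> - 1)"
    using t low[of 0 y] by (intro add_mono mult_left_mono) auto
  also have "\<dots> = \<mu> + (t * (1 + d) - 1)" by (simp add: algebra_simps)
  also have "\<dots> = \<mu>" using t by simp
  finally have "t * H q y + (1 - t) * H 0 y \<le> \<mu>" .
  moreover have "H (t *\<^sub>R q) y \<le> t * H q y + (1 - t) * H 0 y"
    using convex_onD[OF convex[of y], of "1 - t" q 0] t by simp
  ultimately have "(t *\<^sub>R q) \<bullet> e \<le> support H \<mu> y e" by (intro support_ge) simp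
  then have "(1 + d) * (t * (q \<bullet> e)) \<le> (1 + d) * support H \<mu> y e"
    using d by (intro mult_left_mono) auto
  moreover have "(1 + d) * (t * (q \<bullet> e)) = t * (1 + d) * (q \<bullet> e)" by (simp add: mult_ac)
  ultimately have "q \<bullet> e \<le> support H \<mu> y e + d * support H \<mu> y e" using t(3) by (simp add: distrib_right)
  also have "\<dots> \<le> support H \<mu> y e + d * (\<Lambda>0 * norm e)"
    using d support_upper by (intro add_left_mono mult_left_mono) auto
  finally show "q \<bullet> e \<le> support H \<mu> y e + C0 * \<Lambda>0 * norm (x - y) * norm e"
    by (simp add: d_def mult_ac)
qed

text \<open>A closed convex set is the intersection of the half spaces given by its support function.\<close>

lemma level_of_support:
  assumes "\<And>e. q \<bullet> e \<le> support H \<mu> x e" shows "H q x \<le> \<mu>"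
proof (rule ccontr)
  assume neg: "\<not> ?thesis"
  let ?K = "{q. H q x \<le> \<mu>}"
  have "continuous_on UNIV (\<lambda>q. H q x)"
    unfolding continuous_on_def using H_tendsto[OF tendsto_ident_at tendsto_const] by blast
  then have "closed ?K" by (intro closed_Collect_le continuous_on_const)
  moreover have "convex ?K"
  proof (rule convexI)
    fix a b :: 'a and u v :: real
    assume *: "a \<in> ?K" "b \<in> ?K" "0 \<le> u" "0 \<le> v" "u + v = 1"
    have "H (u *\<^sub>R a + v *\<^sub>R b) x \<le> u * H a x + v * H b x"
      using convex[of x] * unfolding convex_on_def by blast
    also have "\<dots> \<le> u * \<mu> + v * \<mu>" using * by (intro add_mono mult_left_mono) auto
    also have "\<dots> = \<mu>" using *(5) by (metis distrib_right mult_1)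
    finally show "u *\<^sub>R a + v *\<^sub>R b \<in> ?K" by simp
  qed
  moreover have "q \<notin> ?K" using neg by simp
  ultimately obtain a b where ab: "a \<bullet> q < b" "\<And>p. p \<in> ?K \<Longrightarrow> b < a \<bullet> p"
    using separating_hyperplane_closed_point[of ?K q] by blast
  have "support H \<mu> x (- a) \<le> - b"
  proof (rule support_le)
    fix p assume "H p x \<le> \<mu>"
    then show "p \<bullet> (- a) \<le> - b" using ab(2)[of p] by (simp add: inner_commute)
  qed
  then show False using assms[of "- a"] ab(1) by (simp add: inner_commute)
qed

definition C1 :: real where "C1 = C0 * \<Lambda>0 + \<Lambda>0"
definition \<Lambda> :: real where "\<Lambda> = \<Lambda>0 + C1"

lemma C1_bounds: "0 \<le> C0 * \<Lambda>0" "C0 * \<Lambda>0 \<le> C1" "\<Lambda>0 \<le> C1" "0 \<le> C1"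
  using C0_nonneg \<Lambda>0_pos by (auto simp: C1_def)

abbreviation "c \<equiv> level_cost H \<mu> C1"

lemma support_tendsto:
  assumes "(f \<longlongrightarrow> x) F" "(g \<longlongrightarrow> e) F"
  shows "((\<lambda>n. support H \<mu> (f n) (g n)) \<longlongrightarrow> support H \<mu> x e) F"
proof (rule LIM_zero_cancel, rule Lim_null_comparison)
  let ?b = "\<lambda>n. C0 * \<Lambda>0 * norm (f n - x) * norm (g n) + \<Lambda>0 * norm (g n - e)"
  show "\<forall>\<^sub>F n in F. norm (support H \<mu> (f n) (g n) - support H \<mu> x e) \<le> ?b n"
  proof (rule always_eventually, rule allI)
    fix n
    have "support H \<mu> (f n) (g n) \<le> support H \<mu> x e + ?b n"
      using support_lip[of "f n" "g n" x] support_lip_direction[of x "g n" e] by linarith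
    moreover have "support H \<mu> x e \<le> support H \<mu> (f n) (g n) + ?b n"
      using support_lip[of x "g n" "f n"] support_lip_direction[of x e "g n"]
      by (simp add: norm_minus_commute)
    ultimately show "norm (support H \<mu> (f n) (g n) - support H \<mu> x e) \<le> ?b n"
      unfolding real_norm_def abs_le_iff by linarith
  qed
  have "(?b \<longlongrightarrow> C0 * \<Lambda>0 * norm (x - x) * norm e + \<Lambda>0 * norm (e - e)) F"
    by (intro tendsto_intros assms)
  then show "(?b \<longlongrightarrow> 0) F" by simp
qed

sublocale cost: step_cost c \<Lambda>
proof
  fix x y :: 'a
  have 1: "0 \<le> norm (y - x) * min 1 (norm (y - x))" by simp
  have 2: "norm (y - x) * min 1 (norm (y - x)) \<le> norm (y - x)"
    by (rule mult_left_le) auto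
  show "norm (y - x) \<le> c x y"
    unfolding level_cost_def using support_lower[of "y - x" x] mult_nonneg_nonneg[OF C1_bounds(4) 1] by linarith
  show "c x y \<le> \<Lambda> * norm (y - x)"
    unfolding level_cost_def \<Lambda>_def distrib_right
    using support_upper[of x "y - x"] mult_left_mono[OF 2 C1_bounds(4)] by linarith
next
  show "continuous_on UNIV (\<lambda>x. c x y)" for y :: 'a
    unfolding level_cost_def continuous_on_def
    by (intro ballI tendsto_intros support_tendsto)
  show "continuous_on UNIV (\<lambda>y. c x y)" for x :: 'a
    unfolding level_cost_def continuous_on_def
    by (intro ballI tendsto_intros support_tendsto)
qed

lemma superjet_of_admissible:
  assumes u: "cost.admissible u" and q: "q \<in> superjet u x"
  shows "H q x \<le> \<mu>"
proof (rule level_of_support)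
  fix e :: 'a
  let ?K = "C0 * \<Lambda>0 * (norm e)\<^sup>2 + C1 * (norm e)\<^sup>2"
  show "q \<bullet> e \<le> support H \<mu> x e"
  proof (rule superjet_slope_le_backward_rate[OF q, of 1 _ _ ?K])
    fix s :: real assume s: "0 < s"
    have "u x - u (x - s *\<^sub>R e) \<le> c (x - s *\<^sub>R e) x"
      using u unfolding cost.admissible_def by blast
    also have "\<dots> = support H \<mu> (x - s *\<^sub>R e) (s *\<^sub>R e) + C1 * (norm (s *\<^sub>R e) * min 1 (norm (s *\<^sub>R e)))"
      by (simp add: level_cost_def)
    also have "\<dots> \<le> (s * support H \<mu> x e + C0 * \<Lambda>0 * norm (s *\<^sub>R e) * norm (s *\<^sub>R e))
        + C1 * (norm (s *\<^sub>R e) * norm (s *\<^sub>R e))"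
    proof (intro add_mono mult_left_mono C1_bounds)
      have "support H \<mu> (x - s *\<^sub>R e) (s *\<^sub>R e) \<le> support H \<mu> x (s *\<^sub>R e)
          + C0 * \<Lambda>0 * norm ((x - s *\<^sub>R e) - x) * norm (s *\<^sub>R e)" by (rule support_lip)
      moreover have "norm ((x - s *\<^sub>R e) - x) = norm (s *\<^sub>R e)" by simp
      ultimately show "support H \<mu> (x - s *\<^sub>R e) (s *\<^sub>R e)
          \<le> s * support H \<mu> x e + C0 * \<Lambda>0 * norm (s *\<^sub>R e) * norm (s *\<^sub>R e)"
        using support_scale_le[of s x e] s by simp
    qed auto
    also have "\<dots> = s * (support H \<mu> x e + ?K * s)"
      using s by (simp add: power2_eq_square algebra_simps)
    finally show "u x - u (x - s *\<^sub>R e) \<le> s * (support H \<mu> x e + ?K * s)" .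
  qed simp
qed

text \<open>The converse integrates the slope bound along the segment: there the support function differs
  from its value at \<open>z\<close> by at most \<open>C0 \<Lambda>0\<close> times the length. For long steps the bound \<open>\<Lambda>0\<close> for all
  slopes is used instead, which is why the error term in \<open>c\<close> may be taken linear there.\<close>

lemma local_subsolution_step:
  assumes cont: "continuous_on UNIV u"
    and jets: "\<And>y q. y \<in> ball x0 \<rho> \<Longrightarrow> q \<in> superjet u y \<Longrightarrow> H q y \<le> \<mu>"
    and z: "z \<in> ball x0 \<rho>" "z' \<in> ball x0 \<rho>"
  shows "u z' - u z \<le> c z z'"
proof (cases "z = z'")
  case True
  then show ?thesis using cost.c_lower[of z' z] by simp
next
  case False
  define t where "t = norm (z' - z)"
  have t: "t > 0" using False by (simp add: t_def)
  define e where "e = (1 / t) *\<^sub>R (z' - z)"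
  have e: "norm e = 1" "z' = z + t *\<^sub>R e" using t by (auto simp: e_def t_def)
  define r0 where "r0 = \<rho> - max (dist x0 z) (dist x0 z')"
  have r0: "r0 > 0" using z by (auto simp: r0_def)
  have in_ball: "y \<in> ball x0 \<rho>" if "0 \<le> s" "s \<le> t" "dist y (z + s *\<^sub>R e) < r0" for y s
  proof -
    have "z + s *\<^sub>R e = (1 - s / t) *\<^sub>R z + (s / t) *\<^sub>R z'"
      using t by (simp add: e(2) scaleR_add_right scaleR_diff_left)
    moreover have "(1 - s / t) *\<^sub>R z + (s / t) *\<^sub>R z' \<in> cball x0 (max (dist x0 z) (dist x0 z'))"
      using that t by (intro convexD[OF convex_cball]) (auto simp: divide_le_eq)
    ultimately have "dist x0 (z + s *\<^sub>R e) \<le> max (dist x0 z) (dist x0 z')" by simp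
    moreover have "dist x0 y \<le> dist x0 (z + s *\<^sub>R e) + dist y (z + s *\<^sub>R e)"
      using dist_triangle[of x0 y "z + s *\<^sub>R e"] by (simp add: dist_commute)
    ultimately show ?thesis using that(3) unfolding r0_def by simp
  qed
  have coarse: "u z' \<le> u z + t * \<Lambda>0"
    unfolding e(2)
  proof (rule superjet_slope_bounds_increment[OF cont e(1) _ r0])
    fix y q s assume "0 \<le> s" "s \<le> t" "dist y (z + s *\<^sub>R e) < r0" "q \<in> superjet u y"
    then have "H q y \<le> \<mu>" using jets in_ball by blast
    then show "q \<bullet> e \<le> \<Lambda>0" using inner_le_\<Lambda>0[of q y e] e(1) by simp
  qed (use t in simp)
  have fine: "u z' \<le> u z + t * (support H \<mu> z e + C0 * \<Lambda>0 * t)"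
  proof (rule field_le_epsilon)
    fix \<epsilon> :: real assume \<epsilon>: "\<epsilon> > 0"
    define k where "k = t * (C0 * \<Lambda>0) + 1"
    have k: "k > 0" using mult_nonneg_nonneg[OF less_imp_le[OF t] C1_bounds(1)] unfolding k_def by linarith
    define r where "r = min r0 (\<epsilon> / k)"
    have r: "r > 0" "r \<le> r0" "r * k \<le> \<epsilon>" using r0 \<epsilon> k by (auto simp: r_def min_def field_simps)
    have "u (z + t *\<^sub>R e) \<le> u z + t * (support H \<mu> z e + C0 * \<Lambda>0 * (t + r))"
    proof (rule superjet_slope_bounds_increment[OF cont e(1) _ r(1)])
      fix y q s assume *: "0 \<le> s" "s \<le> t" "dist y (z + s *\<^sub>R e) < r" "q \<in> superjet u y"
      then have "H q y \<le> \<mu>" using jets in_ball[of s y] r(2) by (meson less_le_trans)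
      then have "q \<bullet> e \<le> support H \<mu> y e" by (rule support_ge)
      also have "\<dots> \<le> support H \<mu> z e + C0 * \<Lambda>0 * norm (y - z) * norm e" by (rule support_lip)
      also have "\<dots> \<le> support H \<mu> z e + C0 * \<Lambda>0 * (t + r)"
      proof -
        have "norm (y - z) \<le> dist y (z + s *\<^sub>R e) + norm (s *\<^sub>R e)"
          using norm_triangle_ineq[of "y - (z + s *\<^sub>R e)" "s *\<^sub>R e"] by (simp add: dist_norm)
        then have "norm (y - z) \<le> t + r" using * e(1) by simp
        from mult_left_mono[OF this C1_bounds(1)] show ?thesis using e(1) by simp
      qed
      finally show "q \<bullet> e \<le> support H \<mu> z e + C0 * \<Lambda>0 * (t + r)" .
    qed (use t in simp)
    also have "\<dots> = u z + t * (support H \<mu> z e + C0 * \<Lambda>0 * t) + r * (t * (C0 * \<Lambda>0))"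
      by (simp add: algebra_simps)
    also have "r * (t * (C0 * \<Lambda>0)) \<le> \<epsilon>"
      using r(1,3) unfolding k_def by (simp add: distrib_left)
    finally show "u z' \<le> u z + t * (support H \<mu> z e + C0 * \<Lambda>0 * t) + \<epsilon>" by (simp add: e(2))
  qed
  have supp: "t * support H \<mu> z e \<le> support H \<mu> z (z' - z)"
  proof -
    have "support H \<mu> z e \<le> (1 / t) * support H \<mu> z (z' - z)"
      unfolding e_def using t by (intro support_scale_le) simp
    then show ?thesis using t by (simp add: field_simps)
  qed
  have c_eq: "c z z' = support H \<mu> z (z' - z) + C1 * (t * min 1 t)" by (simp add: level_cost_def t_def)
  show ?thesis
  proof (cases "t \<le> 1")
    case True
    have "u z' - u z \<le> t * support H \<mu> z e + C0 * \<Lambda>0 * (t * t)" using fine by (simp add: algebra_simps)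
    also have "\<dots> \<le> support H \<mu> z (z' - z) + C1 * (t * t)"
      using supp C1_bounds(2) by (intro add_mono mult_right_mono) auto
    finally show ?thesis using True by (simp add: c_eq)
  next
    case False
    have "u z' - u z \<le> C1 * t" using coarse mult_left_mono[OF C1_bounds(3) less_imp_le[OF t]]
      unfolding mult.commute[of C1 t] by linarith
    moreover have "0 \<le> support H \<mu> z (z' - z)" using support_lower norm_ge_zero order_trans by blast
    ultimately show ?thesis using False by (simp add: c_eq)
  qed
qed

lemma local_subsolution_le_m:
  assumes "continuous_on UNIV u"
    and "\<And>z q. z \<in> ball x \<rho> \<Longrightarrow> q \<in> superjet u z \<Longrightarrow> H q z \<le> \<mu>"
    and "\<Lambda> * norm (y - x) < \<rho>"
  shows "u y - u x \<le> cost.m x y"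
  by (rule cost.locally_admissible_le_m[OF local_subsolution_step[OF assms(1,2)] assms(3)])

end

section \<open>Ergodic theorems\<close>

lemma sum_lessThan_add: "(\<Sum>k<a + b. f k) = (\<Sum>k<a. f k) + (\<Sum>k<b. f (a + k))" for a b :: nat
  by (induction b) (auto simp: add.assoc)

context ergodic_environment
begin

lemma action_space: "\<omega> \<in> space M \<Longrightarrow> \<tau> y \<omega> \<in> space M"
  using measurable_action[of y] by (rule measurable_space)

lemma action_cancel: "\<omega> \<in> space M \<Longrightarrow> \<tau> (- y) (\<tau> y \<omega>) = \<omega>" "\<omega> \<in> space M \<Longrightarrow> \<tau> y (\<tau> (- y) \<omega>) = \<omega>"
  using action_add[of \<omega> "- y" y] action_add[of \<omega> y "- y"] by (simp_all add: action_zero)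

lemma expectation_action:
  fixes f :: "'w \<Rightarrow> real"
  assumes "f \<in> borel_measurable M"
  shows "expectation (\<lambda>\<omega>. f (\<tau> y \<omega>)) = expectation f"
  using integral_distr[OF measurable_action[of y], of f] assms by (simp add: measure_preserving)

lemma measurable_compose_action:
  "f \<in> measurable M N \<Longrightarrow> (\<lambda>\<omega>. f (\<tau> y \<omega>)) \<in> measurable M N"
  by (rule measurable_compose[OF measurable_action])

lemma prob_invariant:
  assumes E: "{\<omega> \<in> space M. P \<omega>} \<in> sets M"
    and inv: "\<And>y \<omega>. \<omega> \<in> space M \<Longrightarrow> P \<omega> \<Longrightarrow> P (\<tau> y \<omega>)"
  shows "prob {\<omega> \<in> space M. P \<omega>} \<in> {0, 1}"
proof (rule ergodic[OF E])
  fix y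
  show "\<tau> y ` {\<omega> \<in> space M. P \<omega>} = {\<omega> \<in> space M. P \<omega>}"
  proof (intro equalityI subsetI)
    fix \<omega> assume "\<omega> \<in> {\<omega> \<in> space M. P \<omega>}"
    then have "\<omega> = \<tau> y (\<tau> (- y) \<omega>)" "\<tau> (- y) \<omega> \<in> {\<omega> \<in> space M. P \<omega>}"
      using inv[of \<omega> "- y"] action_space[of \<omega> "- y"] by (auto simp: action_cancel)
    then show "\<omega> \<in> \<tau> y ` {\<omega> \<in> space M. P \<omega>}" by (rule image_eqI)
  qed (use inv action_space in auto)
qed

text \<open>All sublevel sets have probability 0 or 1; the constant is where the probability jumps.\<close>

lemma AE_const_of_invariant:
  fixes f :: "'w \<Rightarrow> ereal"
  assumes f[measurable]: "f \<in> borel_measurable M"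
    and inv: "\<And>y \<omega>. \<omega> \<in> space M \<Longrightarrow> f (\<tau> y \<omega>) = f \<omega>"
  shows "\<exists>c. AE \<omega> in M. f \<omega> = c"
proof -
  define c where "c = (INF r\<in>{r::rat. prob {\<omega> \<in> space M. f \<omega> \<le> ereal (of_rat r)} = 1}. ereal (of_rat r))"
  have zero_one: "prob {\<omega> \<in> space M. f \<omega> \<le> ereal (of_rat r)} \<in> {0, 1}" for r
    by (rule prob_invariant) (use inv in auto)
  have "AE \<omega> in M. \<forall>r::rat. prob {\<omega> \<in> space M. f \<omega> \<le> ereal (of_rat r)} = 1 \<longrightarrow> f \<omega> \<le> ereal (of_rat r)"
    unfolding AE_all_countable using prob_Collect_eq_1 by (intro allI AE_impI) auto
  moreover have "AE \<omega> in M. \<forall>r::rat. prob {\<omega> \<in> space M. f \<omega> \<le> ereal (of_rat r)} = 0 \<longrightarrow> \<not> f \<omega> \<le> ereal (of_rat r)"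
    unfolding AE_all_countable using prob_Collect_eq_0 by (intro allI AE_impI) auto
  ultimately have "AE \<omega> in M. f \<omega> = c"
  proof eventually_elim
    case (elim \<omega>)
    have "f \<omega> \<le> c" unfolding c_def using elim(1) by (intro INF_greatest) auto
    moreover have "\<not> f \<omega> < c"
    proof
      assume "f \<omega> < c"
      then obtain r where r: "f \<omega> < ereal (of_rat r)" "ereal (of_rat r) < c"
        using ereal_dense3 by blast
      then have "prob {\<omega> \<in> space M. f \<omega> \<le> ereal (of_rat r)} \<noteq> 1"
        unfolding c_def using INF_lower[of r _ "\<lambda>r. ereal (of_rat r)"] by (auto simp: not_less[symmetric] simp del: not_less)
      then have "\<not> f \<omega> \<le> ereal (of_rat r)" using zero_one[of r] elim(2) by auto
      then show False using r(1) by simp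
    qed
    ultimately show ?case by (simp add: not_less antisym)
  qed
  then show ?thesis by blast
qed

text \<open>
  A superadditive maximal inequality. Walk along the orbit of \<open>\<omega>\<close> in steps of \<open>q\<close>: from a point where
  \<open>Z n \<ge> \<theta> n\<close> for some \<open>n \<le> N\<close> jump \<open>n\<close> steps and collect \<open>\<theta> n\<close>, from any other point advance by one
  step. By superadditivity and positivity, \<open>Z n\<close> is at least what is collected, which is at least
  \<open>\<theta>\<close> times the number of visits to points of the first kind.
\<close>

lemma superadditive_collects:
  fixes Z :: "nat \<Rightarrow> 'w \<Rightarrow> real"
  assumes Z0: "\<And>n \<omega>. \<omega> \<in> space M \<Longrightarrow> 0 \<le> Z n \<omega>"
    and super: "\<And>n k \<omega>. \<omega> \<in> space M \<Longrightarrow> Z n \<omega> + Z k (\<tau> (real n *\<^sub>R q) \<omega>) \<le> Z (n + k) \<omega>"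
    and \<theta>: "\<theta> \<ge> 0" and E: "E = {\<omega> \<in> space M. \<exists>n\<in>{1..N}. \<theta> * real n \<le> Z n \<omega>}"
    and \<omega>: "\<omega> \<in> space M"
  shows "\<theta> * (\<Sum>k<n - N. indicator E (\<tau> (real k *\<^sub>R q) \<omega>)) \<le> Z n \<omega>"
  using \<omega>
proof (induction n arbitrary: \<omega> rule: less_induct)
  case (less n)
  let ?S = "\<lambda>a \<omega>. (\<Sum>k<a. indicator E (\<tau> (real k *\<^sub>R q) \<omega>)) :: real"
  have S_mono: "?S a \<omega> \<le> ?S b \<omega>" if "a \<le> b" for a b \<omega>
    using that by (intro sum_mono2) auto
  show ?case
  proof (cases "n \<le> N")
    case True
    then show ?thesis using Z0 less.prems by simp
  next
    case False
    obtain j where j: "1 \<le> j" "j \<le> n" "\<theta> * ?S j \<omega> \<le> Z j \<omega>"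
    proof (cases "\<omega> \<in> E")
      case True
      then obtain j where j: "j \<in> {1..N}" "\<theta> * real j \<le> Z j \<omega>" using E by auto
      have "?S j \<omega> \<le> (\<Sum>k<j. 1)" by (intro sum_mono) (simp add: indicator_def)
      then have "\<theta> * ?S j \<omega> \<le> \<theta> * real j" using \<theta> by (intro mult_left_mono) auto
      then show ?thesis using that[of j] j False by auto
    next
      case notE: False
      then have "?S 1 \<omega> = 0" using less.prems by (simp add: action_zero)
      then show ?thesis using that[of 1] Z0[OF less.prems] False by auto
    qed
    let ?\<omega>' = "\<tau> (real j *\<^sub>R q) \<omega>"
    have IH: "\<theta> * ?S (n - j - N) ?\<omega>' \<le> Z (n - j) ?\<omega>'"
      using less.IH[of "n - j" ?\<omega>'] j action_space[OF less.prems] by simp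
    have "?S (n - N) \<omega> \<le> ?S (j + (n - j - N)) \<omega>" by (rule S_mono) auto
    also have "\<dots> = ?S j \<omega> + (\<Sum>k<n - j - N. indicator E (\<tau> (real (j + k) *\<^sub>R q) \<omega>))"
      by (rule sum_lessThan_add)
    also have "(\<Sum>k<n - j - N. indicator E (\<tau> (real (j + k) *\<^sub>R q) \<omega>)) = ?S (n - j - N) ?\<omega>'"
      using less.prems
      by (intro sum.cong refl) (simp add: action_add[symmetric] scaleR_add_left[symmetric] add.commute)
    finally have "\<theta> * ?S (n - N) \<omega> \<le> \<theta> * (?S j \<omega> + ?S (n - j - N) ?\<omega>')"
      using \<theta> by (rule mult_left_mono)
    also have "\<dots> = \<theta> * ?S j \<omega> + \<theta> * ?S (n - j - N) ?\<omega>'" by (rule distrib_left)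
    also have "\<dots> \<le> Z j \<omega> + Z (n - j) ?\<omega>'" using IH j(3) by (rule add_mono[rotated])
    also have "\<dots> \<le> Z (j + (n - j)) \<omega>" by (rule super[OF less.prems])
    finally show ?thesis using j(2) by simp
  qed
qed

lemma superadditive_maximal:
  fixes Z :: "nat \<Rightarrow> 'w \<Rightarrow> real"
  assumes meas[measurable]: "\<And>n. Z n \<in> borel_measurable M"
    and Z0: "\<And>n \<omega>. \<omega> \<in> space M \<Longrightarrow> 0 \<le> Z n \<omega>" and bdd: "\<And>n \<omega>. \<omega> \<in> space M \<Longrightarrow> Z n \<omega> \<le> K * real n"
    and super: "\<And>n k \<omega>. \<omega> \<in> space M \<Longrightarrow> Z n \<omega> + Z k (\<tau> (real n *\<^sub>R q) \<omega>) \<le> Z (n + k) \<omega>"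
    and mean: "\<And>n. expectation (Z n) \<le> g * real n"
    and \<theta>: "\<theta> \<ge> 0"
  shows "\<theta> * prob {\<omega> \<in> space M. \<exists>n\<ge>1. \<theta> * real n \<le> Z n \<omega>} \<le> g"
proof -
  define E where "E = (\<lambda>N. {\<omega> \<in> space M. \<exists>n\<in>{1..N}. \<theta> * real n \<le> Z n \<omega>})"
  have E_eq: "E N = {\<omega> \<in> space M. \<exists>n\<in>{1..N}. \<theta> * real n \<le> Z n \<omega>}" for N by (simp add: E_def)
  have E_sets[measurable]: "E N \<in> sets M" for N unfolding E_def by measurable
  have int: "integrable M (Z n)" for n
    using Z0 bdd by (intro integrable_const_bound[where B = "K * real n"]) auto
  have step: "\<theta> * prob (E N) \<le> g" for N
  proof -
    have le: "\<theta> * (real n * prob (E N)) \<le> g * real (n + N)" for n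
    proof -
      have ind: "integrable M (\<lambda>\<omega>. indicator (E N) (\<tau> (real k *\<^sub>R q) \<omega>) :: real)" for k
        by (intro integrable_const_bound[where B = 1]) (auto simp: indicator_def intro!: measurable_compose_action)
      have ex: "expectation (\<lambda>\<omega>. indicator (E N) (\<tau> (real k *\<^sub>R q) \<omega>)) = prob (E N)" for k
        using expectation_action[of "indicator (E N)" "real k *\<^sub>R q"] by simp
      have "expectation (\<lambda>\<omega>. \<theta> * (\<Sum>k<n + N - N. indicator (E N) (\<tau> (real k *\<^sub>R q) \<omega>))) \<le> expectation (Z (n + N))"
      proof (rule integral_mono)
        show "\<theta> * (\<Sum>k<n + N - N. indicator (E N) (\<tau> (real k *\<^sub>R q) \<omega>)) \<le> Z (n + N) \<omega>"
          if "\<omega> \<in> space M" for \<omega>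
          by (rule superadditive_collects[where Z = Z and q = q, OF Z0 super \<theta> E_eq that])
      qed (use int ind in auto)
      also have "expectation (\<lambda>\<omega>. \<theta> * (\<Sum>k<n + N - N. indicator (E N) (\<tau> (real k *\<^sub>R q) \<omega>)))
          = \<theta> * (\<Sum>k<n. prob (E N))"
        using ind by (simp add: ex)
      finally show ?thesis using mean[of "n + N"] by simp
    qed
    have bnd: "\<theta> * prob (E N) \<le> g + g * real N * (1 / real (Suc n))" for n
    proof -
      define x where "x = real (Suc n)"
      have x: "x > 0" by (simp add: x_def)
      have "\<theta> * prob (E N) * x \<le> g * (x + real N)"
        using le[of "Suc n", unfolded of_nat_add, folded x_def] by (simp only: mult_ac)
      then have "\<theta> * prob (E N) \<le> g * (x + real N) / x" using x by (simp add: pos_le_divide_eq)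
      also have "\<dots> = g + g * real N * (1 / x)" using x by (simp add: field_simps)
      finally show ?thesis by (simp only: x_def)
    qed
    have "(\<lambda>n. g + g * real N * (1 / real (Suc n))) \<longlonglongrightarrow> g + g * real N * 0"
      by (intro tendsto_intros LIMSEQ_Suc[OF lim_1_over_n])
    then have "(\<lambda>n. g + g * real N * (1 / real (Suc n))) \<longlonglongrightarrow> g" by simp
    then show ?thesis by (rule tendsto_lowerbound) (use bnd in \<open>auto intro!: always_eventually\<close>)
  qed
  have "incseq E" unfolding E_def incseq_def by fastforce
  moreover have "(\<Union>N. E N) = {\<omega> \<in> space M. \<exists>n\<ge>1. \<theta> * real n \<le> Z n \<omega>}"
    unfolding E_def by fastforce
  ultimately have "(\<lambda>N. prob (E N)) \<longlonglongrightarrow> prob {\<omega> \<in> space M. \<exists>n\<ge>1. \<theta> * real n \<le> Z n \<omega>}"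
    using finite_Lim_measure_incseq[of E] by (metis E_sets image_subsetI)
  then have "(\<lambda>N. \<theta> * prob (E N)) \<longlonglongrightarrow> \<theta> * prob {\<omega> \<in> space M. \<exists>n\<ge>1. \<theta> * real n \<le> Z n \<omega>}"
    by (rule tendsto_mult_left)
  then show ?thesis by (rule tendsto_upperbound) (use step in auto)
qed

text \<open>
  The averages of a subadditive process converge almost surely to a constant. Ergodicity makes the
  lower and the upper limit constant. The maximal inequality for \<open>\<Lambda> n - X n\<close>, which is superadditive,
  bounds the lower limit from below by \<open>\<gamma> = inf E X n / n\<close>. For the upper limit it is applied to the
  Birkhoff sums of \<open>X N / N\<close>, which dominate \<open>X n\<close> up to a constant: telescoping
  \<open>X (k + N) - X k \<le> X N (\<tau> (k q) \<omega>)\<close> over \<open>k < n\<close> leaves \<open>N\<close> terms close to \<open>X n\<close>.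
\<close>

lemma subadditive_AE_limit:
  fixes X :: "nat \<Rightarrow> 'w \<Rightarrow> real"
  assumes meas[measurable]: "\<And>n. X n \<in> borel_measurable M"
    and X0: "\<And>n \<omega>. \<omega> \<in> space M \<Longrightarrow> 0 \<le> X n \<omega>" and X_le: "\<And>n \<omega>. \<omega> \<in> space M \<Longrightarrow> X n \<omega> \<le> \<Lambda> * real n"
    and sub: "\<And>n k \<omega>. \<omega> \<in> space M \<Longrightarrow> X (n + k) \<omega> \<le> X n \<omega> + X k (\<tau> (real n *\<^sub>R q) \<omega>)"
    and step: "\<And>n k \<omega>. \<omega> \<in> space M \<Longrightarrow> X n \<omega> \<le> X (n + k) \<omega> + \<Lambda> * real k"
    and shift: "\<And>n y z \<omega>. \<omega> \<in> space M \<Longrightarrow> \<bar>X n (\<tau> y \<omega>) - X n (\<tau> z \<omega>)\<bar> \<le> C * norm (y - z)"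
  shows "\<exists>\<gamma>. AE \<omega> in M. (\<lambda>n. X n \<omega> / real n) \<longlonglongrightarrow> \<gamma>"
proof -
  have \<Lambda>: "\<Lambda> \<ge> 0"
  proof -
    obtain \<omega> where "\<omega> \<in> space M" using not_empty by blast
    then show ?thesis using X0[of \<omega> 1] X_le[of \<omega> 1] by simp
  qed
  have int: "integrable M (X n)" for n
    using X0 X_le by (intro integrable_const_bound[where B = "\<Lambda> * real n"]) auto
  define e where "e = (\<lambda>n. expectation (X n) / real n)"
  define \<gamma> where "\<gamma> = (INF n\<in>{1..}. e n)"
  have e0: "0 \<le> e n" for n
    unfolding e_def using X0 by (intro divide_nonneg_nonneg Bochner_Integration.integral_nonneg_AE) auto
  have bdd: "bdd_below (e ` {1..})" using e0 by (auto intro!: bdd_belowI)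
  have \<gamma>_le: "\<gamma> * real n \<le> expectation (X n)" for n
  proof (cases "n = 0")
    case False
    then have "\<gamma> \<le> e n" unfolding \<gamma>_def using bdd by (intro cINF_lower) auto
    then show ?thesis using False by (simp add: e_def field_simps)
  qed (use X0 in \<open>auto intro!: Bochner_Integration.integral_nonneg_AE\<close>)
  have \<gamma>_\<Lambda>: "\<gamma> \<le> \<Lambda>"
  proof -
    have "expectation (X 1) \<le> expectation (\<lambda>_. \<Lambda>)"
      using X_le[of _ 1] by (intro integral_mono int) auto
    then show ?thesis using \<gamma>_le[of 1] by (simp add: prob_space)
  qed
  have shift_lim: "(\<lambda>n. ereal (X n (\<tau> y \<omega>) / real n) - ereal (X n \<omega> / real n)) \<longlonglongrightarrow> 0" if "\<omega> \<in> space M" for y \<omega>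
  proof -
    have "(\<lambda>n. X n (\<tau> y \<omega>) / real n - X n \<omega> / real n) \<longlonglongrightarrow> 0"
    proof (rule Lim_null_comparison)
      show "\<forall>\<^sub>F n in sequentially. norm (X n (\<tau> y \<omega>) / real n - X n \<omega> / real n) \<le> C * norm y * (1 / real n)"
      proof (rule always_eventually, rule allI)
        fix n
        have "\<bar>X n (\<tau> y \<omega>) - X n \<omega>\<bar> \<le> C * norm y"
          using shift[OF that, of n y 0] that by (simp add: action_zero)
        then show "norm (X n (\<tau> y \<omega>) / real n - X n \<omega> / real n) \<le> C * norm y * (1 / real n)"
          unfolding diff_divide_distrib[symmetric] by (simp add: divide_right_mono)
      qed
      show "(\<lambda>n. C * norm y * (1 / real n)) \<longlonglongrightarrow> 0"
        using tendsto_mult_left[OF lim_1_over_n, of "C * norm y"] by simp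
    qed
    then show ?thesis by (simp add: zero_ereal_def)
  qed
  have lim_shift: "liminf (\<lambda>n. ereal (X n (\<tau> y \<omega>) / real n)) = liminf (\<lambda>n. ereal (X n \<omega> / real n))"
    "limsup (\<lambda>n. ereal (X n (\<tau> y \<omega>) / real n)) = limsup (\<lambda>n. ereal (X n \<omega> / real n))"
    if "\<omega> \<in> space M" for y \<omega>
  proof -
    have eq: "(\<lambda>n. (ereal (X n (\<tau> y \<omega>) / real n) - ereal (X n \<omega> / real n)) + ereal (X n \<omega> / real n))
        = (\<lambda>n. ereal (X n (\<tau> y \<omega>) / real n))" by simp
    show "liminf (\<lambda>n. ereal (X n (\<tau> y \<omega>) / real n)) = liminf (\<lambda>n. ereal (X n \<omega> / real n))"
      using ereal_liminf_lim_add[OF shift_lim[OF that, of y], of "\<lambda>n. ereal (X n \<omega> / real n)"] unfolding eq by simp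
    show "limsup (\<lambda>n. ereal (X n (\<tau> y \<omega>) / real n)) = limsup (\<lambda>n. ereal (X n \<omega> / real n))"
      using ereal_limsup_lim_add[OF shift_lim[OF that, of y], of "\<lambda>n. ereal (X n \<omega> / real n)"] unfolding eq by simp
  qed
  obtain a where a: "AE \<omega> in M. liminf (\<lambda>n. ereal (X n \<omega> / real n)) = a"
    using AE_const_of_invariant[of "\<lambda>\<omega>. liminf (\<lambda>n. ereal (X n \<omega> / real n))"] lim_shift(1) by auto
  obtain b where b: "AE \<omega> in M. limsup (\<lambda>n. ereal (X n \<omega> / real n)) = b"
    using AE_const_of_invariant[of "\<lambda>\<omega>. limsup (\<lambda>n. ereal (X n \<omega> / real n))"] lim_shift(2) by auto
  have a_ge: "ereal \<gamma> \<le> a"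
  proof (rule ccontr)
    assume "\<not> ereal \<gamma> \<le> a"
    then have "a < ereal \<gamma>" by simp
    then obtain c where c: "a < ereal c" "ereal c < ereal \<gamma>" using ereal_dense2 by blast
    have AE1: "AE \<omega> in M. \<exists>n\<ge>1. (\<Lambda> - c) * real n \<le> \<Lambda> * real n - X n \<omega>"
      using a
    proof eventually_elim
      case (elim \<omega>)
      have "\<exists>n\<ge>1. X n \<omega> / real n < c"
      proof (rule ccontr)
        assume "\<not> ?thesis"
        then have "\<forall>n\<ge>1. ereal c \<le> ereal (X n \<omega> / real n)" by (auto simp: not_less)
        then have "ereal c \<le> liminf (\<lambda>n. ereal (X n \<omega> / real n))"
          by (intro Liminf_bounded) (auto simp: eventually_sequentially)
        then show False using elim c by simp
      qed
      then obtain n where "n \<ge> 1" "X n \<omega> / real n < c" by blast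
      then show ?case by (intro exI[of _ n]) (simp add: field_simps)
    qed
    have "(\<Lambda> - c) * prob {\<omega> \<in> space M. \<exists>n\<ge>1. (\<Lambda> - c) * real n \<le> \<Lambda> * real n - X n \<omega>} \<le> \<Lambda> - \<gamma>"
    proof (rule superadditive_maximal[where K = \<Lambda> and q = q])
      show "\<Lambda> * real n - X n \<omega> + (\<Lambda> * real k - X k (\<tau> (real n *\<^sub>R q) \<omega>)) \<le> \<Lambda> * real (n + k) - X (n + k) \<omega>"
        if "\<omega> \<in> space M" for n k \<omega> using sub[OF that, of n k] by (simp add: algebra_simps)
      show "expectation (\<lambda>\<omega>. \<Lambda> * real n - X n \<omega>) \<le> (\<Lambda> - \<gamma>) * real n" for n
        using \<gamma>_le[of n] int[of n] by (simp add: prob_space algebra_simps)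
      show "0 \<le> \<Lambda> - c" using c(2) \<gamma>_\<Lambda> by simp
    qed (use X0 X_le in auto)
    moreover have "prob {\<omega> \<in> space M. \<exists>n\<ge>1. (\<Lambda> - c) * real n \<le> \<Lambda> * real n - X n \<omega>} = 1"
      using AE1 by (intro prob_Collect_eq_1[THEN iffD2]) auto
    ultimately show False using c(2) by simp
  qed
  have b_le: "b \<le> ereal \<gamma>"
  proof (rule ccontr)
    assume "\<not> b \<le> ereal \<gamma>"
    then have "ereal \<gamma> < b" by simp
    then obtain c where c: "ereal \<gamma> < ereal c" "ereal c < b" using ereal_dense2 by blast
    then have "\<gamma> < c" by simp
    then obtain N where N: "N \<ge> 1" "e N < c"
      unfolding \<gamma>_def using cINF_less_iff[OF _ bdd] by auto
    define d where "d = (e N + c) / 2"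
    have d: "e N < d" "d < c" using N by (auto simp: d_def)
    define Z where "Z = (\<lambda>n \<omega>. (\<Sum>k<n. X N (\<tau> (real k *\<^sub>R q) \<omega>)) / real N)"
    define K where "K = 2 * \<Lambda> * real N"
    have dominates: "X n \<omega> \<le> Z n \<omega> + K" if \<omega>: "\<omega> \<in> space M" for n \<omega>
    proof -
      have "(\<Sum>k<n. X (k + N) \<omega>) - (\<Sum>k<n. X k \<omega>) \<le> (\<Sum>k<n. X N (\<tau> (real k *\<^sub>R q) \<omega>))"
        unfolding sum_subtractf[symmetric]
      proof (rule sum_mono)
        show "X (k + N) \<omega> - X k \<omega> \<le> X N (\<tau> (real k *\<^sub>R q) \<omega>)" for k
          using sub[OF \<omega>, of k N] by linarith
      qed
      moreover have "(\<Sum>k<n. X (k + N) \<omega>) - (\<Sum>k<n. X k \<omega>) = (\<Sum>i<N. X (n + i) \<omega>) - (\<Sum>i<N. X i \<omega>)"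
        using sum_lessThan_add[of "\<lambda>k. X k \<omega>" n N] sum_lessThan_add[of "\<lambda>k. X k \<omega>" N n]
        by (simp add: add.commute)
      moreover have "(\<Sum>i<N. X (n + i) \<omega>) \<ge> (\<Sum>i<N. X n \<omega> - \<Lambda> * real N)"
      proof (rule sum_mono)
        fix i assume "i \<in> {..<N}"
        then have "\<Lambda> * real i \<le> \<Lambda> * real N" using \<Lambda> by (intro mult_left_mono) auto
        then show "X n \<omega> - \<Lambda> * real N \<le> X (n + i) \<omega>" using step[OF \<omega>, of n i] by linarith
      qed
      moreover have "(\<Sum>i<N. X i \<omega>) \<le> (\<Sum>i<N. \<Lambda> * real N)"
      proof (rule sum_mono)
        fix i assume "i \<in> {..<N}"
        then have "\<Lambda> * real i \<le> \<Lambda> * real N" using \<Lambda> by (intro mult_left_mono) auto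
        then show "X i \<omega> \<le> \<Lambda> * real N" using X_le[OF \<omega>, of i] by linarith
      qed
      ultimately have "real N * (X n \<omega> - \<Lambda> * real N) - real N * (\<Lambda> * real N)
          \<le> (\<Sum>k<n. X N (\<tau> (real k *\<^sub>R q) \<omega>))" by simp
      then have "real N * (X n \<omega> - K) \<le> (\<Sum>k<n. X N (\<tau> (real k *\<^sub>R q) \<omega>))"
        by (simp add: K_def algebra_simps)
      then have "X n \<omega> - K \<le> Z n \<omega>" using N(1) by (simp add: Z_def field_simps)
      then show ?thesis by simp
    qed
    have AE1: "AE \<omega> in M. \<exists>n\<ge>1. d * real n \<le> Z n \<omega>"
      using b AE_space
    proof eventually_elim
      case (elim \<omega>)
      have K_lim: "(\<lambda>n. K * (1 / real n)) \<longlonglongrightarrow> K * 0" by (intro tendsto_mult_left lim_1_over_n)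
      have "\<forall>\<^sub>F n in sequentially. K * (1 / real n) < c - d"
        by (rule order_tendstoD(2)[OF K_lim]) (use d in simp)
      moreover have "\<exists>\<^sub>F n in sequentially. c < X n \<omega> / real n"
      proof (rule ccontr)
        assume "\<not> ?thesis"
        then have "\<forall>\<^sub>F n in sequentially. ereal (X n \<omega> / real n) \<le> ereal c"
          by (simp add: not_frequently not_less)
        then have "limsup (\<lambda>n. ereal (X n \<omega> / real n)) \<le> ereal c" by (rule Limsup_bounded)
        then show False using elim c by simp
      qed
      ultimately have "\<exists>\<^sub>F n in sequentially. c < X n \<omega> / real n \<and> (K * (1 / real n) < c - d \<and> n \<ge> 1)"
        by (intro frequently_eventually_frequently eventually_conj eventually_ge_at_top)
      then obtain n where n: "c < X n \<omega> / real n" "K * (1 / real n) < c - d" "n \<ge> 1"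
        using frequently_ex by blast
      then have "c * real n < X n \<omega>" "K < (c - d) * real n" by (auto simp: field_simps)
      then have "d * real n \<le> Z n \<omega>" using dominates[OF elim(2), of n] by (simp add: algebra_simps)
      then show ?case using n(3) by blast
    qed
    have X_action[measurable]: "(\<lambda>\<omega>. X N (\<tau> y \<omega>)) \<in> borel_measurable M" for y
      by (rule measurable_compose_action) (rule meas)
    have Z_meas[measurable]: "Z n \<in> borel_measurable M" for n
      unfolding Z_def by measurable
    have "d * prob {\<omega> \<in> space M. \<exists>n\<ge>1. d * real n \<le> Z n \<omega>} \<le> e N"
    proof (rule superadditive_maximal[where K = \<Lambda> and q = q])
      fix n k :: nat and \<omega> assume \<omega>: "\<omega> \<in> space M"
      show "0 \<le> Z n \<omega>" unfolding Z_def using X0 action_space[OF \<omega>]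
        by (intro divide_nonneg_nonneg sum_nonneg) auto
      have "(\<Sum>k<n. X N (\<tau> (real k *\<^sub>R q) \<omega>)) \<le> (\<Sum>k<n. \<Lambda> * real N)"
        using X_le action_space[OF \<omega>] by (intro sum_mono) auto
      then show "Z n \<omega> \<le> \<Lambda> * real n" using N(1) by (simp add: Z_def field_simps)
      have "(\<Sum>j<n + k. X N (\<tau> (real j *\<^sub>R q) \<omega>)) = (\<Sum>j<n. X N (\<tau> (real j *\<^sub>R q) \<omega>))
          + (\<Sum>j<k. X N (\<tau> (real j *\<^sub>R q) (\<tau> (real n *\<^sub>R q) \<omega>)))"
        unfolding sum_lessThan_add using \<omega>
        by (simp add: action_add[symmetric] scaleR_add_left[symmetric] add.commute)
      then show "Z n \<omega> + Z k (\<tau> (real n *\<^sub>R q) \<omega>) \<le> Z (n + k) \<omega>"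
        by (simp add: Z_def add_divide_distrib)
    next
      fix n
      have i: "integrable M (\<lambda>\<omega>. X N (\<tau> y \<omega>))" for y
        using X0 X_le action_space
        by (intro integrable_const_bound[where B = "\<Lambda> * real N"]) auto
      have "expectation (Z n) = (\<Sum>k<n. expectation (X N)) / real N"
        unfolding Z_def using i by (simp add: expectation_action)
      then show "expectation (Z n) \<le> e N * real n" by (simp add: e_def mult.commute)
    qed (use d e0[of N] in auto)
    moreover have "prob {\<omega> \<in> space M. \<exists>n\<ge>1. d * real n \<le> Z n \<omega>} = 1"
      using AE1 by (intro prob_Collect_eq_1[THEN iffD2]) auto
    ultimately show False using d by simp
  qed
  have "AE \<omega> in M. (\<lambda>n. X n \<omega> / real n) \<longlonglongrightarrow> \<gamma>"
    using a b
  proof eventually_elim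
    case (elim \<omega>)
    have "(\<lambda>n. ereal (X n \<omega> / real n)) \<longlonglongrightarrow> ereal \<gamma>"
    proof (rule Liminf_eq_Limsup)
      have "a \<le> b"
        using Liminf_le_Limsup[OF sequentially_bot, of "\<lambda>n. ereal (X n \<omega> / real n)"] elim by simp
      then show "liminf (\<lambda>n. ereal (X n \<omega> / real n)) = ereal \<gamma>" "limsup (\<lambda>n. ereal (X n \<omega> / real n)) = ereal \<gamma>"
        using elim a_ge b_le by (auto intro: antisym order_trans)
    qed simp
    then show ?case by simp
  qed
  then show ?thesis by blast
qed

text \<open>Off the event \<open>A'\<close> below, the event \<open>A\<close> has small frequency along the half lines in
  directions \<open>e\<close> and \<open>- e\<close>, at all scales, so that every point of the line has a point outside
  \<open>A\<close> at a distance that is small in comparison with its own size.\<close>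

lemma sparse_along_line:
  assumes A[measurable]: "A \<in> sets M" and \<theta>: "0 < \<theta>" "\<theta> \<le> 1 / 2"
  shows "\<exists>A'\<in>sets M. prob A' \<le> (2 / \<theta>) * prob A \<and>
     (\<forall>\<omega>\<in>space M - A'. \<forall>t T. \<bar>t\<bar> \<le> T \<longrightarrow> (\<exists>s. \<bar>s - t\<bar> \<le> 2 * \<theta> * T + 2 \<and> \<tau> (s *\<^sub>R e) \<omega> \<notin> A))"
proof -
  define Z where "Z = (\<lambda>e n \<omega>. (\<Sum>k<n. indicator A (\<tau> (real k *\<^sub>R e) \<omega>)) :: real)"
  define B where "B = (\<lambda>e. {\<omega> \<in> space M. \<exists>n\<ge>1. \<theta> * real n \<le> Z e n \<omega>})"
  have [measurable]: "Z e n \<in> borel_measurable M" for e n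
    unfolding Z_def by (intro borel_measurable_sum measurable_compose_action) auto
  have B_sets[measurable]: "B e \<in> sets M" for e unfolding B_def by measurable
  have B_prob: "prob (B e) \<le> (1 / \<theta>) * prob A" for e
  proof -
    have "\<theta> * prob (B e) \<le> prob A"
      unfolding B_def
    proof (rule superadditive_maximal[where K = 1 and q = e])
      fix n k :: nat and \<omega> assume \<omega>: "\<omega> \<in> space M"
      show "0 \<le> Z e n \<omega>" unfolding Z_def by (intro sum_nonneg) auto
      have "Z e n \<omega> \<le> (\<Sum>k<n. 1)" unfolding Z_def by (intro sum_mono) (simp add: indicator_def)
      then show "Z e n \<omega> \<le> 1 * real n" by simp
      show "Z e n \<omega> + Z e k (\<tau> (real n *\<^sub>R e) \<omega>) \<le> Z e (n + k) \<omega>"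
        unfolding Z_def sum_lessThan_add using \<omega>
        by (simp add: action_add[symmetric] scaleR_add_left[symmetric] add.commute)
    next
      fix n
      have i: "integrable M (\<lambda>\<omega>. indicator A (\<tau> y \<omega>) :: real)" for y
        by (intro integrable_const_bound[where B = 1]) (auto simp: indicator_def intro!: measurable_compose_action)
      have "expectation (\<lambda>\<omega>. indicator A (\<tau> y \<omega>)) = prob A" for y
        using expectation_action[of "indicator A" y] by simp
      then show "expectation (Z e n) \<le> prob A * real n"
        unfolding Z_def using i by simp
    qed (use \<theta> in auto)
    then show ?thesis using \<theta> by (simp add: field_simps)
  qed
  have near: "\<exists>s. \<bar>s - t\<bar> \<le> 2 * \<theta> * T + 2 \<and> \<tau> (s *\<^sub>R e) \<omega> \<notin> A"
    if \<omega>: "\<omega> \<in> space M" "\<omega> \<notin> B e" and t: "0 \<le> t" "t \<le> T" for t T \<omega> e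
  proof -
    define a where "a = nat \<lfloor>t\<rfloor>"
    have a: "real a \<le> t" "t < real a + 1" using t(1) by (auto simp: a_def)
    \<comment> \<open>A run of \<open>l\<close> visits to \<open>A\<close> that starts before \<open>T\<close> makes the frequency of \<open>A\<close> up to its end at
      least \<open>\<theta>\<close>.\<close>
    define l where "l = nat \<lceil>2 * \<theta> * T\<rceil> + 1"
    have tT: "0 \<le> 2 * \<theta> * T" using \<theta> t by simp
    have l: "2 * \<theta> * T \<le> real l" "real l < 2 * \<theta> * T + 2" "l \<ge> 1"
      using tT unfolding l_def by linarith+
    have "\<exists>k\<in>{a..<a + l}. \<tau> (real k *\<^sub>R e) \<omega> \<notin> A"
    proof (rule ccontr)
      assume "\<not> ?thesis"
      then have all: "\<tau> (real (a + k) *\<^sub>R e) \<omega> \<in> A" if "k < l" for k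
        using that by (auto simp del: of_nat_add)
      have "(\<Sum>k<l. 1) \<le> (\<Sum>k<l. indicator A (\<tau> (real (a + k) *\<^sub>R e) \<omega>) :: real)"
        using all by (intro sum_mono) (auto simp del: of_nat_add)
      moreover have "0 \<le> (\<Sum>k<a. indicator A (\<tau> (real k *\<^sub>R e) \<omega>) :: real)" by (intro sum_nonneg) auto
      ultimately have "real l \<le> Z e (a + l) \<omega>" unfolding Z_def sum_lessThan_add by simp
      moreover have "\<theta> * real (a + l) \<le> real l"
      proof -
        have "\<theta> * real a \<le> \<theta> * T" using a t \<theta> by (intro mult_left_mono) auto
        moreover have "\<theta> * real l \<le> (1 / 2) * real l" using \<theta> by (intro mult_right_mono) auto
        ultimately show ?thesis using l(1) by (simp add: distrib_left)
      qed
      ultimately have "\<omega> \<in> B e" unfolding B_def using \<omega> l(3) by (auto intro!: exI[of _ "a + l"])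
      then show False using \<omega> by blast
    qed
    then obtain k where k: "a \<le> k" "k < a + l" "\<tau> (real k *\<^sub>R e) \<omega> \<notin> A" by auto
    have "real k \<le> real a + real l - 1" using k(2) by linarith
    then have "\<bar>real k - t\<bar> \<le> 2 * \<theta> * T + 2" using k(1) a l tT by linarith
    then show ?thesis using k(3) by blast
  qed
  show ?thesis
  proof (rule bexI[of _ "B e \<union> B (- e)"], intro conjI ballI allI impI)
    have "prob (B e \<union> B (- e)) \<le> prob (B e) + prob (B (- e))" by (rule measure_Un_le) auto
    also have "\<dots> \<le> (1 / \<theta>) * prob A + (1 / \<theta>) * prob A" by (intro add_mono B_prob)
    also have "\<dots> = (2 / \<theta>) * prob A" by simp
    finally show "prob (B e \<union> B (- e)) \<le> (2 / \<theta>) * prob A" .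
    fix \<omega> and t T :: real
    assume \<omega>: "\<omega> \<in> space M - (B e \<union> B (- e))" and t: "\<bar>t\<bar> \<le> T"
    show "\<exists>s. \<bar>s - t\<bar> \<le> 2 * \<theta> * T + 2 \<and> \<tau> (s *\<^sub>R e) \<omega> \<notin> A"
    proof (cases "t \<ge> 0")
      case True
      then show ?thesis using near[of \<omega> e t T] \<omega> t by auto
    next
      case False
      then obtain s where "\<bar>s - (- t)\<bar> \<le> 2 * \<theta> * T + 2" "\<tau> (s *\<^sub>R (- e)) \<omega> \<notin> A"
        using near[of \<omega> "- e" "- t" T] \<omega> t by auto
      then show ?thesis by (intro exI[of _ "- s"]) auto
    qed
  qed auto
qed

lemma sparse_in_boxes:
  assumes A: "A \<in> sets M" and \<theta>: "0 < \<theta>" "\<theta> \<le> 1 / 2" and "finite B"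
  shows "\<exists>A'\<in>sets M. prob A' \<le> (2 / \<theta>) ^ card B * prob A \<and>
     (\<forall>\<omega>\<in>space M - A'. \<forall>t T. (\<forall>b\<in>B. \<bar>t b\<bar> \<le> T) \<longrightarrow>
        (\<exists>s. (\<forall>b\<in>B. \<bar>s b - t b\<bar> \<le> 2 * \<theta> * T + 2) \<and> \<tau> (\<Sum>b\<in>B. s b *\<^sub>R b) \<omega> \<notin> A))"
  using \<open>finite B\<close>
proof (induction B rule: finite_induct)
  case empty
  show ?case by (rule bexI[of _ A]) (use A in \<open>auto simp: action_zero\<close>)
next
  case (insert e B)
  then obtain A' where A': "A' \<in> sets M" "prob A' \<le> (2 / \<theta>) ^ card B * prob A"
    "\<And>\<omega> t T. \<omega> \<in> space M - A' \<Longrightarrow> (\<forall>b\<in>B. \<bar>t b\<bar> \<le> T) \<Longrightarrow>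
        (\<exists>s. (\<forall>b\<in>B. \<bar>s b - t b\<bar> \<le> 2 * \<theta> * T + 2) \<and> \<tau> (\<Sum>b\<in>B. s b *\<^sub>R b) \<omega> \<notin> A)"
    by blast
  obtain A'' where A'': "A'' \<in> sets M" "prob A'' \<le> (2 / \<theta>) * prob A'"
    "\<And>\<omega> t T. \<omega> \<in> space M - A'' \<Longrightarrow> \<bar>t\<bar> \<le> T \<Longrightarrow> (\<exists>s. \<bar>s - t\<bar> \<le> 2 * \<theta> * T + 2 \<and> \<tau> (s *\<^sub>R e) \<omega> \<notin> A')"
    using sparse_along_line[OF A'(1) \<theta>, of e] by blast
  show ?case
  proof (rule bexI[of _ A''], intro conjI ballI allI impI)
    have "prob A'' \<le> (2 / \<theta>) * ((2 / \<theta>) ^ card B * prob A)"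
      using A''(2) mult_left_mono[OF A'(2), of "2 / \<theta>"] \<theta> by simp
    then show "prob A'' \<le> (2 / \<theta>) ^ card (insert e B) * prob A" using insert.hyps by simp
    fix \<omega> and t :: "'a \<Rightarrow> real" and T :: real
    assume \<omega>: "\<omega> \<in> space M - A''" and t: "\<forall>b\<in>insert e B. \<bar>t b\<bar> \<le> T"
    obtain r where r: "\<bar>r - t e\<bar> \<le> 2 * \<theta> * T + 2" "\<tau> (r *\<^sub>R e) \<omega> \<notin> A'"
      using A''(3)[OF \<omega>, of "t e" T] t by auto
    obtain s where s: "\<forall>b\<in>B. \<bar>s b - t b\<bar> \<le> 2 * \<theta> * T + 2" "\<tau> (\<Sum>b\<in>B. s b *\<^sub>R b) (\<tau> (r *\<^sub>R e) \<omega>) \<notin> A"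
      using A'(3)[of "\<tau> (r *\<^sub>R e) \<omega>" t T] r t \<omega> action_space by auto
    have "\<tau> (\<Sum>b\<in>B. s b *\<^sub>R b) (\<tau> (r *\<^sub>R e) \<omega>) = \<tau> (\<Sum>b\<in>insert e B. (s(e := r)) b *\<^sub>R b) \<omega>"
    proof -
      have "(\<Sum>b\<in>B. (s(e := r)) b *\<^sub>R b) = (\<Sum>b\<in>B. s b *\<^sub>R b)"
        using insert.hyps by (intro sum.cong) auto
      then show ?thesis using insert.hyps \<omega> by (simp add: action_add[symmetric] add.commute)
    qed
    then show "\<exists>s. (\<forall>b\<in>insert e B. \<bar>s b - t b\<bar> \<le> 2 * \<theta> * T + 2) \<and> \<tau> (\<Sum>b\<in>insert e B. s b *\<^sub>R b) \<omega> \<notin> A"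
      using s r insert.hyps by (intro exI[of _ "s(e := r)"]) auto
  qed (rule A''(1))
qed

text \<open>
  Almost sure convergence at the origin of a stationary process that is Lipschitz in the vertex
  becomes uniform in the vertex on balls of radius proportional to \<open>n\<close>: the event \<open>A\<close> that the
  convergence is late has small probability, every vertex has a vertex outside \<open>A\<close> nearby, and
  the Lipschitz bound transfers the estimate. Postponing what counts as late makes the
  probability of \<open>A\<close> as small as desired without changing how near the good vertices are, hence the
  exceptional set is null.
\<close>

lemma AE_uniform_in_vertex:
  fixes X :: "nat \<Rightarrow> 'w \<Rightarrow> real"
  assumes meas[measurable]: "\<And>n. X n \<in> borel_measurable M"
    and shift: "\<And>n y z \<omega>. \<omega> \<in> space M \<Longrightarrow> \<bar>X n (\<tau> y \<omega>) - X n (\<tau> z \<omega>)\<bar> \<le> C * norm (y - z)"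
    and lim: "AE \<omega> in M. (\<lambda>n. X n \<omega> / real n) \<longlonglongrightarrow> \<gamma>"
  shows "AE \<omega> in M. \<forall>R>0. \<forall>\<eta>>0. \<forall>\<^sub>F n in sequentially. \<forall>x\<in>cball 0 (R * real n).
      \<bar>X n (\<tau> x \<omega>) / real n - \<gamma>\<bar> \<le> \<eta>"
proof -
  have C: "C \<ge> 0"
  proof -
    obtain \<omega> where \<omega>: "\<omega> \<in> space M" using not_empty by blast
    obtain e :: 'a where e: "norm e = 1" using vector_choose_size[of 1] by auto
    show ?thesis using shift[OF \<omega>, of 0 e 0] e abs_ge_zero[of "X 0 (\<tau> e \<omega>) - X 0 (\<tau> 0 \<omega>)"] by simp
  qed
  define good where "good = (\<lambda>R \<eta> \<omega>. \<forall>\<^sub>F n in sequentially. \<forall>x\<in>cball 0 (R * real n).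
      \<bar>X n (\<tau> x \<omega>) / real n - \<gamma>\<bar> \<le> \<eta>)"
  have main: "AE \<omega> in M. good R (3 * \<eta>) \<omega>" if R: "R > 0" and \<eta>: "\<eta> > 0" for R \<eta>
  proof -
    define bad where "bad = (\<lambda>N. {\<omega> \<in> space M. \<exists>n\<ge>N. \<eta> < \<bar>X n \<omega> / real n - \<gamma>\<bar>})"
    have bad_sets: "bad N \<in> sets M" for N unfolding bad_def by measurable
    have "prob (\<Inter>N. bad N) = 0"
    proof -
      have "AE \<omega> in M. \<omega> \<notin> (\<Inter>N. bad N)"
        using lim
      proof eventually_elim
        case (elim \<omega>)
        then have "\<forall>\<^sub>F n in sequentially. dist (X n \<omega> / real n) \<gamma> < \<eta>" using \<eta> by (rule tendstoD)
        then obtain N where "\<forall>n\<ge>N. dist (X n \<omega> / real n) \<gamma> < \<eta>" unfolding eventually_sequentially by blast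
        then have "\<omega> \<notin> bad N" unfolding bad_def dist_real_def by force
        then show ?case by blast
      qed
      moreover have "(\<Inter>N. bad N) \<in> sets M" using bad_sets by (intro sets.countable_INT) auto
      ultimately show ?thesis using prob_eq_0 by blast
    qed
    moreover have "decseq bad" unfolding bad_def decseq_def by (auto intro: order_trans)
    ultimately have bad_lim: "(\<lambda>N. prob (bad N)) \<longlonglongrightarrow> 0"
      using finite_Lim_measure_decseq[of bad] bad_sets by (metis image_subsetI)
    define d where "d = real DIM('a)"
    have d: "d \<ge> 1" using DIM_positive[where 'a = 'a] unfolding d_def by linarith
    define K where "K = C * d"
    have K: "K \<ge> 0" using C d by (simp add: K_def)
    \<comment> \<open>This frequency of bad vertices makes good vertices dense enough at scale \<open>R n\<close> for an error
      \<open>\<eta>\<close> in the Lipschitz bound; it does not depend on \<open>N\<close>.\<close>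
    define \<theta> where "\<theta> = min (1 / 2) (\<eta> / (2 * K * R + 1))"
    have KR: "2 * K * R + 1 > 0" using K R by (simp add: add_nonneg_pos)
    have \<theta>: "0 < \<theta>" "\<theta> \<le> 1 / 2" "\<theta> * (2 * K * R + 1) \<le> \<eta>"
    proof -
      show "0 < \<theta>" using KR \<eta> by (simp add: \<theta>_def)
      show "\<theta> \<le> 1 / 2" unfolding \<theta>_def by (rule min.cobounded1)
      have "\<theta> \<le> \<eta> / (2 * K * R + 1)" by (simp add: \<theta>_def)
      then show "\<theta> * (2 * K * R + 1) \<le> \<eta>" using KR by (simp add: pos_le_divide_eq)
    qed
    define sparse where "sparse = (\<lambda>N A'. \<forall>\<omega>\<in>space M - A'. \<forall>t T. (\<forall>b\<in>(Basis :: 'a set). \<bar>t b\<bar> \<le> T) \<longrightarrow>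
        (\<exists>s. (\<forall>b\<in>Basis. \<bar>s b - t b\<bar> \<le> 2 * \<theta> * T + 2) \<and> \<tau> (\<Sum>b\<in>Basis. s b *\<^sub>R b) \<omega> \<notin> bad N))"
    have "\<forall>N. \<exists>A'. A' \<in> sets M \<and> prob A' \<le> (2 / \<theta>) ^ card (Basis :: 'a set) * prob (bad N) \<and> sparse N A'"
      using sparse_in_boxes[OF bad_sets \<theta>(1,2) finite_Basis] unfolding sparse_def by blast
    from choice[OF this] obtain A where A_all: "\<forall>N. A N \<in> sets M
        \<and> prob (A N) \<le> (2 / \<theta>) ^ card (Basis :: 'a set) * prob (bad N) \<and> sparse N (A N)" ..
    then have A: "\<And>N. A N \<in> sets M" "\<And>N. prob (A N) \<le> (2 / \<theta>) ^ card (Basis :: 'a set) * prob (bad N)"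
        "\<And>N. sparse N (A N)" by auto
    have good: "good R (3 * \<eta>) \<omega>" if \<omega>: "\<omega> \<in> space M" "\<omega> \<notin> A N" for \<omega> N
    proof -
      have "(\<lambda>n. 2 * K * (1 / real n)) \<longlonglongrightarrow> 2 * K * 0" by (intro tendsto_mult_left lim_1_over_n)
      then have "\<forall>\<^sub>F n in sequentially. 2 * K * (1 / real n) < \<eta>"
        by (rule order_tendstoD(2)) (use \<eta> in simp)
      then show ?thesis
        using eventually_ge_at_top[of "max N 1"] unfolding good_def
      proof eventually_elim
        case (elim n)
        show ?case
        proof
          fix x :: 'a assume "x \<in> cball 0 (R * real n)"
          then have x: "norm x \<le> R * real n" by simp
          have n: "real n > 0" "n \<ge> N" using elim(2) by auto
          have "\<forall>b\<in>Basis. \<bar>x \<bullet> b\<bar> \<le> R * real n" using x Basis_le_norm[of _ x] by (auto intro: order_trans)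
          then obtain s where s: "\<forall>b\<in>Basis. \<bar>s b - x \<bullet> b\<bar> \<le> 2 * \<theta> * (R * real n) + 2"
            "\<tau> (\<Sum>b\<in>Basis. s b *\<^sub>R b) \<omega> \<notin> bad N"
            using A(3)[of N, unfolded sparse_def, rule_format, of \<omega> "\<lambda>b. x \<bullet> b" "R * real n"] \<omega> by blast
          define y :: 'a where "y = (\<Sum>b\<in>Basis. s b *\<^sub>R b)"
          have "norm (x - y) = norm (\<Sum>b\<in>Basis. (x \<bullet> b - s b) *\<^sub>R b)"
            unfolding y_def using euclidean_representation[of x]
            by (simp add: scaleR_diff_left sum_subtractf)
          also have "\<dots> \<le> (\<Sum>b\<in>(Basis :: 'a set). 2 * \<theta> * (R * real n) + 2)"
          proof (rule sum_norm_le)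
            fix b :: 'a assume "b \<in> Basis"
            then show "norm ((x \<bullet> b - s b) *\<^sub>R b) \<le> 2 * \<theta> * (R * real n) + 2"
              using s(1) by (simp add: abs_minus_commute)
          qed
          also have "\<dots> = d * (2 * \<theta> * (R * real n) + 2)" by (simp add: d_def)
          finally have xy: "norm (x - y) \<le> d * (2 * \<theta> * (R * real n) + 2)" .
          have "\<bar>X n (\<tau> x \<omega>) - X n (\<tau> y \<omega>)\<bar> \<le> C * norm (x - y)" by (rule shift[OF \<omega>(1)])
          also have "\<dots> \<le> C * (d * (2 * \<theta> * (R * real n) + 2))" using C xy by (rule mult_left_mono[rotated])
          also have "\<dots> = (\<theta> * (2 * K * R) + 2 * K * (1 / real n)) * real n"
            using n(1) by (simp add: K_def field_simps)
          also have "\<dots> \<le> (\<eta> + \<eta>) * real n"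
          proof (rule mult_right_mono[OF add_mono])
            show "\<theta> * (2 * K * R) \<le> \<eta>" using \<theta>(1,3) by (simp add: distrib_left)
          qed (use elim n in auto)
          finally have "\<bar>X n (\<tau> x \<omega>) / real n - X n (\<tau> y \<omega>) / real n\<bar> \<le> 2 * \<eta>"
            using n(1) by (simp add: abs_divide pos_divide_le_eq flip: diff_divide_distrib)
          moreover have "\<bar>X n (\<tau> y \<omega>) / real n - \<gamma>\<bar> \<le> \<eta>"
            using s(2) n(2) action_space[OF \<omega>(1)] unfolding bad_def y_def[symmetric] by force
          ultimately show "\<bar>X n (\<tau> x \<omega>) / real n - \<gamma>\<bar> \<le> 3 * \<eta>" by linarith
        qed
      qed
    qed
    have "prob (\<Inter>N. A N) = 0"
    proof -
      have le: "prob (\<Inter>N. A N) \<le> (2 / \<theta>) ^ card (Basis :: 'a set) * prob (bad N)" for N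
        using finite_measure_mono[of "\<Inter>N. A N" "A N"] A(1) A(2)[of N] by fastforce
      have "(\<lambda>N. (2 / \<theta>) ^ card (Basis :: 'a set) * prob (bad N)) \<longlonglongrightarrow> (2 / \<theta>) ^ card (Basis :: 'a set) * 0"
        by (intro tendsto_mult_left bad_lim)
      then have "prob (\<Inter>N. A N) \<le> (2 / \<theta>) ^ card (Basis :: 'a set) * 0"
        by (rule tendsto_lowerbound) (use le in \<open>auto intro!: always_eventually\<close>)
      then show ?thesis by (simp add: measure_le_0_iff)
    qed
    moreover have "(\<Inter>N. A N) \<in> sets M" using A(1) by (intro sets.countable_INT) auto
    ultimately have "AE \<omega> in M. \<omega> \<notin> (\<Inter>N. A N)" using prob_eq_0 by blast
    with AE_space show ?thesis
    proof eventually_elim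
      case (elim \<omega>)
      then show ?case using good by blast
    qed
  qed
  have "AE \<omega> in M. \<forall>k::nat. \<forall>j::nat. good (real (Suc k)) (3 * (1 / real (Suc j))) \<omega>"
    unfolding AE_all_countable by (intro allI main) auto
  then show ?thesis
  proof eventually_elim
    case (elim \<omega>)
    show ?case
    proof (intro allI impI)
      fix R \<eta> :: real assume R: "R > 0" and \<eta>: "\<eta> > 0"
      obtain k :: nat where k: "R \<le> real k" using real_arch_simple by blast
      obtain j where j: "inverse (real (Suc j)) < \<eta> / 3" using reals_Archimedean[of "\<eta> / 3"] \<eta> by auto
      have "good (real (Suc k)) (3 * (1 / real (Suc j))) \<omega>" using elim by blast
      then show "\<forall>\<^sub>F n in sequentially. \<forall>x\<in>cball 0 (R * real n). \<bar>X n (\<tau> x \<omega>) / real n - \<gamma>\<bar> \<le> \<eta>"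
        unfolding good_def
      proof eventually_elim
        case (elim n)
        show ?case
        proof
          fix x :: 'a assume "x \<in> cball 0 (R * real n)"
          moreover have "R * real n \<le> real (Suc k) * real n" using k by (intro mult_right_mono) auto
          ultimately have "x \<in> cball 0 (real (Suc k) * real n)" by simp
          then have "\<bar>X n (\<tau> x \<omega>) / real n - \<gamma>\<bar> \<le> 3 * (1 / real (Suc j))" using elim by blast
          also have "\<dots> \<le> \<eta>" using j by (simp add: inverse_eq_divide del: of_nat_Suc)
          finally show "\<bar>X n (\<tau> x \<omega>) / real n - \<gamma>\<bar> \<le> \<eta>" .
        qed
      qed
    qed
  qed
qed

end

section \<open>Measurability and the effective Hamiltonian\<close>

text \<open>
  A function that is determined up to \<open>\<epsilon>\<close> by finitely many measurable coordinates, known up to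
  \<open>\<eta>\<close>, is measurable: its superlevel sets are countable unions of cells on which the coordinates
  have prescribed integer parts in units of \<open>\<eta>\<close>.
\<close>

lemma borel_measurable_finitely_determined:
  fixes f :: "'w \<Rightarrow> real" and X :: "'i \<Rightarrow> 'w \<Rightarrow> real"
  assumes X[measurable]: "\<And>i. X i \<in> borel_measurable M"
    and det: "\<And>\<epsilon>. \<epsilon> > 0 \<Longrightarrow> \<exists>F \<eta>. finite F \<and> \<eta> > 0 \<and> (\<forall>\<omega>\<in>space M. \<forall>\<omega>'\<in>space M.
        (\<forall>i\<in>F. \<bar>X i \<omega> - X i \<omega>'\<bar> < \<eta>) \<longrightarrow> f \<omega> \<le> f \<omega>' + \<epsilon>)"
  shows "f \<in> borel_measurable M"
  unfolding borel_measurable_iff_greater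
proof
  fix a :: real
  have "\<forall>k. \<exists>F \<eta>. finite F \<and> \<eta> > 0 \<and> (\<forall>\<omega>\<in>space M. \<forall>\<omega>'\<in>space M.
        (\<forall>i\<in>F. \<bar>X i \<omega> - X i \<omega>'\<bar> < \<eta>) \<longrightarrow> f \<omega> \<le> f \<omega>' + 1 / real (Suc k))"
    using det by simp
  then obtain F \<eta> where F: "\<And>k. finite (F k)" and \<eta>: "\<And>k. \<eta> k > 0"
    and F\<eta>: "\<And>k \<omega> \<omega>'. \<omega> \<in> space M \<Longrightarrow> \<omega>' \<in> space M \<Longrightarrow> (\<And>i. i \<in> F k \<Longrightarrow> \<bar>X i \<omega> - X i \<omega>'\<bar> < \<eta> k) \<Longrightarrow>
      f \<omega> \<le> f \<omega>' + 1 / real (Suc k)"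
    by metis
  define cell where "cell = (\<lambda>k c. {\<omega> \<in> space M. \<forall>i\<in>F k. \<lfloor>X i \<omega> / \<eta> k\<rfloor> = (c i :: int)})"
  define C where "C = (\<lambda>k. {c \<in> PiE (F k) (\<lambda>_. UNIV). \<exists>\<omega>\<in>cell k c. a + 1 / real (Suc k) < f \<omega>})"
  have cell_sets: "cell k c \<in> sets M" for k c
    unfolding cell_def using F by (intro sets.sets_Collect_finite_All) auto
  have same_cell: "f \<omega> \<le> f \<omega>' + 1 / real (Suc k)" if "\<omega> \<in> cell k c" "\<omega>' \<in> cell k c" for k c \<omega> \<omega>'
  proof (rule F\<eta>)
    fix i assume "i \<in> F k"
    then have "\<lfloor>X i \<omega> / \<eta> k\<rfloor> = \<lfloor>X i \<omega>' / \<eta> k\<rfloor>" using that unfolding cell_def by simp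
    then have "\<bar>X i \<omega> / \<eta> k - X i \<omega>' / \<eta> k\<bar> < 1" by linarith
    then show "\<bar>X i \<omega> - X i \<omega>'\<bar> < \<eta> k"
      using \<eta>[of k] by (simp add: abs_divide pos_divide_less_eq flip: diff_divide_distrib)
  qed (use that in \<open>auto simp: cell_def\<close>)
  have "{\<omega> \<in> space M. a < f \<omega>} = (\<Union>k. \<Union>c\<in>C k. cell k c)"
  proof (intro equalityI subsetI)
    fix \<omega> assume "\<omega> \<in> {\<omega> \<in> space M. a < f \<omega>}"
    then have \<omega>: "\<omega> \<in> space M" "a < f \<omega>" by auto
    obtain k where k: "inverse (real (Suc k)) < f \<omega> - a" using reals_Archimedean[of "f \<omega> - a"] \<omega> by auto
    define c where "c = restrict (\<lambda>i. \<lfloor>X i \<omega> / \<eta> k\<rfloor>) (F k)"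
    have "\<omega> \<in> cell k c" using \<omega> by (simp add: cell_def c_def)
    moreover have "c \<in> C k"
      unfolding C_def using \<open>\<omega> \<in> cell k c\<close> k
      by (auto simp: c_def inverse_eq_divide simp del: of_nat_Suc intro!: bexI[of _ \<omega>])
    ultimately show "\<omega> \<in> (\<Union>k. \<Union>c\<in>C k. cell k c)" by blast
  next
    fix \<omega> assume "\<omega> \<in> (\<Union>k. \<Union>c\<in>C k. cell k c)"
    then obtain k c \<omega>' where *: "\<omega> \<in> cell k c" "\<omega>' \<in> cell k c" "a + 1 / real (Suc k) < f \<omega>'"
      unfolding C_def by blast
    then show "\<omega> \<in> {\<omega> \<in> space M. a < f \<omega>}"
      using same_cell[OF *(2,1)] by (auto simp: cell_def)
  qed
  moreover have "countable (C k)" for k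
    unfolding C_def using F by (intro countable_subset[OF _ countable_PiE[of "F k" "\<lambda>_. UNIV :: int set"]]) auto
  ultimately show "{\<omega> \<in> space M. a < f \<omega>} \<in> sets M"
    using cell_sets by (auto intro!: sets.countable_UN'')
qed

lemma Limsup_le_add:
  fixes f g :: "'a \<Rightarrow> real"
  assumes "F \<noteq> bot" "\<forall>\<^sub>F x in F. f x \<le> g x + C"
  shows "Limsup F (\<lambda>x. ereal (f x)) \<le> Limsup F (\<lambda>x. ereal (g x)) + ereal C"
proof -
  have "Limsup F (\<lambda>x. ereal (f x)) \<le> Limsup F (\<lambda>x. ereal (g x) + ereal C)"
    by (rule Limsup_mono) (use assms(2) in simp)
  also have "\<dots> = Limsup F (\<lambda>x. ereal (g x)) + ereal C"
    by (rule Limsup_add_ereal_right) (use assms(1) in auto)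
  finally show ?thesis .
qed

text \<open>For the measurability of the limit superior, uncountably many \<open>\<delta>\<close> have to be reduced to countably many.\<close>

lemma Limsup_at_right_eq_rational:
  fixes g :: "real \<Rightarrow> real"
  assumes cont: "continuous_on {0<..} g"
  shows "Limsup (at_right 0) (\<lambda>\<delta>. ereal (g \<delta>)) =
    (INF n. SUP r\<in>{r::rat. 0 < r \<and> r < 1 / of_nat (Suc n)}. ereal (g (of_rat r)))"
proof -
  define I where "I = (\<lambda>n::nat. {r::rat. 0 < r \<and> r < 1 / of_nat (Suc n)})"
  have le: "Limsup (at_right 0) (\<lambda>\<delta>. ereal (g \<delta>)) \<le> (INF n. SUP r\<in>I n. ereal (g (of_rat r)))"
  proof (rule INF_greatest)
    fix n
    let ?S = "SUP r\<in>I n. ereal (g (of_rat r))"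
    have "ereal (g \<delta>) \<le> ?S" if \<delta>: "0 < \<delta>" "\<delta> < 1 / real (Suc n)" for \<delta>
    proof (rule ccontr)
      assume "\<not> ereal (g \<delta>) \<le> ?S"
      then have "?S < ereal (g \<delta>)" by (simp only: not_le)
      from ereal_dense2[OF this] obtain s where s: "?S < ereal s" "ereal s < ereal (g \<delta>)" by blast
      have "isCont g \<delta>" using cont \<delta> continuous_on_eq_continuous_at[of "{0<..}" g] by auto
      then have "\<forall>\<^sub>F x in at \<delta>. s < g x" using s(2) by (intro order_tendstoD) (auto simp: isCont_def)
      then obtain d where d: "d > 0" "\<And>x. x \<noteq> \<delta> \<Longrightarrow> dist x \<delta> < d \<Longrightarrow> s < g x"
        unfolding eventually_at by blast
      obtain r where r: "max 0 (\<delta> - d) < of_rat r" "of_rat r < \<delta>"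
        using of_rat_dense[of "max 0 (\<delta> - d)" \<delta>] \<delta> d by auto
      have "of_rat r < (of_rat (1 / of_nat (Suc n)) :: real)"
        using r \<delta> by (simp add: of_rat_divide del: of_nat_Suc)
      then have "r \<in> I n" using r unfolding I_def mem_Collect_eq of_rat_less by simp
      then have "ereal (g (of_rat r)) \<le> ?S" by (rule SUP_upper)
      also note s(1)
      finally have "g (of_rat r) < s" by simp
      moreover have "s < g (of_rat r)" using r by (intro d(2)) (auto simp: dist_real_def)
      ultimately show False by linarith
    qed
    moreover have "\<forall>\<^sub>F \<delta> in at_right 0. \<delta> \<in> {0<..<1 / real (Suc n)}" by (intro eventually_at_right_real) simp
    ultimately show "Limsup (at_right 0) (\<lambda>\<delta>. ereal (g \<delta>)) \<le> ?S"
      by (intro Limsup_bounded) (auto elim!: eventually_mono)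
  qed
  have ge: "(INF n. SUP r\<in>I n. ereal (g (of_rat r))) \<le> Limsup (at_right 0) (\<lambda>\<delta>. ereal (g \<delta>))"
    unfolding Limsup_def
  proof (rule INF_greatest)
    fix P assume "P \<in> {P. eventually P (at_right (0::real))}"
    then obtain b where b: "b > 0" "\<And>x. 0 < x \<Longrightarrow> x < b \<Longrightarrow> P x"
      unfolding eventually_at_right_field by auto
    obtain n where n: "inverse (real (Suc n)) < b" using reals_Archimedean[OF b(1)] by auto
    have "(SUP r\<in>I n. ereal (g (of_rat r))) \<le> (SUP x\<in>Collect P. ereal (g x))"
    proof (rule SUP_least)
      fix r assume r: "r \<in> I n"
      then have r': "0 < r" "(of_rat r :: real) < of_rat (1 / of_nat (Suc n))"
        unfolding I_def mem_Collect_eq of_rat_less by blast+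
      then have "(of_rat r :: real) < b" using n by (simp add: of_rat_divide inverse_eq_divide del: of_nat_Suc)
      then have "P (of_rat r)" using r' by (intro b(2)) auto
      then show "ereal (g (of_rat r)) \<le> (SUP x\<in>Collect P. ereal (g x))" by (intro SUP_upper) simp
    qed
    then show "(INF n. SUP r\<in>I n. ereal (g (of_rat r))) \<le> (SUP x\<in>Collect P. ereal (g x))"
      by (rule INF_lower2[OF UNIV_I])
  qed
  show ?thesis using antisym[OF le ge] unfolding I_def .
qed

lemma (in random_hamiltonian) uniform_moduli:
  "\<exists>Bd Lp Cr. \<forall>\<omega>\<in>space M. hamiltonian (\<lambda>q x. H q x \<omega>) Bd Lp Cr"
proof -
  have pos: "\<bar>R\<bar> + 1 > 0" for R :: real by simp
  obtain Bd where Bd: "\<And>R. \<forall>p\<in>ball 0 (\<bar>R\<bar> + 1). \<forall>y. \<forall>\<omega>\<in>space M. \<bar>H p y \<omega>\<bar> \<le> Bd R"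
    using locally_bounded[OF pos] by metis
  obtain Lp where Lp: "\<And>R. Lp R > 0" "\<And>R. \<forall>p1\<in>ball 0 (\<bar>R\<bar> + 1). \<forall>p2\<in>ball 0 (\<bar>R\<bar> + 1). \<forall>y1 y2. \<forall>\<omega>\<in>space M.
         \<bar>H p1 y1 \<omega> - H p2 y2 \<omega>\<bar> \<le> Lp R * (norm (p1 - p2) + norm (y1 - y2))"
    using locally_lipschitz[OF pos] by metis
  have "\<exists>b>0. \<forall>p. b \<le> norm p \<longrightarrow> (\<forall>y. \<forall>\<omega>\<in>space M. a \<le> H p y \<omega>)" for a
  proof -
    have "\<forall>\<^sub>F p in at_infinity. ereal a < (INF (y, \<omega>) \<in> UNIV \<times> space M. ereal (H p y \<omega>))"
      by (rule order_tendstoD(1)[OF coercive]) simp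
    then obtain b where b: "\<And>p. b \<le> norm p \<Longrightarrow> ereal a < (INF (y, \<omega>) \<in> UNIV \<times> space M. ereal (H p y \<omega>))"
      unfolding eventually_at_infinity by blast
    show ?thesis
    proof (intro exI[of _ "max b 1"] conjI allI impI ballI)
      fix p y :: 'a and \<omega> assume p: "max b 1 \<le> norm p" and \<omega>: "\<omega> \<in> space M"
      have "ereal a < (INF (y, \<omega>) \<in> UNIV \<times> space M. ereal (H p y \<omega>))" using p by (intro b) simp
      also have "\<dots> \<le> ereal (H p y \<omega>)"
        using \<omega> INF_lower[of "(y, \<omega>)" "UNIV \<times> space M" "\<lambda>(y, \<omega>). ereal (H p y \<omega>)"] by simp
      finally show "a \<le> H p y \<omega>" by simp
    qed simp
  qed
  then obtain Cr where Cr: "\<And>a. Cr a > 0" "\<And>a p y \<omega>. Cr a \<le> norm p \<Longrightarrow> \<omega> \<in> space M \<Longrightarrow> a \<le> H p y \<omega>"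
    by metis
  have "hamiltonian (\<lambda>q x. H q x \<omega>) Bd Lp Cr" if \<omega>: "\<omega> \<in> space M" for \<omega>
  proof
    fix R :: real and q x :: 'a assume "norm q \<le> R"
    then have "q \<in> ball 0 (\<bar>R\<bar> + 1)" by simp
    then show "\<bar>H q x \<omega>\<bar> \<le> Bd R" using Bd \<omega> by blast
  next
    fix R :: real and q1 q2 x1 x2 :: 'a assume "norm q1 \<le> R" "norm q2 \<le> R"
    then have "q1 \<in> ball 0 (\<bar>R\<bar> + 1)" "q2 \<in> ball 0 (\<bar>R\<bar> + 1)" by simp_all
    then show "\<bar>H q1 x1 \<omega> - H q2 x2 \<omega>\<bar> \<le> Lp R * (norm (q1 - q2) + norm (x1 - x2))" using Lp(2) \<omega> by blast
  qed (use Cr Lp(1) \<omega> in \<open>auto intro: less_imp_le\<close>)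
  then show ?thesis by blast
qed

locale random_hamiltonian_moduli = ergodic_environment M \<tau> + random_hamiltonian M \<tau> H
  for M :: "'w measure" and \<tau> :: "'a::euclidean_space \<Rightarrow> 'w \<Rightarrow> 'w" and H +
  fixes Bd Lp Cr :: "real \<Rightarrow> real"
  assumes ham: "\<And>\<omega>. \<omega> \<in> space M \<Longrightarrow> hamiltonian (\<lambda>q x. H q x \<omega>) Bd Lp Cr"
begin

abbreviation "v \<equiv> v_approx H"

lemma v_solution:
  assumes "\<omega> \<in> space M" "\<delta> > 0"
  shows "approx_solution (\<lambda>q x. H q x \<omega>) p \<delta> (v p \<delta> \<omega>)"
proof -
  interpret h: hamiltonian "\<lambda>q x. H q x \<omega>" Bd Lp Cr by (rule ham[OF assms(1)])
  have "\<exists>!v. approx_solution (\<lambda>q x. H q x \<omega>) p \<delta> v"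
    using h.approx_solution_exists[OF assms(2)] h.approx_solution_unique[OF assms(2)] by blast
  from theI'[OF this] show ?thesis unfolding v_approx_def approx_solution_def .
qed

lemma v_eqI:
  assumes "\<omega> \<in> space M" "\<delta> > 0" "approx_solution (\<lambda>q x. H q x \<omega>) p \<delta> w"
  shows "v p \<delta> \<omega> = w"
  using hamiltonian.approx_solution_unique[OF ham[OF assms(1)] assms(2) v_solution[OF assms(1,2)] assms(3)] .

abbreviation "Lip \<equiv> max_slope Bd Cr"

lemma v_bound: "\<omega> \<in> space M \<Longrightarrow> \<delta> > 0 \<Longrightarrow> norm p \<le> R \<Longrightarrow> \<bar>\<delta> * v p \<delta> \<omega> x\<bar> \<le> Bd R"
  using hamiltonian.approx_solution_bound[OF ham _ _ v_solution] by blast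

lemma v_lipschitz: "\<omega> \<in> space M \<Longrightarrow> \<delta> > 0 \<Longrightarrow> norm p \<le> R \<Longrightarrow> (Lip R)-lipschitz_on UNIV (v p \<delta> \<omega>)"
  using hamiltonian.approx_solution_lipschitz[OF ham _ _ v_solution] by blast

lemma v_stationary:
  assumes "\<omega> \<in> space M" "\<delta> > 0"
  shows "v p \<delta> (\<tau> z \<omega>) x = v p \<delta> \<omega> (x + z)"
proof -
  have "approx_solution (\<lambda>q x. H q (x + z) \<omega>) p \<delta> (\<lambda>x. v p \<delta> \<omega> (x + z))"
    by (rule hamiltonian.approx_solution_translate[OF ham[OF assms(1)] v_solution[OF assms]])
  then have "approx_solution (\<lambda>q x. H q x (\<tau> z \<omega>)) p \<delta> (\<lambda>x. v p \<delta> \<omega> (x + z))"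
    using stationary[OF assms(1)] by simp
  from v_eqI[OF action_space[OF assms(1)] assms(2) this] show ?thesis by simp
qed

text \<open>The coordinates are the values of \<open>H\<close> at the points of a finite net of a ball in slope and
  position; the ball is large enough for the local comparison, and the net fine enough for the
  Lipschitz bound on \<open>H\<close>.\<close>

lemma v_measurable:
  assumes \<delta>: "\<delta> > 0"
  shows "(\<lambda>\<omega>. v p \<delta> \<omega> 0) \<in> borel_measurable M"
proof (rule borel_measurable_finitely_determined[where X = "\<lambda>(q, x). H q x"])
  show "(case i of (q, x) \<Rightarrow> H q x) \<in> borel_measurable M" for i
    using measurable_H by (cases i) simp
  fix \<epsilon> :: real assume \<epsilon>: "\<epsilon> > 0"
  define K where "K = norm p"
  define B where "B = 2 * Bd K / \<delta>"
  have Bd0: "Bd K \<ge> 0"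
  proof -
    obtain \<omega> where "\<omega> \<in> space M" using not_empty by blast
    from hamiltonian.Bd_nonneg[OF ham[OF this], of K] show ?thesis by (simp add: K_def)
  qed
  have B: "B \<ge> 0" using Bd0 \<delta> by (simp add: B_def)
  define P where "P = 2 * Lip K + 1"
  define C where "C = Lp (K + P)"
  have C: "C \<ge> 0"
  proof -
    obtain \<omega> where "\<omega> \<in> space M" using not_empty by blast
    from hamiltonian.Lp_nonneg[OF ham[OF this]] show ?thesis by (simp add: C_def)
  qed
  define D where "D = 2 * (B + 1)"
  define R where "R = D + C * D / (\<epsilon> * \<delta> / 2)"
  have D: "D > 0" using B by (simp add: D_def)
  have R: "R > 0" "D \<le> R" "C * D / (\<epsilon> * \<delta> / 2) \<le> R"
    using C D \<epsilon> \<delta> by (auto simp: R_def add_pos_nonneg)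
  have CDR: "C * (D / R) \<le> \<epsilon> * \<delta> / 2"
    using R(1,3) \<epsilon> \<delta> by (simp add: field_simps)
  let ?S = "cball (0::'a) (K + P) \<times> cball (0::'a) (R + 1)"
  define r where "r = \<epsilon> * \<delta> / (16 * (C + 1))"
  have r: "r > 0" "4 * (C * r) \<le> \<epsilon> * \<delta> / 4"
    using C \<epsilon> \<delta> by (auto simp: r_def field_simps)
  have "compact ?S" by (intro compact_Times compact_cball)
  then obtain F where F: "finite F" "F \<subseteq> ?S" "?S \<subseteq> (\<Union>z\<in>F. ball z r)"
    using seq_compact_imp_totally_bounded[of ?S] r(1) unfolding compact_eq_seq_compact_metric by blast
  have "v p \<delta> \<omega> 0 \<le> v p \<delta> \<omega>' 0 + \<epsilon>"
    if \<omega>: "\<omega> \<in> space M" "\<omega>' \<in> space M"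
      and close: "\<forall>i\<in>F. \<bar>(case i of (q, x) \<Rightarrow> H q x) \<omega> - (case i of (q, x) \<Rightarrow> H q x) \<omega>'\<bar> < \<epsilon> * \<delta> / 4" for \<omega> \<omega>'
  proof -
    have "\<delta> * (v p \<delta> \<omega> 0 - v p \<delta> \<omega>' 0) \<le> \<epsilon> * \<delta> / 2 + Lp (K + P) * (2 * (B + 1) / R)"
    proof (rule approx_solution_diff_local[OF ham[OF \<omega>(1)] ham[OF \<omega>(2)] \<delta> _ R(1) B_def _ _
          v_solution[OF \<omega>(1) \<delta>] v_solution[OF \<omega>(2) \<delta>]])
      show "norm p \<le> K" by (simp add: K_def)
      show "2 * Lip K + 2 * (B + 1) / R \<le> P" using R by (simp add: P_def D_def)
      fix q x :: 'a assume "norm q \<le> K + P" "norm x \<le> R + 1"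
      then have qx: "(q, x) \<in> ?S" by simp
      then obtain z where z: "z \<in> F" "(q, x) \<in> ball z r" using F(3) by blast
      obtain q' x' where z_eq: "z = (q', x')" by (cases z)
      have d: "norm (q - q') \<le> r" "norm (x - x') \<le> r"
        using z(2) dist_fst_le[of z "(q, x)"] dist_snd_le[of z "(q, x)"]
        by (auto simp: z_eq dist_norm norm_minus_commute)
      have q': "norm q' \<le> K + P" using F(2) z(1) by (auto simp: z_eq)
      have lip: "\<bar>H q x \<omega>'' - H q' x' \<omega>''\<bar> \<le> 2 * (C * r)" if "\<omega>'' \<in> space M" for \<omega>''
      proof -
        have "\<bar>H q x \<omega>'' - H q' x' \<omega>''\<bar> \<le> Lp (K + P) * (norm (q - q') + norm (x - x'))"
          using hamiltonian.lip[OF ham[OF that], of q "K + P" q' x x'] q' qx by simp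
        also have "\<dots> \<le> C * (r + r)" using d C unfolding C_def by (intro mult_left_mono add_mono) auto
        finally show ?thesis by simp
      qed
      have "\<bar>H q' x' \<omega> - H q' x' \<omega>'\<bar> < \<epsilon> * \<delta> / 4" using close z(1) by (auto simp: z_eq)
      then show "\<bar>H q x \<omega> - H q x \<omega>'\<bar> \<le> \<epsilon> * \<delta> / 2"
        using lip[OF \<omega>(1)] lip[OF \<omega>(2)] r(2) by linarith
    qed (use \<epsilon> \<delta> in simp)
    also have "\<dots> \<le> \<epsilon> * \<delta> / 2 + \<epsilon> * \<delta> / 2"
      by (rule add_left_mono[OF CDR[unfolded C_def D_def]])
    also have "\<dots> = \<delta> * \<epsilon>" by simp
    finally have "\<delta> * (v p \<delta> \<omega> 0 - v p \<delta> \<omega>' 0) \<le> \<delta> * \<epsilon>" .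
    then show ?thesis using \<delta> by simp
  qed
  then show "\<exists>F \<eta>. finite F \<and> \<eta> > 0 \<and> (\<forall>\<omega>\<in>space M. \<forall>\<omega>'\<in>space M.
     (\<forall>i\<in>F. \<bar>(case i of (q, x) \<Rightarrow> H q x) \<omega> - (case i of (q, x) \<Rightarrow> H q x) \<omega>'\<bar> < \<eta>) \<longrightarrow>
        v p \<delta> \<omega> 0 \<le> v p \<delta> \<omega>' 0 + \<epsilon>)"
    using F(1) \<epsilon> \<delta> by (intro exI[of _ F] exI[of _ "\<epsilon> * \<delta> / 4"]) auto
qed

abbreviation limit_value :: "'a \<Rightarrow> 'w \<Rightarrow> ereal" where
  "limit_value p \<omega> \<equiv> Limsup (at_right 0) (\<lambda>\<delta>. ereal (- \<delta> * v p \<delta> \<omega> 0))"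

lemma at_right_pos: "\<forall>\<^sub>F \<delta>::real in at_right 0. \<delta> > 0"
  by (rule eventually_at_right_less)

lemma limit_value_measurable: "limit_value p \<in> borel_measurable M"
proof -
  have cont: "continuous_on {0<..} (\<lambda>\<delta>. - \<delta> * v p \<delta> \<omega> 0)" if \<omega>: "\<omega> \<in> space M" for \<omega>
    unfolding continuous_on_def
  proof
    fix \<delta> :: real assume "\<delta> \<in> {0<..}"
    then have \<delta>: "\<delta> > 0" by simp
    have lim: "((\<lambda>\<delta>'. 2 * (\<bar>\<delta>' - \<delta>\<bar> * Bd (norm p) / \<delta>)) \<longlongrightarrow> 2 * (\<bar>\<delta> - \<delta>\<bar> * Bd (norm p) / \<delta>)) (at \<delta> within {0<..})"
      using \<delta> by (intro tendsto_intros) auto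
    have "((\<lambda>\<delta>'. - \<delta>' * v p \<delta>' \<omega> 0 - (- \<delta> * v p \<delta> \<omega> 0)) \<longlongrightarrow> 0) (at \<delta> within {0<..})"
    proof (rule Lim_null_comparison)
      show "\<forall>\<^sub>F \<delta>' in at \<delta> within {0<..}. norm (- \<delta>' * v p \<delta>' \<omega> 0 - (- \<delta> * v p \<delta> \<omega> 0))
          \<le> 2 * (\<bar>\<delta>' - \<delta>\<bar> * Bd (norm p) / \<delta>)"
        unfolding eventually_at_topological
      proof (intro exI[of _ UNIV] conjI ballI impI)
        fix \<delta>' :: real assume "\<delta>' \<in> {0<..}"
        then have \<delta>': "\<delta>' > 0" by simp
        show "norm (- \<delta>' * v p \<delta>' \<omega> 0 - (- \<delta> * v p \<delta> \<omega> 0)) \<le> 2 * (\<bar>\<delta>' - \<delta>\<bar> * Bd (norm p) / \<delta>)"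
          using hamiltonian.approx_solution_diff_discount[OF ham[OF \<omega>] order_refl \<delta>' \<delta> v_solution[OF \<omega> \<delta>'] v_solution[OF \<omega> \<delta>], of p 0]
          by (simp add: abs_minus_commute)
      qed auto
      show "((\<lambda>\<delta>'. 2 * (\<bar>\<delta>' - \<delta>\<bar> * Bd (norm p) / \<delta>)) \<longlongrightarrow> 0) (at \<delta> within {0<..})" using lim by simp
    qed
    then show "((\<lambda>\<delta>. - \<delta> * v p \<delta> \<omega> 0) \<longlongrightarrow> - \<delta> * v p \<delta> \<omega> 0) (at \<delta> within {0<..})" by (rule LIM_zero_cancel)
  qed
  have "(\<lambda>\<omega>. INF n. SUP r\<in>{r::rat. 0 < r \<and> r < 1 / of_nat (Suc n)}.
      ereal (- of_rat r * v p (of_rat r) \<omega> 0)) \<in> borel_measurable M"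
  proof (intro borel_measurable_INF borel_measurable_SUP)
    fix n :: nat and r :: rat assume "r \<in> {r. 0 < r \<and> r < 1 / of_nat (Suc n)}"
    then have "(of_rat r :: real) > 0" by simp
    from v_measurable[OF this, of p]
    show "(\<lambda>\<omega>. ereal (- of_rat r * v p (of_rat r) \<omega> 0)) \<in> borel_measurable M" by measurable
  qed auto
  then show ?thesis
    by (rule measurable_cong[THEN iffD1, rotated]) (use Limsup_at_right_eq_rational[OF cont] in simp)
qed

text \<open>A translation changes \<open>\<delta> v\<^sup>\<delta> (0)\<close> by at most \<open>\<delta>\<close> times a constant.\<close>

lemma limit_value_invariant:
  assumes \<omega>: "\<omega> \<in> space M"
  shows "limit_value p (\<tau> y \<omega>) = limit_value p \<omega>"
proof -
  have diff: "\<bar>\<delta> * v p \<delta> (\<tau> y \<omega>) 0 - \<delta> * v p \<delta> \<omega> 0\<bar> \<le> \<delta> * (Lip (norm p) * norm y)" if \<delta>: "\<delta> > 0" for \<delta>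
  proof -
    have "\<bar>v p \<delta> \<omega> y - v p \<delta> \<omega> 0\<bar> \<le> Lip (norm p) * norm y"
      using lipschitz_onD[OF v_lipschitz[OF \<omega> \<delta> order_refl], of y 0 p] by (simp add: dist_real_def)
    from mult_left_mono[OF this, of \<delta>] show ?thesis
      using \<delta> v_stationary[OF \<omega> \<delta>, of p y 0] by (simp add: abs_mult flip: right_diff_distrib)
  qed
  have small: "\<forall>\<^sub>F \<delta> in at_right 0. 0 < \<delta> \<and> \<delta> * (Lip (norm p) * norm y) < \<epsilon>" if "\<epsilon> > 0" for \<epsilon> :: real
  proof (rule eventually_conj[OF at_right_pos])
    have "((\<lambda>\<delta>. \<delta> * (Lip (norm p) * norm y)) \<longlongrightarrow> 0 * (Lip (norm p) * norm y)) (at_right 0)"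
      by (intro tendsto_intros)
    then show "\<forall>\<^sub>F \<delta> in at_right 0. \<delta> * (Lip (norm p) * norm y) < \<epsilon>"
      by (rule order_tendstoD) (use that in simp)
  qed
  have "limit_value p (\<tau> y \<omega>) \<le> limit_value p \<omega>"
  proof (rule ereal_le_epsilon2)
    fix \<epsilon> :: real assume "\<epsilon> > 0"
    from small[OF this] have "\<forall>\<^sub>F \<delta> in at_right 0. - \<delta> * v p \<delta> (\<tau> y \<omega>) 0 \<le> - \<delta> * v p \<delta> \<omega> 0 + \<epsilon>"
    proof eventually_elim
      case (elim \<delta>)
      then have "0 < \<delta>" "\<delta> * (Lip (norm p) * norm y) < \<epsilon>" by blast+
      then show ?case using diff[of \<delta>] unfolding mult_minus_left by linarith
    qed
    then show "limit_value p (\<tau> y \<omega>) \<le> limit_value p \<omega> + ereal \<epsilon>"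
      by (intro Limsup_le_add) auto
  qed
  moreover have "limit_value p \<omega> \<le> limit_value p (\<tau> y \<omega>)"
  proof (rule ereal_le_epsilon2)
    fix \<epsilon> :: real assume "\<epsilon> > 0"
    from small[OF this] have "\<forall>\<^sub>F \<delta> in at_right 0. - \<delta> * v p \<delta> \<omega> 0 \<le> - \<delta> * v p \<delta> (\<tau> y \<omega>) 0 + \<epsilon>"
    proof eventually_elim
      case (elim \<delta>)
      then have "0 < \<delta>" "\<delta> * (Lip (norm p) * norm y) < \<epsilon>" by blast+
      then show ?case using diff[of \<delta>] unfolding mult_minus_left by linarith
    qed
    then show "limit_value p \<omega> \<le> limit_value p (\<tau> y \<omega>) + ereal \<epsilon>"
      by (intro Limsup_le_add) auto
  qed
  ultimately show ?thesis by (rule antisym)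
qed

lemma limit_value_finite:
  assumes \<omega>: "\<omega> \<in> space M"
  shows "\<bar>limit_value p \<omega>\<bar> \<noteq> \<infinity>"
proof -
  have "\<forall>\<^sub>F \<delta> in at_right 0. - Bd (norm p) \<le> - \<delta> * v p \<delta> \<omega> 0 \<and> - \<delta> * v p \<delta> \<omega> 0 \<le> Bd (norm p)"
    using at_right_pos
  proof eventually_elim
    case (elim \<delta>) then show ?case using v_bound[OF \<omega> _ order_refl, of \<delta> p 0] by (simp add: abs_le_iff)
  qed
  then have "limit_value p \<omega> \<le> ereal (Bd (norm p))" "ereal (- Bd (norm p)) \<le> limit_value p \<omega>"
    by (auto intro!: Limsup_bounded le_Limsup elim!: eventually_mono)
  then show ?thesis by (cases "limit_value p \<omega>") auto
qed

lemma limit_value_lipschitz: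
  assumes \<omega>: "\<omega> \<in> space M" and R: "norm p1 \<le> R" "norm p2 \<le> R"
  shows "limit_value p1 \<omega> \<le> limit_value p2 \<omega> + ereal (Lp (R + (2 * Lip R + 1)) * norm (p1 - p2))"
proof (rule Limsup_le_add)
  show "\<forall>\<^sub>F \<delta> in at_right 0. - \<delta> * v p1 \<delta> \<omega> 0 \<le> - \<delta> * v p2 \<delta> \<omega> 0 + Lp (R + (2 * Lip R + 1)) * norm (p1 - p2)"
    using at_right_pos
  proof eventually_elim
    case (elim \<delta>)
    from hamiltonian.approx_solution_diff_slope[OF ham[OF \<omega>] R(2,1) elim v_solution[OF \<omega> elim] v_solution[OF \<omega> elim], of 0]
    show ?case by (simp add: right_diff_distrib norm_minus_commute)
  qed
qed simp

text \<open>For each slope in a countable dense set the limit value is almost surely constant, because it is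
  measurable and invariant; the Lipschitz dependence on the slope extends this to all slopes with a
  common exceptional set.\<close>

lemma limit_value_AE_const: "\<exists>h. AE \<omega> in M. \<forall>p. limit_value p \<omega> = ereal (h p)"
proof -
  obtain Q :: "'a set" where Q: "countable Q" "\<And>X. open X \<Longrightarrow> X \<noteq> {} \<Longrightarrow> \<exists>d\<in>Q. d \<in> X"
    using countable_dense_exists by blast
  have "\<forall>p. \<exists>c. AE \<omega> in M. limit_value p \<omega> = c"
    using AE_const_of_invariant[OF limit_value_measurable limit_value_invariant] by blast
  from choice[OF this] obtain c where c: "\<forall>p. AE \<omega> in M. limit_value p \<omega> = c p" ..
  have "AE \<omega> in M. \<forall>p\<in>Q. limit_value p \<omega> = c p"
    using Q(1) c by (simp add: AE_ball_countable)
  then have ae: "AE \<omega> in M. \<omega> \<in> space M \<and> (\<forall>p\<in>Q. limit_value p \<omega> = c p)"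
    using AE_space by eventually_elim (intro conjI)
  obtain \<omega>0 where \<omega>0: "\<omega>0 \<in> space M" "\<forall>p\<in>Q. limit_value p \<omega>0 = c p"
  proof -
    obtain S where S: "S \<subseteq> {\<omega> \<in> space M. \<omega> \<in> space M \<and> (\<forall>p\<in>Q. limit_value p \<omega> = c p)}" "prob S = 1"
      by (rule AE_E_prob[OF ae])
    then have "S \<noteq> {}" by auto
    then show ?thesis using S(1) that by blast
  qed
  have le: "limit_value p \<omega>1 \<le> limit_value p \<omega>2"
    if *: "\<omega>1 \<in> space M" "\<omega>2 \<in> space M" "\<forall>p\<in>Q. limit_value p \<omega>1 = limit_value p \<omega>2" for \<omega>1 \<omega>2 p
  proof (rule ereal_le_epsilon2)
    fix \<epsilon> :: real assume \<epsilon>: "\<epsilon> > 0"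
    define R where "R = norm p + 1"
    define C where "C = Lp (R + (2 * Lip R + 1))"
    have C: "C \<ge> 0" using hamiltonian.Lp_nonneg[OF ham[OF *(1)]] by (simp add: C_def)
    define r where "r = min 1 (\<epsilon> / (2 * (C + 1)))"
    have r: "r > 0" "r \<le> 1" using \<epsilon> C by (auto simp: r_def)
    have Cr: "C * r \<le> \<epsilon> / 2"
    proof -
      have "r \<le> \<epsilon> / (2 * (C + 1))" by (simp add: r_def)
      then have "r * (2 * (C + 1)) \<le> \<epsilon>" using C by (simp add: pos_le_divide_eq)
      then show ?thesis using r by (simp add: algebra_simps)
    qed
    obtain q where q: "q \<in> Q" "q \<in> ball p r" using Q(2)[of "ball p r"] r by auto
    have qR: "norm q \<le> R" "norm p \<le> R"
      using q(2) r norm_triangle_sub[of q p] by (auto simp: R_def dist_norm norm_minus_commute)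
    have "C * norm (p - q) \<le> C * r" using q(2) C by (intro mult_left_mono) (auto simp: dist_norm)
    then have d: "C * norm (p - q) \<le> \<epsilon> / 2" "C * norm (q - p) \<le> \<epsilon> / 2" using Cr by (auto simp: norm_minus_commute)
    have "limit_value p \<omega>1 \<le> limit_value q \<omega>1 + ereal (C * norm (p - q))"
      unfolding C_def by (rule limit_value_lipschitz[OF *(1) qR(2,1)])
    also have "\<dots> \<le> limit_value q \<omega>1 + ereal (\<epsilon> / 2)" using d by (intro add_left_mono) simp
    also have "limit_value q \<omega>1 = limit_value q \<omega>2" using * q(1) by blast
    also have "limit_value q \<omega>2 + ereal (\<epsilon> / 2) \<le> (limit_value p \<omega>2 + ereal (C * norm (q - p))) + ereal (\<epsilon> / 2)"
      unfolding C_def by (intro add_right_mono limit_value_lipschitz[OF *(2) qR])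
    also have "\<dots> \<le> (limit_value p \<omega>2 + ereal (\<epsilon> / 2)) + ereal (\<epsilon> / 2)"
      using d by (intro add_right_mono add_left_mono) simp
    also have "\<dots> = limit_value p \<omega>2 + ereal \<epsilon>" by (simp add: add.assoc)
    finally show "limit_value p \<omega>1 \<le> limit_value p \<omega>2 + ereal \<epsilon>" .
  qed
  have "AE \<omega> in M. \<forall>p. limit_value p \<omega> = ereal (real_of_ereal (limit_value p \<omega>0))"
    using ae
  proof eventually_elim
    case (elim \<omega>)
    then have "limit_value p \<omega> = limit_value p \<omega>0" for p
      using le[of \<omega> \<omega>0 p] le[of \<omega>0 \<omega> p] \<omega>0 by (intro antisym) auto
    then show ?case using limit_value_finite[OF \<omega>0(1)] by (simp add: ereal_real)
  qed
  then show ?thesis by (rule exI[of _ "\<lambda>p. real_of_ereal (limit_value p \<omega>0)"])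
qed

lemma effective_hamiltonian_AE:
  "AE \<omega> in M. \<forall>p. limit_value p \<omega> = ereal (effective_hamiltonian M H p)"
proof -
  obtain h where h: "AE \<omega> in M. \<forall>p. limit_value p \<omega> = ereal (h p)"
    using limit_value_AE_const by blast
  have full: "AE \<omega> in M. \<omega> \<in> \<Omega>1" if "full_probability M \<Omega>1" for \<Omega>1
    using that AE_prob_1 unfolding full_probability_def by blast
  have "\<exists>\<Omega>1. full_probability M \<Omega>1 \<and> (\<forall>p. \<forall>\<omega>\<in>\<Omega>1. limit_value p \<omega> = ereal (h p))"
  proof -
    obtain S where S: "S \<subseteq> {\<omega> \<in> space M. \<forall>p. limit_value p \<omega> = ereal (h p)}" "S \<in> sets M" "prob S = 1"
      by (rule AE_E_prob[OF h])
    then show ?thesis unfolding full_probability_def by (intro exI[of _ S]) blast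
  qed
  moreover have "h' = h" if h': "\<exists>\<Omega>1. full_probability M \<Omega>1 \<and> (\<forall>p. \<forall>\<omega>\<in>\<Omega>1. limit_value p \<omega> = ereal (h' p))" for h'
  proof -
    obtain \<Omega>1 where \<Omega>1: "full_probability M \<Omega>1" "\<forall>p. \<forall>\<omega>\<in>\<Omega>1. limit_value p \<omega> = ereal (h' p)"
      using h' by blast
    have "AE \<omega> in M. \<forall>p. h' p = h p"
      using full[OF \<Omega>1(1)] h
    proof eventually_elim
      case (elim \<omega>)
      show ?case
      proof
        fix p
        have "ereal (h' p) = ereal (h p)" using elim \<Omega>1(2) by metis
        then show "h' p = h p" by simp
      qed
    qed
    then show ?thesis by (auto simp: fun_eq_iff)
  qed
  ultimately have "effective_hamiltonian M H = h"
    unfolding effective_hamiltonian_def by (intro the_equality)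
  then show ?thesis using h by simp
qed

end

section \<open>From the distance to the approximate problem\<close>

context convex_level
begin

text \<open>\<open>\<gamma> q\<close> is the asymptotic cost per step of travelling in steps \<open>q\<close>, uniformly in the starting point.\<close>

definition uniform_rate :: "'a set \<Rightarrow> ('a \<Rightarrow> real) \<Rightarrow> bool" where
  "uniform_rate Q \<gamma> \<longleftrightarrow> (\<forall>q\<in>Q. \<forall>R>0. \<forall>\<eta>>0. \<forall>\<^sub>F n in sequentially. \<forall>x\<in>cball 0 (R * real n).
      \<bar>cost.m x (x + real n *\<^sub>R q) / real n - \<gamma> q\<bar> \<le> \<eta>)"

lemma steps_of_scale:
  assumes "0 < \<delta>" "0 < s" "\<delta> < s / (real N + 1)"
  defines "n \<equiv> nat \<lceil>s / \<delta>\<rceil>"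
  shows "s / \<delta> \<le> real n" "real n \<le> s / \<delta> + 1" "N \<le> n" "1 \<le> n"
proof -
  have "s / \<delta> > 0" using assms by simp
  then show *: "s / \<delta> \<le> real n" "real n \<le> s / \<delta> + 1" unfolding n_def by linarith+
  have "real N + 1 < s / \<delta>" using assms by (simp add: field_simps)
  then show "N \<le> n" "1 \<le> n" using * by linarith+
qed

text \<open>A finite net of steps \<open>q\<close> and the Lipschitz continuity of the distance pass from the rates to all
  displacements \<open>w\<close> of order \<open>1 / \<delta>\<close>.\<close>

lemma m_affine_lower_bound:
  assumes rate: "uniform_rate Q \<gamma>" and dense: "\<And>X :: 'a set. open X \<Longrightarrow> X \<noteq> {} \<Longrightarrow> \<exists>d\<in>Q. d \<in> X"
    and p: "\<And>q. q \<in> Q \<Longrightarrow> p \<bullet> q \<le> \<gamma> q" and pos: "R > 0" "R' > 0" "\<epsilon> > 0"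
  shows "\<forall>\<^sub>F \<delta> in at_right 0. \<forall>y w. norm y \<le> R / \<delta> \<longrightarrow> norm w \<le> R' / \<delta> \<longrightarrow>
      p \<bullet> w - \<epsilon> / \<delta> \<le> cost.m y (y + w)"
proof -
  define \<kappa> where "\<kappa> = norm p + \<Lambda>"
  have \<kappa>: "\<kappa> > 0" using cost.\<Lambda>_ge_1 norm_ge_zero[of p] by (simp add: \<kappa>_def add_nonneg_pos)
  define r where "r = \<epsilon> / (4 * \<kappa>)"
  have r: "r > 0" "\<kappa> * r = \<epsilon> / 4" using \<kappa> pos by (auto simp: r_def)
  have "cball 0 R' \<subseteq> (\<Union>q\<in>Q. ball q r)"
  proof
    fix x :: 'a
    obtain q where "q \<in> Q" "q \<in> ball x r" using dense[of "ball x r"] r by auto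
    then show "x \<in> (\<Union>q\<in>Q. ball q r)" by (auto simp: dist_commute)
  qed
  then obtain F where F: "F \<subseteq> Q" "finite F" "cball 0 R' \<subseteq> (\<Union>q\<in>F. ball q r)"
    using compactE_image[OF compact_cball[of 0 R'], of Q "\<lambda>q. ball q r"] by auto
  have "\<forall>\<^sub>F n in sequentially. \<forall>q\<in>F. \<forall>x\<in>cball 0 (R * real n).
      \<bar>cost.m x (x + real n *\<^sub>R q) / real n - \<gamma> q\<bar> \<le> \<epsilon> / 4"
  proof (rule eventually_ball_finite[OF F(2)], rule ballI)
    fix q assume "q \<in> F"
    then have "q \<in> Q" using F(1) by blast
    moreover have "\<epsilon> / 4 > 0" using pos by simp
    ultimately show "\<forall>\<^sub>F n in sequentially. \<forall>x\<in>cball 0 (R * real n).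
        \<bar>cost.m x (x + real n *\<^sub>R q) / real n - \<gamma> q\<bar> \<le> \<epsilon> / 4"
      using rate pos(1) unfolding uniform_rate_def by blast
  qed
  then obtain N where N: "\<And>n q x. N \<le> n \<Longrightarrow> q \<in> F \<Longrightarrow> x \<in> cball 0 (R * real n) \<Longrightarrow>
      \<bar>cost.m x (x + real n *\<^sub>R q) / real n - \<gamma> q\<bar> \<le> \<epsilon> / 4"
    unfolding eventually_sequentially by blast
  have "\<forall>\<^sub>F \<delta> in at_right 0. \<delta> \<in> {0<..<min 1 (1 / (real N + 1))}"
    by (rule eventually_at_right_real) simp
  then show ?thesis
  proof eventually_elim
    case (elim \<delta>)
    then have "0 < \<delta>" "\<delta> < 1 / (real N + 1)" by auto
    moreover have "1 / (real N + 1) \<le> 1" by simp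
    ultimately have \<delta>: "0 < \<delta>" "\<delta> < 1" "\<delta> < 1 / (real N + 1)" by linarith+
    define n where "n = nat \<lceil>1 / \<delta>\<rceil>"
    note n = steps_of_scale[OF \<delta>(1) zero_less_one \<delta>(3), folded n_def]
    have n0: "real n > 0" using n(4) by simp
    have n2: "real n \<le> 2 / \<delta>" using n(2) \<delta> by (simp add: field_simps)
    show ?case
    proof (intro allI impI)
      fix y w :: 'a assume y: "norm y \<le> R / \<delta>" and w: "norm w \<le> R' / \<delta>"
      have scale: "a / \<delta> \<le> a * real n" if "a > 0" for a
        using mult_left_mono[OF n(1), of a] that by simp
      have yn: "y \<in> cball 0 (R * real n)" using y scale[OF pos(1)] by simp
      have "norm w \<le> R' * real n" using w scale[OF pos(2)] by simp
      then have "norm ((1 / real n) *\<^sub>R w) \<le> R'" using n0 by (simp add: field_simps)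
      then have "(1 / real n) *\<^sub>R w \<in> cball 0 R'" by simp
      then obtain q where q: "q \<in> F" "(1 / real n) *\<^sub>R w \<in> ball q r" using F(3) by blast
      have "real n *\<^sub>R ((1 / real n) *\<^sub>R w - q) = w - real n *\<^sub>R q"
        using n0 by (simp add: scaleR_diff_right)
      then have "norm (w - real n *\<^sub>R q) = real n * norm ((1 / real n) *\<^sub>R w - q)"
        by (metis norm_scaleR abs_of_nat)
      also have "\<dots> \<le> real n * r"
        using q(2) by (intro mult_left_mono) (auto simp: dist_norm norm_minus_commute)
      finally have wq: "norm (w - real n *\<^sub>R q) \<le> real n * r" .
      have "\<bar>cost.m y (y + real n *\<^sub>R q) / real n - \<gamma> q\<bar> \<le> \<epsilon> / 4" by (rule N[OF n(3) q(1) yn])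
      then have "\<gamma> q - \<epsilon> / 4 \<le> cost.m y (y + real n *\<^sub>R q) / real n" by linarith
      then have "p \<bullet> q - \<epsilon> / 4 \<le> cost.m y (y + real n *\<^sub>R q) / real n" using p[of q] F(1) q(1) by fastforce
      then have 1: "real n * (p \<bullet> q - \<epsilon> / 4) \<le> cost.m y (y + real n *\<^sub>R q)"
        using n0 by (simp add: field_simps)
      have 2: "cost.m y (y + real n *\<^sub>R q) \<le> cost.m y (y + w) + \<Lambda> * norm (w - real n *\<^sub>R q)"
        using cost.m_lipschitz[of y "y + real n *\<^sub>R q" y "y + w"] by (simp add: norm_minus_commute abs_le_iff)
      have 3: "p \<bullet> w \<le> real n * (p \<bullet> q) + norm p * norm (w - real n *\<^sub>R q)"
        using norm_cauchy_schwarz[of p "w - real n *\<^sub>R q"] by (simp add: inner_diff_right)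
      have "p \<bullet> w \<le> cost.m y (y + w) + \<kappa> * norm (w - real n *\<^sub>R q) + real n * (\<epsilon> / 4)"
        using 1 2 3 unfolding \<kappa>_def right_diff_distrib distrib_right by linarith
      also have "\<kappa> * norm (w - real n *\<^sub>R q) \<le> \<kappa> * (real n * r)" using wq \<kappa> by simp
      also have "\<kappa> * (real n * r) = real n * (\<epsilon> / 4)" using r(2) by (simp add: mult.left_commute)
      finally have "p \<bullet> w \<le> cost.m y (y + w) + real n * (\<epsilon> / 2)" by (simp add: mult.commute)
      also have "real n * (\<epsilon> / 2) \<le> (2 / \<delta>) * (\<epsilon> / 2)" using n2 pos by (intro mult_right_mono) auto
      finally show "p \<bullet> w - \<epsilon> / \<delta> \<le> cost.m y (y + w)" by simp
    qed
  qed
qed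

text \<open>
  If \<open>p \<bullet> q \<le> \<gamma> q\<close> for all \<open>q\<close>, then \<open>- m y x0\<close>, as a function of \<open>y\<close>, is a subsolution at level \<open>\<mu>\<close>
  that, on a ball of radius of order \<open>1 / \<delta>\<close>, lies below \<open>p \<bullet> (y - x0)\<close> up to \<open>\<epsilon> / \<delta>\<close> and vanishes at \<open>x0\<close>. It is compared with
  \<open>v\<^sup>\<delta> + p \<bullet> (y - x0)\<close>.
\<close>

lemma discounted_upper_bound:
  assumes rate: "uniform_rate Q \<gamma>" and dense: "\<And>X :: 'a set. open X \<Longrightarrow> X \<noteq> {} \<Longrightarrow> \<exists>d\<in>Q. d \<in> X"
    and p: "\<And>q. q \<in> Q \<Longrightarrow> p \<bullet> q \<le> \<gamma> q" and pos: "R > 0" "\<epsilon> > 0"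
    and v: "\<And>\<delta>. \<delta> > 0 \<Longrightarrow> approx_solution H p \<delta> (v \<delta>)"
  shows "\<forall>\<^sub>F \<delta> in at_right 0. \<forall>x\<in>ball 0 (R / \<delta>). - \<delta> * v \<delta> x \<le> \<mu> + \<epsilon>"
proof -
  define K where "K = norm p"
  define b where "b = Bd K"
  have b: "b \<ge> 0" unfolding b_def K_def by (rule Bd_nonneg) simp
  define L where "L = \<Lambda> + norm p + Lip K"
  have LipK: "Lip K > 0" unfolding K_def by (rule Lip_pos) simp
  have L: "\<Lambda> + norm p \<le> L" "Lip K \<le> L" using LipK cost.\<Lambda>_ge_1 by (auto simp: L_def)
  define P where "P = 2 * L + 1"
  define C where "C = Lp (K + P)"
  have C: "C \<ge> 0" by (simp add: C_def Lp_nonneg)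
  define A where "A = 2 * (\<bar>\<mu>\<bar> + b + 1)"
  have A: "A > 0" using b by (simp add: A_def)
  define R' where "R' = A + C * A / (\<epsilon> / 2)"
  have R': "R' > 0" "A \<le> R'" "C * A / (\<epsilon> / 2) \<le> R'" using A C pos by (auto simp: R'_def add_pos_nonneg)
  have CAR: "C * (A / R') \<le> \<epsilon> / 2" using R'(1,3) pos by (simp add: field_simps)
  have e2: "\<epsilon> / 2 > 0" and RR: "R + R' > 0" using pos R' by auto
  have "\<forall>\<^sub>F \<delta> in at_right 0. \<delta> \<in> {0<..<1::real}" by (rule eventually_at_right_real) simp
  then show ?thesis
    using m_affine_lower_bound[OF rate dense p RR R'(1) e2, simplified]
  proof eventually_elim
    case (elim \<delta>)
    then have \<delta>: "0 < \<delta>" "\<delta> < 1" by auto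
    have aff: "p \<bullet> w - \<epsilon> / 2 / \<delta> \<le> cost.m y (y + w)"
      if "norm y \<le> (R + R') / \<delta>" "norm w \<le> R' / \<delta>" for y w
      using elim(2) that by simp
    show ?case
    proof
      fix x0 :: 'a assume "x0 \<in> ball 0 (R / \<delta>)"
      then have x0: "norm x0 \<le> R / \<delta>" by simp
      define k where "k = (\<mu> + \<epsilon> / 2) / \<delta>"
      define u where "u = (\<lambda>y. - cost.m y x0 + ((- p) \<bullet> (y - x0) + (- k)))"
      have u_Lip: "L-lipschitz_on UNIV u"
      proof (rule lipschitz_onI)
        fix y z :: 'a
        have "\<bar>u y - u z\<bar> \<le> \<bar>cost.m y x0 - cost.m z x0\<bar> + \<bar>p \<bullet> (y - z)\<bar>"
          unfolding u_def by (simp add: inner_diff_right)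
        also have "\<dots> \<le> \<Lambda> * norm (y - z) + norm p * norm (y - z)"
          using cost.m_lipschitz[of y x0 z x0] Cauchy_Schwarz_ineq2[of p "y - z"] by simp
        also have "\<dots> \<le> L * norm (y - z)"
          using mult_right_mono[OF L(1), of "norm (y - z)"] by (simp add: distrib_right)
        finally show "dist (u y) (u z) \<le> L * dist y z" by (simp add: dist_real_def dist_norm)
      qed (use L LipK in linarith)
      have v_Lip: "L-lipschitz_on UNIV (v \<delta>)"
        using approx_solution_lipschitz[OF _ \<delta>(1) v[OF \<delta>(1)], of K] L(2)
        by (auto simp: K_def intro: lipschitz_on_mono)
      have u_le: "u y \<le> - \<mu> / \<delta>" if y: "y \<in> cball x0 (R' / \<delta>)" for y
      proof -
        have d: "norm (x0 - y) \<le> R' / \<delta>" using y by (simp add: dist_norm)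
        have "norm y \<le> norm x0 + norm (x0 - y)" by (metis norm_minus_commute norm_triangle_sub)
        then have "norm y \<le> (R + R') / \<delta>" using x0 d by (simp add: add_divide_distrib)
        from aff[OF this d] have "p \<bullet> (x0 - y) - \<epsilon> / 2 / \<delta> \<le> cost.m y x0" by simp
        then show ?thesis unfolding u_def k_def by (simp add: inner_diff_right add_divide_distrib)
      qed
      define B where "B = (\<bar>\<mu>\<bar> + b) / \<delta>"
      have B0: "B \<ge> 0" using b \<delta> by (simp add: B_def)
      have v_ge: "- b \<le> \<delta> * v \<delta> y" for y
        using approx_solution_bound[OF _ \<delta>(1) v[OF \<delta>(1)], of K y] by (simp add: K_def b_def abs_le_iff)
      have slope_le: "2 * (B + 1) / (R' / \<delta>) \<le> A / R'"
      proof -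
        have "2 * (B + 1) / (R' / \<delta>) = 2 * (\<bar>\<mu>\<bar> + b + \<delta>) / R'"
        proof -
          have "B * \<delta> = \<bar>\<mu>\<bar> + b" using \<delta> by (simp add: B_def)
          then have "(B + 1) * \<delta> = \<bar>\<mu>\<bar> + b + \<delta>" by (simp add: distrib_right)
          moreover have "2 * (B + 1) / (R' / \<delta>) = 2 * ((B + 1) * \<delta>) / R'" by simp
          ultimately show ?thesis by (simp only:)
        qed
        also have "\<dots> \<le> A / R'" using \<delta> R'(1) unfolding A_def by (intro divide_right_mono) auto
        finally show ?thesis .
      qed
      have "\<delta> * (u x0 - v \<delta> x0) \<le> 0 + C * (2 * (B + 1) / (R' / \<delta>))"
      proof (rule local_comparison[where ?G1.0 = "\<lambda>q. H (p + q)" and ?G2.0 = "\<lambda>q. H (p + q)" and P = P,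
            OF \<delta>(1) _ C order_refl B0 u_Lip v_Lip])
        show "0 < R' / \<delta>" using R'(1) \<delta>(1) by simp
        fix y assume "y \<in> cball x0 (R' / \<delta>)"
        then have "\<delta> * u y \<le> - \<mu>" using u_le[of y] \<delta>(1) by (simp add: field_simps)
        then have "\<delta> * (u y - v \<delta> y) \<le> \<bar>\<mu>\<bar> + b" using v_ge[of y] unfolding right_diff_distrib by linarith
        then show "u y - v \<delta> y \<le> B" using \<delta>(1) by (simp add: B_def field_simps)
      next
        fix y q assume y: "y \<in> ball x0 (R' / \<delta>)" and q: "q \<in> superjet u y"
        have "q + (p + 0) \<in> superjet (\<lambda>y. u y + (p \<bullet> (y - x0) + k)) y"
          by (intro superjet_add_C1[OF _ q] C1_add C1_inner C1_const)
        moreover have "(\<lambda>y. u y + (p \<bullet> (y - x0) + k)) = (\<lambda>y. - cost.m y x0)"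
          by (simp add: u_def fun_eq_iff)
        ultimately have "p + q \<in> superjet (\<lambda>y. - cost.m y x0) y" by (simp add: add.commute)
        then have "H (p + q) y \<le> \<mu>" by (rule superjet_of_admissible[OF cost.admissible_neg_m])
        moreover have "\<delta> * u y \<le> - \<mu>" using u_le[of y] y \<delta>(1) by (simp add: field_simps)
        ultimately show "\<delta> * u y + H (p + q) y \<le> 0" by linarith
      next
        fix y q assume "q \<in> subjet (v \<delta>) y"
        then show "0 \<le> \<delta> * v \<delta> y + H (p + q) y" by (rule approx_solutionD(4)[OF v[OF \<delta>(1)]])
      next
        fix q1 q2 x y :: 'a assume "norm q1 \<le> P" "norm q2 \<le> P"
        from comp_same[OF _ this, of p K y x]
        show "H (p + q2) y - H (p + q1) x \<le> 0 + C * (norm (q1 - q2) + norm (x - y))"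
          by (simp add: K_def C_def)
      next
        show "2 * L + 2 * (B + 1) / (R' / \<delta>) \<le> P"
        proof -
          have "A / R' \<le> 1" using R' by simp
          then show ?thesis using slope_le unfolding P_def by linarith
        qed
      qed
      also have "\<dots> \<le> C * (A / R')" using mult_left_mono[OF slope_le C] by (simp only: add_0_left)
      also have "\<dots> \<le> \<epsilon> / 2" by (rule CAR)
      finally have "\<delta> * u x0 - \<delta> * v \<delta> x0 \<le> \<epsilon> / 2" by (simp add: right_diff_distrib)
      moreover have "\<delta> * u x0 = - (\<mu> + \<epsilon> / 2)"
      proof -
        have "cost.m x0 x0 = 0" using cost.m_upper[of x0 x0] cost.m_lower[of x0 x0] by simp
        then show ?thesis using \<delta>(1) by (simp add: u_def k_def)
      qed
      ultimately show "- \<delta> * v \<delta> x0 \<le> \<mu> + \<epsilon>" by simp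
    qed
  qed
qed

text \<open>
  If \<open>p \<bullet> q > \<gamma> q\<close> for some \<open>q\<close>, then \<open>- \<delta> v\<^sup>\<delta>\<close> cannot be below \<open>\<mu> - \<epsilon>\<close> anywhere. Near a point where
  it is, \<open>v\<^sup>\<delta> + p \<bullet> x\<close> is a subsolution at level \<open>\<mu>\<close>, so its increment over \<open>n\<close> steps \<open>q\<close> is at most
  about \<open>n \<gamma> q\<close>; going back \<open>n\<close> steps hence raises \<open>v\<^sup>\<delta>\<close> by a multiple of \<open>n\<close>. Iterating this with
  \<open>n\<close> of order \<open>1 / \<delta>\<close> finitely many times contradicts the bound for \<open>\<delta> v\<^sup>\<delta>\<close>.
\<close>

lemma discounted_lower_bound:
  assumes rate: "uniform_rate Q \<gamma>" and q: "q \<in> Q" "\<gamma> q < p \<bullet> q" and pos: "R > 0" "\<epsilon> > 0"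
    and v: "\<And>\<delta>. \<delta> > 0 \<Longrightarrow> approx_solution H p \<delta> (v \<delta>)"
  shows "\<forall>\<^sub>F \<delta> in at_right 0. \<forall>x\<in>ball 0 (R / \<delta>). \<mu> - \<epsilon> \<le> - \<delta> * v \<delta> x"
proof -
  define K where "K = norm p"
  define b where "b = Bd K"
  have b: "b \<ge> 0" unfolding b_def K_def by (rule Bd_nonneg) simp
  define L where "L = Lip K"
  have L: "L > 0" unfolding L_def K_def by (rule Lip_pos) simp
  define c where "c = (p \<bullet> q - \<gamma> q) / 2"
  have c: "c > 0" using q(2) by (simp add: c_def)
  define D where "D = L * (\<Lambda> + 1) * norm q"
  have D: "D \<ge> 0" using L cost.\<Lambda>_ge_1 by (simp add: D_def)
  define s where "s = \<epsilon> / (2 * (D + 1))"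
  have s: "s > 0" using pos D by (simp add: s_def)
  have Ds: "D * s \<le> \<epsilon> / 2"
  proof -
    have "s * (2 * (D + 1)) = \<epsilon>" using D by (simp add: s_def)
    then show ?thesis using s by (simp add: algebra_simps)
  qed
  \<comment> \<open>After \<open>J\<close> rounds of \<open>n\<close> steps, with \<open>\<delta> n\<close> about \<open>s\<close>, the growth exceeds the oscillation \<open>2 b\<close> of \<open>\<delta> v\<^sup>\<delta>\<close>.
    The choice of \<open>s\<close> keeps the variation of \<open>\<delta> v\<^sup>\<delta>\<close> below \<open>\<epsilon>\<close> on the region that cheap chains can reach in one round.\<close>
  obtain J :: nat where J: "2 * b / (c * s) < real J" using reals_Archimedean2 by blast
  then have J: "2 * b < real J * (c * s)" using c s by (simp add: pos_divide_less_eq)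
  define R'' where "R'' = R / s + real J * norm q + 1"
  have R'': "R'' > 0" using pos s by (simp add: R''_def add_nonneg_pos)
  have "\<forall>\<^sub>F n in sequentially. \<forall>x\<in>cball 0 (R'' * real n).
      \<bar>cost.m x (x + real n *\<^sub>R q) / real n - \<gamma> q\<bar> \<le> c"
    using rate q(1) R'' c unfolding uniform_rate_def by blast
  then obtain N where N: "\<And>n x. N \<le> n \<Longrightarrow> x \<in> cball 0 (R'' * real n) \<Longrightarrow>
      \<bar>cost.m x (x + real n *\<^sub>R q) / real n - \<gamma> q\<bar> \<le> c"
    unfolding eventually_sequentially by blast
  have "0 < min (s / (real N + 1)) (\<epsilon> / (2 * (D + L + 1)))" using s pos D L by simp
  then have "\<forall>\<^sub>F \<delta> in at_right 0. \<delta> \<in> {0<..<min (s / (real N + 1)) (\<epsilon> / (2 * (D + L + 1)))}"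
    by (rule eventually_at_right_real)
  then show ?thesis
  proof eventually_elim
    case (elim \<delta>)
    then have \<delta>: "0 < \<delta>" "\<delta> < s / (real N + 1)" "\<delta> < \<epsilon> / (2 * (D + L + 1))" by auto
    define n where "n = nat \<lceil>s / \<delta>\<rceil>"
    note n = steps_of_scale[OF \<delta>(1) s \<delta>(2), folded n_def]
    have n0: "real n > 0" using n(4) by simp
    have n\<delta>: "s \<le> \<delta> * real n" "\<delta> * real n \<le> s + \<delta>"
      using n(1,2) \<delta>(1) by (simp_all add: field_simps)
    have D\<delta>: "D * (\<delta> * real n) + \<delta> * L \<le> \<epsilon>"
    proof -
      have "D * (\<delta> * real n) \<le> D * (s + \<delta>)" using n\<delta> D by (intro mult_left_mono)
      moreover have "\<delta> * (2 * (D + L + 1)) < \<epsilon>" using \<delta>(3) D L by (simp add: pos_less_divide_eq)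
      ultimately show ?thesis using Ds \<delta>(1) by (simp add: algebra_simps)
    qed
    note sol = approx_solutionD[OF v[OF \<delta>(1)]]
    have v_Lip: "L-lipschitz_on UNIV (v \<delta>)"
      using approx_solution_lipschitz[OF _ \<delta>(1) v[OF \<delta>(1)], of K] by (simp add: K_def L_def)
    have v_bd: "\<bar>\<delta> * v \<delta> y\<bar> \<le> b" for y
      using approx_solution_bound[OF _ \<delta>(1) v[OF \<delta>(1)], of K y] by (simp add: K_def b_def)
    have jump: "v \<delta> y + c * real n \<le> v \<delta> (y - real n *\<^sub>R q)"
      if y: "norm (y - real n *\<^sub>R q) \<le> R'' * real n" "- \<mu> + \<epsilon> < \<delta> * v \<delta> y" for y
    proof -
      define x' where "x' = y - real n *\<^sub>R q"
      define \<rho> where "\<rho> = \<Lambda> * (real n * norm q) + 1"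
      define u where "u = (\<lambda>z. v \<delta> z + p \<bullet> (z - 0))"
      have "u y - u x' \<le> cost.m x' y"
      proof (rule local_subsolution_le_m[where \<rho> = \<rho>])
        show "continuous_on UNIV u" unfolding u_def by (intro continuous_intros sol)
        show "\<Lambda> * norm (y - x') < \<rho>" by (simp add: x'_def \<rho>_def)
        fix z q' assume z: "z \<in> ball x' \<rho>" and q': "q' \<in> superjet u z"
        have "q' + (- 1) *\<^sub>R p \<in> superjet (\<lambda>z. u z + (- 1) * (p \<bullet> (z - 0))) z"
          by (intro superjet_add_C1[OF _ q'] C1_cmult C1_inner)
        then have "q' - p \<in> superjet (v \<delta>) z" by (simp add: u_def)
        then have "\<delta> * v \<delta> z + H q' z \<le> 0" using sol(3)[of "q' - p" z] by simp
        moreover have "- \<mu> \<le> \<delta> * v \<delta> z"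
        proof -
          have "norm (y - z) \<le> norm (real n *\<^sub>R q) + norm (x' - z)"
            using norm_triangle_ineq[of "real n *\<^sub>R q" "x' - z"] by (simp add: x'_def)
          also have "\<dots> \<le> real n * norm q + \<rho>" using z by (simp add: dist_norm)
          finally have "norm (y - z) \<le> (\<Lambda> + 1) * (real n * norm q) + 1" by (simp add: \<rho>_def distrib_right)
          then have "L * norm (y - z) \<le> L * ((\<Lambda> + 1) * (real n * norm q) + 1)" using L by (intro mult_left_mono) auto
          also have "\<dots> = D * real n + L" by (simp add: D_def algebra_simps)
          finally have "v \<delta> y - v \<delta> z \<le> D * real n + L"
            using lipschitz_onD[OF v_Lip, of y z] unfolding dist_real_def dist_norm by simp
          then have "\<delta> * (v \<delta> y - v \<delta> z) \<le> \<delta> * (D * real n + L)" using \<delta>(1) by (intro mult_left_mono) auto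
          also have "\<dots> = D * (\<delta> * real n) + \<delta> * L" by (simp add: algebra_simps)
          also have "\<dots> \<le> \<epsilon>" by (rule D\<delta>)
          finally show ?thesis using y(2) by (simp add: right_diff_distrib)
        qed
        ultimately show "H q' z \<le> \<mu>" by linarith
      qed
      moreover have "cost.m x' y \<le> real n * (\<gamma> q + c)"
      proof -
        have "x' \<in> cball 0 (R'' * real n)" using y(1) by (simp add: x'_def)
        from N[OF n(3) this] have "cost.m x' y / real n \<le> \<gamma> q + c" by (simp add: x'_def abs_le_iff)
        then show ?thesis using n0 by (simp add: field_simps)
      qed
      moreover have "u y - u x' = v \<delta> y - v \<delta> x' + real n * (p \<bullet> q)"
        by (simp add: u_def x'_def inner_diff_right)
      moreover have "real n * (p \<bullet> q) = real n * (\<gamma> q + c) + c * real n"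
        unfolding c_def by (simp add: field_simps)
      ultimately show ?thesis unfolding x'_def by linarith
    qed
    show ?case
    proof (rule ballI, rule ccontr)
      fix x :: 'a assume x: "x \<in> ball 0 (R / \<delta>)" and "\<not> \<mu> - \<epsilon> \<le> - \<delta> * v \<delta> x"
      then have vx: "- \<mu> + \<epsilon> < \<delta> * v \<delta> x" by simp
      have iterate: "\<delta> * v \<delta> x + real j * (c * s) \<le> \<delta> * v \<delta> (x - (real j * real n) *\<^sub>R q)" if "j \<le> J" for j
        using that
      proof (induction j)
        case (Suc j)
        define y where "y = x - (real j * real n) *\<^sub>R q"
        have y_next: "y - real n *\<^sub>R q = x - (real (Suc j) * real n) *\<^sub>R q"
          by (simp add: y_def algebra_simps)
        have IH: "\<delta> * v \<delta> x + real j * (c * s) \<le> \<delta> * v \<delta> y" using Suc by (simp add: y_def)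
        have "norm (y - real n *\<^sub>R q) \<le> R'' * real n"
        proof -
          have "norm (y - real n *\<^sub>R q) \<le> norm x + real (Suc j) * real n * norm q"
            unfolding y_next using norm_triangle_ineq4[of x "(real (Suc j) * real n) *\<^sub>R q"]
            by (simp add: abs_mult del: of_nat_Suc)
          also have "norm x \<le> R / \<delta>" using x by simp
          also have "R / \<delta> = (R / s) * (s / \<delta>)" using s by simp
          also have "\<dots> \<le> (R / s) * real n" using n(1) pos s by (intro mult_left_mono) auto
          also have "real (Suc j) * real n * norm q \<le> real J * real n * norm q"
            using Suc.prems by (intro mult_right_mono) auto
          finally show ?thesis using n0 by (simp add: R''_def algebra_simps)
        qed
        moreover have "- \<mu> + \<epsilon> < \<delta> * v \<delta> y"
        proof -
          have "0 \<le> real j * (c * s)" using c s by simp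
          then show ?thesis using IH vx by linarith
        qed
        ultimately have "v \<delta> y + c * real n \<le> v \<delta> (y - real n *\<^sub>R q)" by (rule jump)
        then have "\<delta> * (v \<delta> y + c * real n) \<le> \<delta> * v \<delta> (y - real n *\<^sub>R q)" using \<delta>(1) by simp
        moreover have "c * s \<le> c * (\<delta> * real n)" using n\<delta>(1) c by simp
        ultimately show ?case using IH unfolding y_next by (simp add: algebra_simps)
      qed simp
      from iterate[OF order_refl] v_bd[of x] v_bd[of "x - (real J * real n) *\<^sub>R q"] J
      show False by linarith
    qed
  qed
qed

end

section \<open>Homogenization of convex Hamiltonians\<close>

locale convex_random_hamiltonian = random_hamiltonian_moduli M \<tau> H Bd Lp Cr
  for M :: "'w measure" and \<tau> :: "'a::euclidean_space \<Rightarrow> 'w \<Rightarrow> 'w" and H Bd Lp Cr +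
  fixes \<mu>0 :: real
  assumes convex: "\<And>x \<omega>. \<omega> \<in> space M \<Longrightarrow> convex_on UNIV (\<lambda>q. H q x \<omega>)"
    and low: "\<And>q x \<omega>. \<omega> \<in> space M \<Longrightarrow> norm q \<le> 1 \<Longrightarrow> H q x \<omega> \<le> \<mu>0 - 1"
begin

lemma convex_level:
  assumes "\<omega> \<in> space M" "\<mu>0 \<le> \<mu>"
  shows "convex_level (\<lambda>q x. H q x \<omega>) Bd Lp Cr \<mu>"
proof -
  interpret h: hamiltonian "\<lambda>q x. H q x \<omega>" Bd Lp Cr by (rule ham[OF assms(1)])
  show ?thesis
  proof
    show "convex_on UNIV (\<lambda>q. H q x \<omega>)" for x by (rule convex[OF assms(1)])
    show "H q x \<omega> \<le> \<mu> - 1" if "norm q \<le> 1" for q x using low[OF assms(1) that, of x] assms(2) by simp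
  qed
qed

definition cost :: "real \<Rightarrow> 'w \<Rightarrow> 'a \<Rightarrow> 'a \<Rightarrow> real" where
  "cost \<mu> \<omega> = level_cost (\<lambda>q x. H q x \<omega>) \<mu> (convex_level.C1 Lp Cr \<mu>)"

definition dist_at :: "real \<Rightarrow> 'w \<Rightarrow> 'a \<Rightarrow> 'a \<Rightarrow> real" where
  "dist_at \<mu> \<omega> = chain_dist (cost \<mu> \<omega>)"

lemma step_cost: "\<omega> \<in> space M \<Longrightarrow> \<mu>0 \<le> \<mu> \<Longrightarrow> step_cost (cost \<mu> \<omega>) (convex_level.\<Lambda> Lp Cr \<mu>)"
proof -
  assume "\<omega> \<in> space M" "\<mu>0 \<le> \<mu>"
  then interpret l: convex_level "\<lambda>q x. H q x \<omega>" Bd Lp Cr \<mu> by (rule convex_level)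
  show ?thesis unfolding cost_def by (rule l.cost.step_cost_axioms)
qed

lemma dist_at_stationary:
  assumes "\<omega> \<in> space M"
  shows "dist_at \<mu> (\<tau> z \<omega>) x y = dist_at \<mu> \<omega> (x + z) (y + z)"
proof -
  have "cost \<mu> (\<tau> z \<omega>) = (\<lambda>x y. cost \<mu> \<omega> (x + z) (y + z))"
    unfolding cost_def level_cost_def support_def using stationary[OF assms] by (simp add: fun_eq_iff)
  then show ?thesis unfolding dist_at_def by (simp add: chain_dist_translate)
qed

lemma support_measurable:
  assumes \<mu>: "\<mu>0 \<le> \<mu>"
  shows "(\<lambda>\<omega>. support (\<lambda>q x. H q x \<omega>) \<mu> x e) \<in> borel_measurable M"
  unfolding borel_measurable_iff_greater
proof
  fix a :: real
  obtain Q :: "'a set" where Q: "countable Q" "\<And>X. open X \<Longrightarrow> X \<noteq> {} \<Longrightarrow> \<exists>d\<in>Q. d \<in> X"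
    using countable_dense_exists by blast
  have "{\<omega> \<in> space M. a < support (\<lambda>q x. H q x \<omega>) \<mu> x e} =
      (\<Union>q\<in>{q \<in> Q. a < q \<bullet> e}. {\<omega> \<in> space M. H q x \<omega> < \<mu>})"
  proof (intro equalityI subsetI)
    fix \<omega> assume "\<omega> \<in> {\<omega> \<in> space M. a < support (\<lambda>q x. H q x \<omega>) \<mu> x e}"
    then have \<omega>: "\<omega> \<in> space M" "a < support (\<lambda>q x. H q x \<omega>) \<mu> x e" by auto
    interpret l: convex_level "\<lambda>q x. H q x \<omega>" Bd Lp Cr \<mu> by (rule convex_level[OF \<omega>(1) \<mu>])
    have "\<exists>q. H q x \<omega> \<le> \<mu> \<and> a < q \<bullet> e"
    proof (rule ccontr)
      assume "\<not> ?thesis"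
      then have "support (\<lambda>q x. H q x \<omega>) \<mu> x e \<le> a" by (intro l.support_le) (auto simp: not_less)
      then show False using \<omega>(2) by simp
    qed
    then obtain q where q: "H q x \<omega> \<le> \<mu>" "a < q \<bullet> e" by blast
    have "((\<lambda>t. (1 - t) * (q \<bullet> e)) \<longlongrightarrow> (1 - 0) * (q \<bullet> e)) (at_right 0)" by (intro tendsto_intros)
    then have "\<forall>\<^sub>F t in at_right 0. a < (1 - t) * (q \<bullet> e)" by (rule order_tendstoD(1)) (use q in simp)
    moreover have "\<forall>\<^sub>F t in at_right 0. t \<in> {0<..<1::real}" by (rule eventually_at_right_real) simp
    ultimately obtain t where t: "a < (1 - t) * (q \<bullet> e)" "0 < t" "t < 1"
      using eventually_happens[OF eventually_conj] by force
    \<comment> \<open>Shrinking the slope towards the origin makes the inequality \<open>H \<le> \<mu>\<close> strict.\<close>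
    have "H ((1 - t) *\<^sub>R q + t *\<^sub>R 0) x \<omega> \<le> (1 - t) * H q x \<omega> + t * H 0 x \<omega>"
      using convex_onD[OF convex[OF \<omega>(1), of x], of t q 0] t by simp
    also have "\<dots> \<le> (1 - t) * \<mu> + t * (\<mu> - 1)"
      using q(1) l.low[of 0 x] t by (intro add_mono mult_left_mono) auto
    also have "\<dots> < \<mu>" using t by (simp add: algebra_simps)
    finally have lt: "H ((1 - t) *\<^sub>R q) x \<omega> < \<mu>" by simp
    let ?X = "{q'. H q' x \<omega> < \<mu> \<and> a < q' \<bullet> e}"
    have "continuous_on UNIV (\<lambda>q. H q x \<omega>)"
      unfolding continuous_on_def using l.H_tendsto[OF tendsto_ident_at tendsto_const] by blast
    then have "open ?X" by (intro open_Collect_conj open_Collect_less continuous_on_const continuous_on_inner continuous_on_id)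
    moreover have "(1 - t) *\<^sub>R q \<in> ?X" using lt t(1) by simp
    ultimately obtain q' where "q' \<in> Q" "q' \<in> ?X" using Q(2)[of ?X] by blast
    then show "\<omega> \<in> (\<Union>q\<in>{q \<in> Q. a < q \<bullet> e}. {\<omega> \<in> space M. H q x \<omega> < \<mu>})" using \<omega>(1) by blast
  next
    fix \<omega> assume "\<omega> \<in> (\<Union>q\<in>{q \<in> Q. a < q \<bullet> e}. {\<omega> \<in> space M. H q x \<omega> < \<mu>})"
    then obtain q where q: "a < q \<bullet> e" "\<omega> \<in> space M" "H q x \<omega> < \<mu>" by blast
    interpret l: convex_level "\<lambda>q x. H q x \<omega>" Bd Lp Cr \<mu> by (rule convex_level[OF q(2) \<mu>])
    show "\<omega> \<in> {\<omega> \<in> space M. a < support (\<lambda>q x. H q x \<omega>) \<mu> x e}"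
      using l.support_ge[of q x e] q by simp
  qed
  also have "\<dots> \<in> sets M"
    using Q(1) by (intro sets.countable_UN'' countable_subset[OF _ Q(1)] borel_measurable_less measurable_H) auto
  finally show "{\<omega> \<in> space M. a < support (\<lambda>q x. H q x \<omega>) \<mu> x e} \<in> sets M" .
qed

lemma dist_at_measurable:
  assumes \<mu>: "\<mu>0 \<le> \<mu>"
  shows "(\<lambda>\<omega>. dist_at \<mu> \<omega> x y) \<in> borel_measurable M"
  unfolding borel_measurable_iff_less
proof
  fix a :: real
  obtain Q :: "'a set" where Q: "countable Q" "\<And>X. open X \<Longrightarrow> X \<noteq> {} \<Longrightarrow> \<exists>d\<in>Q. d \<in> X"
    using countable_dense_exists by blast
  have c: "(\<lambda>\<omega>. cost \<mu> \<omega> x y) \<in> borel_measurable M" for x y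
    unfolding cost_def level_cost_def by (intro borel_measurable_add support_measurable[OF \<mu>] borel_measurable_const)
  have chain: "(\<lambda>\<omega>. chain_cost (cost \<mu> \<omega>) x zs y) \<in> borel_measurable M" for x zs
    by (induction zs arbitrary: x) (simp_all add: c borel_measurable_add)
  have "{\<omega> \<in> space M. dist_at \<mu> \<omega> x y < a} = (\<Union>zs\<in>lists Q. {\<omega> \<in> space M. chain_cost (cost \<mu> \<omega>) x zs y < a})"
    unfolding dist_at_def using step_cost.m_less_iff_dense[OF step_cost[OF _ \<mu>] Q(2)] by auto
  also have "\<dots> \<in> sets M"
    using Q(1) by (intro sets.countable_UN'' countable_lists borel_measurable_less chain borel_measurable_const)
  finally show "{\<omega> \<in> space M. dist_at \<mu> \<omega> x y < a} \<in> sets M" .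
qed

lemma dist_at_rate:
  assumes \<mu>: "\<mu>0 \<le> \<mu>"
  shows "\<exists>\<gamma>. AE \<omega> in M. \<forall>R>0. \<forall>\<eta>>0. \<forall>\<^sub>F n in sequentially. \<forall>x\<in>cball 0 (R * real n).
      \<bar>dist_at \<mu> \<omega> x (x + real n *\<^sub>R q) / real n - \<gamma>\<bar> \<le> \<eta>"
proof -
  define \<Lambda> where "\<Lambda> = convex_level.\<Lambda> Lp Cr \<mu>"
  define X where "X = (\<lambda>n \<omega>. dist_at \<mu> \<omega> 0 (real n *\<^sub>R q))"
  note sc = step_cost[OF _ \<mu>, folded \<Lambda>_def]
  note lip = step_cost.m_lipschitz[OF sc, folded dist_at_def]
  note tri = step_cost.m_triangle[OF sc, folded dist_at_def]
  have X_action: "X n (\<tau> x \<omega>) = dist_at \<mu> \<omega> x (x + real n *\<^sub>R q)" if "\<omega> \<in> space M" for n x \<omega>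
    unfolding X_def dist_at_stationary[OF that] by (simp add: add.commute)
  have meas: "X n \<in> borel_measurable M" for n unfolding X_def by (rule dist_at_measurable[OF \<mu>])
  have shift: "\<bar>X n (\<tau> y \<omega>) - X n (\<tau> z \<omega>)\<bar> \<le> (2 * \<Lambda>) * norm (y - z)" if "\<omega> \<in> space M" for n y z \<omega>
    using lip[OF that, of y "y + real n *\<^sub>R q" z "z + real n *\<^sub>R q"] by (simp add: X_action[OF that])
  have "\<exists>\<gamma>. AE \<omega> in M. (\<lambda>n. X n \<omega> / real n) \<longlonglongrightarrow> \<gamma>"
  proof (rule subadditive_AE_limit[where \<Lambda> = "\<Lambda> * norm q" and q = q, OF meas _ _ _ _ shift])
    fix n k :: nat and \<omega> assume \<omega>: "\<omega> \<in> space M"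
    show "0 \<le> X n \<omega>" unfolding X_def
      using step_cost.m_lower[OF sc[OF \<omega>], folded dist_at_def, of "real n *\<^sub>R q" 0] norm_ge_zero order_trans by blast
    show "X n \<omega> \<le> \<Lambda> * norm q * real n" unfolding X_def
      using step_cost.m_upper[OF sc[OF \<omega>], folded dist_at_def, of 0 "real n *\<^sub>R q"] by (simp add: mult_ac)
    show "X (n + k) \<omega> \<le> X n \<omega> + X k (\<tau> (real n *\<^sub>R q) \<omega>)"
      using tri[OF \<omega>, of 0 "real (n + k) *\<^sub>R q" "real n *\<^sub>R q"]
      unfolding X_action[OF \<omega>] unfolding X_def by (simp add: scaleR_add_left)
    show "X n \<omega> \<le> X (n + k) \<omega> + \<Lambda> * norm q * real k"
    proof -
      have "\<bar>X n \<omega> - X (n + k) \<omega>\<bar> \<le> \<Lambda> * norm (real n *\<^sub>R q - real (n + k) *\<^sub>R q)"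
        unfolding X_def using lip[OF \<omega>, of 0 "real n *\<^sub>R q" 0 "real (n + k) *\<^sub>R q"] by simp
      also have "norm (real n *\<^sub>R q - real (n + k) *\<^sub>R q) = real k * norm q"
        by (simp add: scaleR_add_left)
      finally show ?thesis by (simp add: mult_ac abs_le_iff)
    qed
  qed
  then obtain \<gamma> where \<gamma>: "AE \<omega> in M. (\<lambda>n. X n \<omega> / real n) \<longlonglongrightarrow> \<gamma>" by blast
  have "AE \<omega> in M. \<forall>R>0. \<forall>\<eta>>0. \<forall>\<^sub>F n in sequentially. \<forall>x\<in>cball 0 (R * real n).
      \<bar>X n (\<tau> x \<omega>) / real n - \<gamma>\<bar> \<le> \<eta>"
    by (rule AE_uniform_in_vertex[OF meas _ \<gamma>]) (rule shift)
  then have "AE \<omega> in M. \<forall>R>0. \<forall>\<eta>>0. \<forall>\<^sub>F n in sequentially. \<forall>x\<in>cball 0 (R * real n).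
      \<bar>dist_at \<mu> \<omega> x (x + real n *\<^sub>R q) / real n - \<gamma>\<bar> \<le> \<eta>"
    using AE_space
  proof eventually_elim
    case (elim \<omega>)
    then show ?case by (simp only: X_action[OF elim(2)])
  qed
  then show ?thesis by (rule exI[of _ \<gamma>])
qed

text \<open>
  The limit of \<open>- \<delta> v\<^sup>\<delta>\<close> is the infimum of the rational levels \<open>\<mu>\<close> at which \<open>p \<bullet> q \<le> \<gamma> \<mu> q\<close> for all \<open>q\<close>.
  These levels bound \<open>- \<delta> v\<^sup>\<delta>\<close> from above and all other levels above \<open>\<mu>0\<close> bound it from below. Since
  \<open>- \<delta> v\<^sup>\<delta> \<ge> \<mu>0 + 1\<close> for the slopes \<open>p\<close> considered, the restriction to levels above \<open>\<mu>0\<close> is harmless.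
\<close>

lemma homogenization:
  "\<exists>h. AE \<omega> in M. \<forall>p. (\<forall>x. \<mu>0 + 1 \<le> H p x \<omega>) \<longrightarrow> (\<forall>R>0. \<forall>\<epsilon>>0. \<forall>\<^sub>F \<delta> in at_right 0.
     \<forall>x\<in>ball 0 (R / \<delta>). \<bar>h p + \<delta> * v p \<delta> \<omega> x\<bar> \<le> \<epsilon>)"
proof -
  obtain Q :: "'a set" where Q: "countable Q" "\<And>X. open X \<Longrightarrow> X \<noteq> {} \<Longrightarrow> \<exists>d\<in>Q. d \<in> X"
    using countable_dense_exists by blast
  define rate where "rate = (\<lambda>\<mu> q \<gamma> \<omega>. \<forall>R>0. \<forall>\<eta>>0. \<forall>\<^sub>F n in sequentially. \<forall>x\<in>cball 0 (R * real n).
      \<bar>dist_at \<mu> \<omega> x (x + real n *\<^sub>R q) / real n - \<gamma>\<bar> \<le> \<eta>)"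
  define g where "g = (\<lambda>\<mu> q. SOME \<gamma>. AE \<omega> in M. rate \<mu> q \<gamma> \<omega>)"
  have g: "AE \<omega> in M. rate \<mu> q (g \<mu> q) \<omega>" if "\<mu>0 \<le> \<mu>" for \<mu> q
    unfolding g_def using dist_at_rate[OF that, of q] unfolding rate_def by (rule someI_ex)
  define levels where "levels = {r::rat. \<mu>0 \<le> of_rat r}"
  define sub where "sub = (\<lambda>p. {r \<in> levels. \<forall>q\<in>Q. p \<bullet> q \<le> g (of_rat r) q})"
  define h where "h = (\<lambda>p. INF r\<in>sub p. (of_rat r :: real))"
  have "AE \<omega> in M. \<forall>r\<in>levels. \<forall>q\<in>Q. rate (of_rat r) q (g (of_rat r) q) \<omega>"
    using Q(1) g by (intro AE_ball_countable') (auto simp: levels_def)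
  then have "AE \<omega> in M. \<forall>p. (\<forall>x. \<mu>0 + 1 \<le> H p x \<omega>) \<longrightarrow> (\<forall>R>0. \<forall>\<epsilon>>0. \<forall>\<^sub>F \<delta> in at_right 0.
     \<forall>x\<in>ball 0 (R / \<delta>). \<bar>h p + \<delta> * v p \<delta> \<omega> x\<bar> \<le> \<epsilon>)"
    using AE_space
  proof eventually_elim
    case (elim \<omega>)
    note \<omega> = elim(2)
    show ?case
    proof (intro allI impI)
      fix p and R \<epsilon> :: real
      assume p: "\<forall>x. \<mu>0 + 1 \<le> H p x \<omega>" and pos: "R > 0" "\<epsilon> > 0"
      have rate: "convex_level.uniform_rate (\<lambda>q x. H q x \<omega>) Lp Cr (of_rat r) Q (g (of_rat r))" if "r \<in> levels" for r
      proof -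
        interpret l: convex_level "\<lambda>q x. H q x \<omega>" Bd Lp Cr "of_rat r"
          by (rule convex_level[OF \<omega>]) (use that in \<open>simp add: levels_def\<close>)
        show ?thesis
          unfolding l.uniform_rate_def using elim(1) that unfolding rate_def dist_at_def cost_def by blast
      qed
      have upper: "\<forall>\<^sub>F \<delta> in at_right 0. \<forall>x\<in>ball 0 (R / \<delta>). - \<delta> * v p \<delta> \<omega> x \<le> of_rat r + \<eta>"
        if "r \<in> sub p" "\<eta> > 0" for r \<eta>
      proof -
        have r: "r \<in> levels" "\<And>q. q \<in> Q \<Longrightarrow> p \<bullet> q \<le> g (of_rat r) q" using that by (auto simp: sub_def)
        interpret l: convex_level "\<lambda>q x. H q x \<omega>" Bd Lp Cr "of_rat r"
          by (rule convex_level[OF \<omega>]) (use r in \<open>simp add: levels_def\<close>)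
        show ?thesis
          by (rule l.discounted_upper_bound[OF rate[OF r(1)] Q(2) r(2) pos(1) that(2) v_solution[OF \<omega>]])
      qed
      have lower: "\<forall>\<^sub>F \<delta> in at_right 0. \<forall>x\<in>ball 0 (R / \<delta>). of_rat r - \<eta> \<le> - \<delta> * v p \<delta> \<omega> x"
        if "r \<in> levels" "r \<notin> sub p" "\<eta> > 0" for r \<eta>
      proof -
        have "\<exists>q\<in>Q. \<not> p \<bullet> q \<le> g (of_rat r) q" using that unfolding sub_def by blast
        then obtain q where q: "q \<in> Q" "g (of_rat r) q < p \<bullet> q" by (auto simp: not_le)
        interpret l: convex_level "\<lambda>q x. H q x \<omega>" Bd Lp Cr "of_rat r"
          by (rule convex_level[OF \<omega>]) (use that in \<open>simp add: levels_def\<close>)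
        show ?thesis
          by (rule l.discounted_lower_bound[OF rate[OF that(1)] q pos(1) that(3) v_solution[OF \<omega>]])
      qed
      have center: "0 \<in> ball 0 (R / \<delta>)" if "\<delta> > 0" for \<delta> using pos that by simp
      have sub_ge: "\<mu>0 + 1 \<le> of_rat r" if r: "r \<in> sub p" for r
      proof (rule field_le_epsilon)
        fix \<eta> :: real assume "\<eta> > 0"
        obtain \<delta> :: real where \<delta>: "\<delta> > 0" "\<forall>x\<in>ball 0 (R / \<delta>). - \<delta> * v p \<delta> \<omega> x \<le> of_rat r + \<eta>"
          using eventually_happens[OF eventually_conj[OF at_right_pos upper[OF r \<open>\<eta> > 0\<close>]]] by auto
        have "\<delta> * v p \<delta> \<omega> 0 \<le> - (\<mu>0 + 1)"
          using p by (intro hamiltonian.approx_solution_le[OF ham[OF \<omega>] \<delta>(1) v_solution[OF \<omega> \<delta>(1)]]) blast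
        moreover have "- \<delta> * v p \<delta> \<omega> 0 \<le> of_rat r + \<eta>" using \<delta>(2) center[OF \<delta>(1)] by blast
        ultimately show "\<mu>0 + 1 \<le> of_rat r + \<eta>" by simp
      qed
      have nonempty: "sub p \<noteq> {}"
      proof
        assume empty: "sub p = {}"
        obtain r where r: "max \<mu>0 (Bd (norm p) + 1) < of_rat r" "(of_rat r :: real) < max \<mu>0 (Bd (norm p) + 1) + 1"
          using of_rat_dense[of "max \<mu>0 (Bd (norm p) + 1)" "max \<mu>0 (Bd (norm p) + 1) + 1"] by auto
        have "r \<in> levels" "r \<notin> sub p" using r empty by (auto simp: levels_def)
        from eventually_happens[OF eventually_conj[OF at_right_pos lower[OF this zero_less_one]]]
        obtain \<delta> :: real where \<delta>: "\<delta> > 0" "\<forall>x\<in>ball 0 (R / \<delta>). of_rat r - 1 \<le> - \<delta> * v p \<delta> \<omega> x" by auto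
        have "of_rat r - 1 \<le> - \<delta> * v p \<delta> \<omega> 0" using \<delta>(2) center[OF \<delta>(1)] by blast
        then show False using v_bound[OF \<omega> \<delta>(1) order_refl, of p 0] r(1) by (simp add: abs_le_iff)
      qed
      have bdd: "bdd_below ((\<lambda>r. of_rat r :: real) ` sub p)" using sub_ge by (auto intro!: bdd_belowI)
      have h_ge: "\<mu>0 + 1 \<le> h p" unfolding h_def using nonempty sub_ge by (intro cINF_greatest) auto
      obtain r1 where r1: "r1 \<in> sub p" "of_rat r1 < h p + \<epsilon> / 2"
        using cINF_less_iff[OF nonempty bdd, of "h p + \<epsilon> / 2"] pos by (auto simp: h_def)
      obtain r2 where r2: "h p - min 1 (\<epsilon> / 2) < of_rat r2" "of_rat r2 < h p"
        using of_rat_dense[of "h p - min 1 (\<epsilon> / 2)" "h p"] pos by auto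
      have "r2 \<notin> sub p" using r2(2) cINF_lower[OF bdd] unfolding h_def by fastforce
      moreover have "r2 \<in> levels" using r2(1) h_ge by (simp add: levels_def min_def split: if_splits)
      moreover have e2: "\<epsilon> / 2 > 0" using pos by simp
      ultimately have "\<forall>\<^sub>F \<delta> in at_right 0. \<forall>x\<in>ball 0 (R / \<delta>). of_rat r2 - \<epsilon> / 2 \<le> - \<delta> * v p \<delta> \<omega> x"
        using lower by blast
      with upper[OF r1(1) e2]
      show "\<forall>\<^sub>F \<delta> in at_right 0. \<forall>x\<in>ball 0 (R / \<delta>). \<bar>h p + \<delta> * v p \<delta> \<omega> x\<bar> \<le> \<epsilon>"
      proof eventually_elim
        case (elim \<delta>)
        show ?case
        proof
          fix x :: 'a assume x: "x \<in> ball 0 (R / \<delta>)"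
          have "- (\<delta> * v p \<delta> \<omega> x) \<le> of_rat r1 + \<epsilon> / 2" "of_rat r2 - \<epsilon> / 2 \<le> - (\<delta> * v p \<delta> \<omega> x)"
            using elim x by auto
          moreover have "h p - \<epsilon> / 2 < of_rat r2" using r2(1) by linarith
          ultimately show "\<bar>h p + \<delta> * v p \<delta> \<omega> x\<bar> \<le> \<epsilon>" using r1(2) by linarith
        qed
      qed
    qed
  qed
  then show ?thesis by (rule exI[of _ h])
qed

end

section \<open>Transfer to the original Hamiltonian\<close>

text \<open>Where the equation for \<open>Ht\<close> forces the slopes \<open>p + Dv\<close> to leave the ball on which \<open>H\<close> and \<open>Ht\<close> may
  differ, the two equations have the same solution. For a test function touching from above at a
  point where \<open>p + Dv\<close> lies in the ball, the inequality for \<open>H\<close> holds because both Hamiltonians are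
  small there; from below this cannot occur.\<close>

lemma approx_solution_modify:
  assumes h: "hamiltonian Ht Bd Lp Cr" and \<delta>: "\<delta> > 0" and v: "approx_solution Ht p \<delta> v"
    and eq: "\<And>q x. q \<notin> ball 0 R0 \<Longrightarrow> Ht q x = H q x"
    and small: "\<And>q x. q \<in> ball 0 R0 \<Longrightarrow> H q x < a" "\<And>q x. q \<in> ball 0 R0 \<Longrightarrow> Ht q x < a"
    and large: "\<And>x. a \<le> Ht p x"
  shows "approx_solution H p \<delta> v"
proof -
  note D = hamiltonian.approx_solutionD[OF h v]
  have le: "\<delta> * v x \<le> - a" for x by (rule hamiltonian.approx_solution_le[OF h \<delta> v large])
  have "\<delta> * v x + H (p + q) x \<le> 0" if "q \<in> superjet v x" for x q
    using D(3)[OF that] eq[of "p + q" x] small(1)[of "p + q" x] le[of x] by (cases "p + q \<in> ball 0 R0") auto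
  moreover have "\<delta> * v x + H (p + q) x \<ge> 0" if "q \<in> subjet v x" for x q
    using D(4)[OF that] eq[of "p + q" x] small(2)[of "p + q" x] le[of x] by (cases "p + q \<in> ball 0 R0") auto
  ultimately show ?thesis
    using v unfolding approx_solution_def viscosity_solution_def
      viscosity_subsolution_iff_superjet viscosity_supersolution_iff_subjet by auto
qed

theorem proposition9p1:
  fixes M :: "'w measure"
    and \<tau> :: "'a::euclidean_space \<Rightarrow> 'w \<Rightarrow> 'w"
    and H Ht :: "'a \<Rightarrow> 'a \<Rightarrow> 'w \<Rightarrow> real"
    and R0 :: real
  assumes "ergodic_environment M \<tau>"
    and "random_hamiltonian M \<tau> H"
    and "R0 > 0"
    and "random_hamiltonian M \<tau> Ht"
    and "\<And>p y \<omega>. p \<notin> ball 0 R0 \<Longrightarrow> \<omega> \<in> space M \<Longrightarrow> Ht p y \<omega> = H p y \<omega>"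
    and "\<And>y \<omega>. \<omega> \<in> space M \<Longrightarrow> convex_on UNIV (\<lambda>p. Ht p y \<omega>)"
  shows "\<exists>\<Omega>7 U. full_probability M \<Omega>7 \<and> bounded U \<and> open U \<and>
    (\<forall>\<omega>\<in>\<Omega>7. \<forall>p. p \<notin> U \<longrightarrow> (\<forall>R>0.
      ((\<lambda>\<delta>. SUP x\<in>ball 0 (R / \<delta>). \<bar>effective_hamiltonian M H p + \<delta> * v_approx H p \<delta> \<omega> x\<bar>)
        \<longlongrightarrow> 0) (at_right 0)))"
proof -
  interpret e: ergodic_environment M \<tau> by (rule assms(1))
  obtain Bd Lp Cr where H: "\<And>\<omega>. \<omega> \<in> space M \<Longrightarrow> hamiltonian (\<lambda>q x. H q x \<omega>) Bd Lp Cr"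
    using random_hamiltonian.uniform_moduli[OF assms(2)] by blast
  obtain Bd' Lp' Cr' where Ht: "\<And>\<omega>. \<omega> \<in> space M \<Longrightarrow> hamiltonian (\<lambda>q x. Ht q x \<omega>) Bd' Lp' Cr'"
    using random_hamiltonian.uniform_moduli[OF assms(4)] by blast
  interpret h: random_hamiltonian_moduli M \<tau> H Bd Lp Cr
    by (intro random_hamiltonian_moduli.intro random_hamiltonian_moduli_axioms.intro assms H)
  interpret ht: random_hamiltonian_moduli M \<tau> Ht Bd' Lp' Cr'
    by (intro random_hamiltonian_moduli.intro random_hamiltonian_moduli_axioms.intro assms Ht)
  \<comment> \<open>Levels from here on dominate \<open>H\<close> and \<open>Ht\<close> where they may differ, and leave the margin 1 for \<open>Ht\<close>
    on the unit ball.\<close>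
  define \<mu>0 where "\<mu>0 = max (Bd R0) (max (Bd' R0) (Bd' 1 + 1))"
  interpret c: convex_random_hamiltonian M \<tau> Ht Bd' Lp' Cr' \<mu>0
  proof
    show "convex_on UNIV (\<lambda>q. Ht q x \<omega>)" if "\<omega> \<in> space M" for x \<omega> by (rule assms(6)[OF that])
    fix q x :: 'a and \<omega> assume "\<omega> \<in> space M" "norm q \<le> 1"
    then have "\<bar>Ht q x \<omega>\<bar> \<le> Bd' 1" by (intro hamiltonian.bound[OF Ht])
    then show "Ht q x \<omega> \<le> \<mu>0 - 1" unfolding \<mu>0_def by linarith
  qed
  define U :: "'a set" where "U = ball 0 (Cr' (\<mu>0 + 1))"
  have large: "\<mu>0 + 1 \<le> Ht p x \<omega>" if "p \<notin> U" "\<omega> \<in> space M" for p x \<omega>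
    using that hamiltonian.coer[OF Ht, of \<omega> "\<mu>0 + 1" p x] by (simp add: U_def)
  have v_eq: "v_approx H p \<delta> \<omega> = v_approx Ht p \<delta> \<omega>" if "p \<notin> U" "\<omega> \<in> space M" "\<delta> > 0" for p \<omega> \<delta>
  proof (rule h.v_eqI[OF that(2,3)], rule approx_solution_modify[OF Ht[OF that(2)] that(3) ht.v_solution[OF that(2,3)]])
    show "Ht q x \<omega> = H q x \<omega>" if "q \<notin> ball 0 R0" for q x by (rule assms(5)[OF that \<open>\<omega> \<in> space M\<close>])
    show "\<mu>0 + 1 \<le> Ht p x \<omega>" for x by (rule large[OF that(1,2)])
    fix q x :: 'a assume "q \<in> ball 0 R0"
    then have q: "norm q \<le> R0" by simp
    show "H q x \<omega> < \<mu>0 + 1" using hamiltonian.bound[OF H[OF that(2)] q, of x] unfolding \<mu>0_def by linarith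
    show "Ht q x \<omega> < \<mu>0 + 1" using hamiltonian.bound[OF Ht[OF that(2)] q, of x] unfolding \<mu>0_def by linarith
  qed
  obtain l where l: "AE \<omega> in M. \<forall>p. (\<forall>x. \<mu>0 + 1 \<le> Ht p x \<omega>) \<longrightarrow> (\<forall>R>0. \<forall>\<epsilon>>0. \<forall>\<^sub>F \<delta> in at_right 0.
     \<forall>x\<in>ball 0 (R / \<delta>). \<bar>l p + \<delta> * v_approx Ht p \<delta> \<omega> x\<bar> \<le> \<epsilon>)"
    using c.homogenization by blast
  have "AE \<omega> in M. \<forall>p. p \<notin> U \<longrightarrow> (\<forall>R>0.
      ((\<lambda>\<delta>. SUP x\<in>ball 0 (R / \<delta>). \<bar>effective_hamiltonian M H p + \<delta> * v_approx H p \<delta> \<omega> x\<bar>) \<longlongrightarrow> 0) (at_right 0))"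
    using l h.effective_hamiltonian_AE AE_space
  proof eventually_elim
    case (elim \<omega>)
    show ?case
    proof (intro allI impI)
      fix p and R :: real assume p: "p \<notin> U" and R: "R > 0"
      have conv: "\<forall>\<^sub>F \<delta> in at_right 0. \<forall>x\<in>ball 0 (R / \<delta>). \<bar>l p + \<delta> * v_approx H p \<delta> \<omega> x\<bar> \<le> \<epsilon>" if "\<epsilon> > 0" for \<epsilon>
      proof -
        have "\<forall>\<^sub>F \<delta> in at_right 0. \<forall>x\<in>ball 0 (R / \<delta>). \<bar>l p + \<delta> * v_approx Ht p \<delta> \<omega> x\<bar> \<le> \<epsilon>"
          using elim(1) large[OF p elim(3)] R that by blast
        with h.at_right_pos show ?thesis
          by eventually_elim (simp add: v_eq[OF p elim(3)])
      qed
      have "((\<lambda>\<delta>. - \<delta> * v_approx H p \<delta> \<omega> 0) \<longlongrightarrow> l p) (at_right 0)"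
      proof (rule tendstoI)
        fix \<epsilon> :: real assume \<epsilon>: "\<epsilon> > 0"
        then have "\<epsilon> / 2 > 0" by simp
        from conv[OF this] h.at_right_pos
        show "\<forall>\<^sub>F \<delta> in at_right 0. dist (- \<delta> * v_approx H p \<delta> \<omega> 0) (l p) < \<epsilon>"
        proof eventually_elim
          case (elim \<delta>)
          then have "0 \<in> ball (0::'a) (R / \<delta>)" using R by simp
          then have "\<bar>l p + \<delta> * v_approx H p \<delta> \<omega> 0\<bar> \<le> \<epsilon> / 2" using elim(1) by blast
          then show ?case using \<epsilon> unfolding dist_real_def mult_minus_left by linarith
        qed
      qed
      then have "((\<lambda>\<delta>. ereal (- \<delta> * v_approx H p \<delta> \<omega> 0)) \<longlongrightarrow> ereal (l p)) (at_right 0)" by simp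
      then have "h.limit_value p \<omega> = ereal (l p)" by (intro lim_imp_Limsup) auto
      moreover have "h.limit_value p \<omega> = ereal (effective_hamiltonian M H p)" using elim(2) by blast
      ultimately have l_eq: "l p = effective_hamiltonian M H p" by simp
      show "((\<lambda>\<delta>. SUP x\<in>ball 0 (R / \<delta>). \<bar>effective_hamiltonian M H p + \<delta> * v_approx H p \<delta> \<omega> x\<bar>) \<longlongrightarrow> 0) (at_right 0)"
      proof (rule tendstoI)
        fix \<epsilon> :: real assume \<epsilon>: "\<epsilon> > 0"
        then have "\<epsilon> / 2 > 0" by simp
        from conv[OF this] h.at_right_pos
        show "\<forall>\<^sub>F \<delta> in at_right 0. dist (SUP x\<in>ball 0 (R / \<delta>). \<bar>effective_hamiltonian M H p + \<delta> * v_approx H p \<delta> \<omega> x\<bar>) 0 < \<epsilon>"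
        proof eventually_elim
          case (elim \<delta>)
          let ?f = "\<lambda>x. \<bar>effective_hamiltonian M H p + \<delta> * v_approx H p \<delta> \<omega> x\<bar>"
          have le: "?f x \<le> \<epsilon> / 2" if "x \<in> ball 0 (R / \<delta>)" for x using elim(1) that unfolding l_eq by blast
          have center: "0 \<in> ball (0::'a) (R / \<delta>)" using R elim(2) by simp
          have "(SUP x\<in>ball 0 (R / \<delta>). ?f x) \<le> \<epsilon> / 2" using center le by (intro cSUP_least) auto
          moreover have "?f 0 \<le> (SUP x\<in>ball 0 (R / \<delta>). ?f x)"
            using le by (intro cSUP_upper[OF center] bdd_aboveI2[of _ _ "\<epsilon> / 2"])
          ultimately show ?case using \<epsilon> abs_ge_zero[of "effective_hamiltonian M H p + \<delta> * v_approx H p \<delta> \<omega> 0"]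
            unfolding dist_real_def by linarith
        qed
      qed
    qed
  qed
  then obtain S where "S \<subseteq> {\<omega> \<in> space M. \<forall>p. p \<notin> U \<longrightarrow> (\<forall>R>0.
      ((\<lambda>\<delta>. SUP x\<in>ball 0 (R / \<delta>). \<bar>effective_hamiltonian M H p + \<delta> * v_approx H p \<delta> \<omega> x\<bar>) \<longlongrightarrow> 0) (at_right 0))}"
    "S \<in> sets M" "e.prob S = 1"
    by (rule e.AE_E_prob)
  moreover have "bounded U" "open U" by (simp_all add: U_def)
  ultimately show ?thesis unfolding full_probability_def by (intro exI[of _ S] exI[of _ U]) blast
qed

end
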